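(* Let $d_1,d_2,t$ be positive integers with $d_1d_2\neq1$ and let $\varepsilon>0$. There is a constant $C=C(d_1,d_2,t,\varepsilon)>0$ such that the following holds. Let $P$ be a set of $m$ points in $\mathbb{R}^{d_1}$, let $Q$ be a set of $n$ points in $\mathbb{R}^{d_2}$, let $G=(P,Q,\mathcal{E})$ be a bipartite semi-algebraic graph with description complexity $t$, and let $I=|\mathcal{E}|$ be its number of edges. If $$I\ge C\left(m^{\frac{d_1d_2-d_2}{d_1d_2-1}+\varepsilon}\, n^{\frac{d_1d_2-d_1}{d_1d_2-1}+\varepsilon}+m^{1+\varepsilon}+n^{1+\varepsilon}\right),$$ then $G$ contains a complete bipartite subgraph $K_{u_1,u_2}$ with $$u_1u_2\ge\min\left\{\left(\frac{I}{m^{\frac{d_1d_2-d_2}{d_1d_2-1}+\varepsilon}\,n^{\frac{d_1d_2-d_1}{d_1d_2-1}+\varepsilon}}\right)^2,\ \frac{I^2}{n^{2+2\varepsilon}},\ \frac{I^2}{m^{2+2\varepsilon}}\right\}.$$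
   Context: A bipartite graph $G=(P,Q,\mathcal{E})$ has parts $P,Q$ and edge set $\mathcal{E}\subset P\times Q$. $K_{u_1,u_2}$ denotes the complete bipartite graph with parts of sizes $u_1$ and $u_2$. Semi-algebraic graph: for finite $P\subset\mathbb{R}^{d_1}$, $Q\subset\mathbb{R}^{d_2}$, the graph $G=(P,Q,\mathcal{E})$ is semi-algebraic with description complexity $t$ if there are $t$ polynomials $f_1,\dots,f_t\in\mathbb{R}[x_1,\dots,x_{d_1+d_2}]$, each of degree at most $t$, and a Boolean function $\Phi:\{\pm1\}^t\to\{\pm1\}$ such that for all $p\in P$, $q\in Q$: $(p,q)\in\mathcal{E}\iff\Phi(f_1(p,q)\ge 0,\dots,f_t(p,q)\ge 0)=1$, where each condition $f_j(p,q)\ge0$ is read as its truth value ($1$ if true, $-1$ if false). *)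

theory Defs
  imports "HOL-Analysis.Analysis" "HOL-Library.Poly_Mapping"
begin

text \<open>
  Real polynomials with variables indexed by \<open>'v\<close>: finitely supported families of
  coefficients, indexed by monomials, which are finitely supported families of exponents.
\<close>

type_synonym 'v real_mpoly = "('v \<Rightarrow>\<^sub>0 nat) \<Rightarrow>\<^sub>0 real"

definition monom_value :: "('v \<Rightarrow>\<^sub>0 nat) \<Rightarrow> ('v \<Rightarrow> real) \<Rightarrow> real" where
  "monom_value \<mu> x = (\<Prod>i\<in>Poly_Mapping.keys \<mu>. x i ^ Poly_Mapping.lookup \<mu> i)"

definition mpoly_value :: "'v real_mpoly \<Rightarrow> ('v \<Rightarrow> real) \<Rightarrow> real" where
  "mpoly_value f x =
     (\<Sum>\<mu>\<in>Poly_Mapping.keys f. Poly_Mapping.lookup f \<mu> * monom_value \<mu> x)"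

definition monom_degree :: "('v \<Rightarrow>\<^sub>0 nat) \<Rightarrow> nat" where
  "monom_degree \<mu> = (\<Sum>i\<in>Poly_Mapping.keys \<mu>. Poly_Mapping.lookup \<mu> i)"

text \<open>The zero polynomial gets total degree 0.\<close>

definition mpoly_degree :: "'v real_mpoly \<Rightarrow> nat" where
  "mpoly_degree f = Max (insert 0 (monom_degree ` Poly_Mapping.keys f))"

text \<open>
  The parts of a bipartite graph may intersect as sets (for instance when both lie in the
  same space); an edge \<open>(p, q)\<close> joins \<open>p\<close> taken in the first part to \<open>q\<close> taken in the second.
\<close>

definition bipartite_graph :: "'p set \<Rightarrow> 'q set \<Rightarrow> ('p \<times> 'q) set \<Rightarrow> bool" where
  "bipartite_graph P Q E \<longleftrightarrow> finite P \<and> finite Q \<and> E \<subseteq> P \<times> Q"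

definition contains_complete_bipartite ::
    "'p set \<Rightarrow> 'q set \<Rightarrow> ('p \<times> 'q) set \<Rightarrow> nat \<Rightarrow> nat \<Rightarrow> bool" where
  "contains_complete_bipartite P Q E u\<^sub>1 u\<^sub>2 \<longleftrightarrow>
     (\<exists>A B. A \<subseteq> P \<and> B \<subseteq> Q \<and> card A = u\<^sub>1 \<and> card B = u\<^sub>2 \<and> A \<times> B \<subseteq> E)"

text \<open>
  The $d_1 + d_2$ variables are indexed by the sum type \<open>'a + 'b\<close>: those in \<open>'a\<close> are the
  coordinates of the first point, those in \<open>'b\<close> the coordinates of the second.
\<close>

definition eval_pair :: "('a + 'b) real_mpoly \<Rightarrow> real ^ 'a \<Rightarrow> real ^ 'b \<Rightarrow> real" where
  "eval_pair f p q = mpoly_value f (case_sum (\<lambda>i. p $ i) (\<lambda>j. q $ j))"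

text \<open>
  The truth values $1$ and $-1$ are rendered as \<open>True\<close> and \<open>False\<close>. The Boolean function \<open>\<Phi>\<close> of
  \<open>t\<close> arguments takes them as a list; only its values on lists of length \<open>t\<close> matter. The
  polynomials in \<open>fs\<close> need not be distinct.
\<close>

definition semialgebraic_graph ::
    "nat \<Rightarrow> (real ^ 'a) set \<Rightarrow> (real ^ 'b) set \<Rightarrow> ((real ^ 'a) \<times> (real ^ 'b)) set \<Rightarrow> bool" where
  "semialgebraic_graph t P Q E \<longleftrightarrow>
     bipartite_graph P Q E \<and>
     (\<exists>(fs :: ('a + 'b) real_mpoly list) (\<Phi> :: bool list \<Rightarrow> bool).
        length fs = t \<and> (\<forall>f\<in>set fs. mpoly_degree f \<le> t) \<and>
        (\<forall>p\<in>P. \<forall>q\<in>Q. (p, q) \<in> E \<longleftrightarrow> \<Phi> (map (\<lambda>f. eval_pair f p q \<ge> 0) fs)))"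

end

theory Submission
  imports Defs
begin

text \<open>
  Write $m = |P|$, $n = |Q|$. If $d_1, d_2 \ge 3$, the star at a vertex of maximum degree is already
  large enough, because then $2\alpha + 2\beta \ge 3$ and $2\alpha, 2\beta \ge 1$. Otherwise one of the
  dimensions, say $d_1$, is $\kappa \in \{1, 2\}$. Any $r$ points of \<open>Q\<close> then split \<open>P\<close> into
  $O(r^\kappa)$ classes of equal neighbourhoods, so a random sample of \<open>Q\<close> shows that among any $i$
  points of \<open>P\<close> some two have neighbourhoods differing in $O(n \, i^{-1/\kappa} \log i)$ points.
  Greedily joining paths at their closest end points gives an ordering of \<open>P\<close> along which the
  neighbourhood changes $X = O(n\, m^{1 - 1/\kappa} \log^2 m)$ times in total. Cutting this ordering into
  blocks of length about $I / 2X$, at least half of the edges lie in products of a block with its common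
  neighbourhood, so one of these products has size of order $I^2 / (m X)$. The logarithms are absorbed
  by \<open>\<epsilon>\<close>, and the case of small \<open>m\<close> and \<open>n\<close> is excluded by choosing \<open>C\<close> large.

  The count of classes in the plane needs that the sign of a polynomial along a branch of a curve changes
  boundedly often, uniformly in the coefficients. This follows from the Cohen--Hoermander method of
  quantifier elimination: the arrangement on a vertical line of the zeros of a finite family of
  polynomials, closed under derivatives and remainders, is determined by the signs of its members of degree 0.
\<close>

text \<open>Every entry of the minimum is I^2 / exp z with z linear in ln m and ln n. It is
  therefore enough to bound the logarithm of the denominator found for a biclique, (2 - 1/\<kappa>)
  ln m + ln n up to small terms, by one of three linear forms; which one depends on the ratio of the
  logarithms. For \<kappa> = 2 all of them agree on m = n^2, up to \<epsilon>, because 2 \<alpha> +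
  \<beta> = 2. The obstacle is uniformity: the classes in the plane have to number O(r^2) with a
  constant depending on t alone, although the polynomials come from arbitrary points of the other
  side. Hence the coefficients are treated as parameters, and the sign diagram is analysed once for
  generic polynomials. Replacing the parameters by polynomials in the abscissa then leaves a bounded
  number of polynomials of bounded degree. The square in r^2 arises from about r curves, each with
  boundedly many branches, along each of which r signs change O(r) times altogether.\<close>

section \<open>Order isomorphisms preserving signs\<close>

text \<open>The piecewise linear bijection of the line that moves \<open>u\<close> to
  \<open>v\<close> inside (c, d) and fixes everything outside. It corrects the position of one zero
  without disturbing what lies beyond the gap.\<close>

definition bend :: "real \<Rightarrow> real \<Rightarrow> real \<Rightarrow> real \<Rightarrow> real \<Rightarrow> real" where
  "bend c d u v y =
     (if y \<le> c \<or> d \<le> y then y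
      else if y \<le> u then c + (y - c) * ((v - c) / (u - c))
      else d - (d - y) * ((d - v) / (d - u)))"

lemma bend_at: "c < u \<Longrightarrow> u < d \<Longrightarrow> bend c d u v u = v"
  by (simp add: bend_def)

lemma bend_outside: "y \<le> c \<or> d \<le> y \<Longrightarrow> bend c d u v y = y"
  by (simp add: bend_def)

lemma bend_left:
  assumes "c < u" "u < d" "c < v" "v < d" "c < y" "y \<le> u"
  shows "bend c d u v y = c + (y - c) * ((v - c) / (u - c))"
    and "c < bend c d u v y" and "bend c d u v y \<le> v"
proof -
  show eq: "bend c d u v y = c + (y - c) * ((v - c) / (u - c))"
    using assms by (simp add: bend_def)
  show "c < bend c d u v y" unfolding eq using assms by simp
  have "(y - c) * ((v - c) / (u - c)) \<le> (u - c) * ((v - c) / (u - c))"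
    using assms by (intro mult_right_mono) auto
  then show "bend c d u v y \<le> v" unfolding eq using assms by simp
qed

lemma bend_right:
  assumes "c < u" "u < d" "c < v" "v < d" "u < y" "y < d"
  shows "bend c d u v y = d - (d - y) * ((d - v) / (d - u))"
    and "v < bend c d u v y" and "bend c d u v y < d"
proof -
  show eq: "bend c d u v y = d - (d - y) * ((d - v) / (d - u))"
    using assms by (simp add: bend_def)
  show "bend c d u v y < d" unfolding eq using assms by simp
  have "(d - y) * ((d - v) / (d - u)) < (d - u) * ((d - v) / (d - u))"
    using assms by (intro mult_strict_right_mono) auto
  then show "v < bend c d u v y" unfolding eq using assms by simp
qed

text \<open>Each linear piece is undone by the corresponding piece with \<open>u\<close> and
  \<open>v\<close> exchanged. Injectivity and surjectivity both come from here.\<close>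

lemma bend_inverse:
  assumes "c < u" "u < d" "c < v" "v < d"
  shows "bend c d v u (bend c d u v y) = y"
proof -
  consider "y \<le> c \<or> d \<le> y" | "c < y" "y \<le> u" | "u < y" "y < d" by linarith
  then show ?thesis
  proof cases
    case 1 then show ?thesis by (simp add: bend_outside)
  next
    case 2
    note l = bend_left[OF assms 2]
    show ?thesis
      using bend_left(1)[OF assms(3,4,1,2) l(2,3)] l(1) assms by simp
  next
    case 3
    note r = bend_right[OF assms 3]
    show ?thesis
      using bend_right(1)[OF assms(3,4,1,2) r(2,3)] r(1) assms by simp
  qed
qed

lemma bend_strict_mono:
  assumes "c < u" "u < d" "c < v" "v < d"
  shows "strict_mono (bend c d u v)"
proof (rule strict_monoI)
  fix x y :: real assume xy: "x < y"
  \<comment> \<open>The pieces give weak monotonicity only; strictness then follows from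
    injectivity, that is from \<open>bend_inverse\<close>.\<close>
  have le: "bend c d u v x \<le> bend c d u v y"
  proof -
    consider "x \<le> c" | "d \<le> x" | "c < x" "x \<le> u" | "u < x" "x < d" by linarith
    then show ?thesis
    proof cases
      case 1
      have "c \<le> bend c d u v y" if "c < y"
        using that bend_left(2)[OF assms, of y] bend_right(2)[OF assms, of y]
          bend_outside[of y c d u v] assms by linarith
      then show ?thesis using 1 xy bend_outside[of x c d u v] bend_outside[of y c d u v]
        by (cases "y \<le> c") auto
    next
      case 2 then show ?thesis using xy bend_outside[of x c d u v] bend_outside[of y c d u v] by auto
    next
      case 3
      show ?thesis
      proof (cases "y \<le> u")
        case True
        have "(x - c) * ((v - c) / (u - c)) \<le> (y - c) * ((v - c) / (u - c))"
          using assms xy by (intro mult_right_mono) auto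
        then show ?thesis
          using bend_left(1)[OF assms 3] bend_left(1)[OF assms _ True] 3 xy by linarith
      next
        case False
        then show ?thesis
          using bend_left(3)[OF assms 3] bend_right(2)[OF assms, of y]
            bend_outside[of y c d u v] assms by linarith
      qed
    next
      case 4
      show ?thesis
      proof (cases "y < d")
        case True
        have "(d - y) * ((d - v) / (d - u)) \<le> (d - x) * ((d - v) / (d - u))"
          using assms xy by (intro mult_right_mono) auto
        then show ?thesis
          using bend_right(1)[OF assms 4] bend_right(1)[OF assms _ True] 4 xy by linarith
      next
        case False
        then show ?thesis
          using bend_right(3)[OF assms 4] bend_outside[of y c d u v] by auto
      qed
    qed
  qed
  moreover have "bend c d u v x \<noteq> bend c d u v y"
    using bend_inverse[OF assms, of x] bend_inverse[OF assms, of y] xy by auto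
  ultimately show "bend c d u v x < bend c d u v y" by simp
qed

lemma bend_surj:
  assumes "c < u" "u < d" "c < v" "v < d"
  shows "surj (bend c d u v)"
  using bend_inverse[OF assms(3,4,1,2)] by (metis surj_def)

section \<open>Signs of a real polynomial between zeros and at infinity\<close>

lemma poly_sgn_constant:
  fixes p :: "real poly"
  assumes "x \<le> y" and "\<And>z. x \<le> z \<Longrightarrow> z \<le> y \<Longrightarrow> poly p z \<noteq> 0"
  shows "sgn (poly p x) = sgn (poly p y)"
proof (cases "x = y")
  case False
  with assms have xy: "x < y" by simp
  have nz: "poly p x \<noteq> 0" "poly p y \<noteq> 0" using assms by auto
  have "\<not> (poly p x < 0 \<and> 0 < poly p y)"
    using poly_IVT_pos[OF xy, of p] assms(2) by (meson less_imp_le)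
  moreover have "\<not> (poly p x > 0 \<and> 0 > poly p y)"
    using poly_IVT_neg[OF xy, of p] assms(2) by (meson less_imp_le)
  ultimately show ?thesis using nz by (auto simp: sgn_if)
qed simp

lemma poly_sgn_constant':
  fixes p :: "real poly"
  assumes "\<And>z. min x y \<le> z \<Longrightarrow> z \<le> max x y \<Longrightarrow> poly p z \<noteq> 0"
  shows "sgn (poly p x) = sgn (poly p y)"
proof (cases "x \<le> y")
  case True
  then show ?thesis using poly_sgn_constant[of x y p] assms by (simp add: min_def max_def)
next
  case False
  then show ?thesis using poly_sgn_constant[of y x p] assms by (simp add: min_def max_def)
qed

text \<open>The mean value theorem on both sides of the zero \<open>w\<close> expresses
  \<open>poly p a\<close> and \<open>poly p b\<close> through values of the derivative, with
  opposite signs in front, and the derivative has one sign on (a, b).\<close>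

lemma poly_sgn_opposite:
  fixes p :: "real poly"
  assumes "a < w" "w < b" "poly p w = 0"
    and nz: "\<And>z. a < z \<Longrightarrow> z < b \<Longrightarrow> poly (pderiv p) z \<noteq> 0"
  shows "poly p a * poly p b < 0"
proof -
  obtain x where x: "a < x" "x < w" "poly p w - poly p a = (w - a) * poly (pderiv p) x"
    using poly_MVT[OF assms(1)] by blast
  obtain y where y: "w < y" "y < b" "poly p b - poly p w = (b - w) * poly (pderiv p) y"
    using poly_MVT[OF assms(2)] by blast
  have "sgn (poly (pderiv p) x) = sgn (poly (pderiv p) y)"
    using x y by (intro poly_sgn_constant nz) auto
  moreover have "poly (pderiv p) x \<noteq> 0" using x y by (intro nz) auto
  ultimately have "poly (pderiv p) x * poly (pderiv p) y > 0"
    by (auto simp: sgn_if zero_less_mult_iff split: if_splits)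
  then have "(w - a) * (b - w) * (poly (pderiv p) x * poly (pderiv p) y) > 0"
    using assms by simp
  moreover have "poly p a = - ((w - a) * poly (pderiv p) x)" "poly p b = (b - w) * poly (pderiv p) y"
    using x y assms by auto
  ultimately show ?thesis by (simp only: mult_minus_left) (simp add: mult_ac)
qed

lemma poly_zero_between:
  fixes p :: "real poly"
  assumes "a < b" "poly p a * poly p b < 0"
  shows "\<exists>w. a < w \<and> w < b \<and> poly p w = 0"
  using assms poly_IVT[of a b p] by blast

lemma poly_sgn_at_top:
  fixes p :: "real poly"
  assumes "p \<noteq> 0"
  shows "\<exists>R. \<forall>y\<ge>R. sgn (poly p y) = sgn (lead_coeff p)"
proof (cases "lead_coeff p > 0")
  case True
  then show ?thesis using poly_pinfty_gt_lc[OF True]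
    by (metis less_le_trans sgn_pos)
next
  case False
  with assms have "lead_coeff (-p) > 0" by (simp add: leading_coeff_neq_0 not_less order_less_le)
  then obtain R where "\<forall>y\<ge>R. poly (-p) y \<ge> lead_coeff (-p)" using poly_pinfty_gt_lc by blast
  with \<open>lead_coeff (-p) > 0\<close> have "\<forall>y\<ge>R. poly p y < 0" by fastforce
  then show ?thesis using \<open>lead_coeff (-p) > 0\<close> by (intro exI[of _ R]) (auto simp: sgn_if)
qed

lemma poly_sgn_at_bot:
  fixes p :: "real poly"
  assumes "p \<noteq> 0"
  shows "\<exists>L. \<forall>y\<le>L. sgn (poly p y) = sgn (lead_coeff p) * (- 1) ^ degree p"
proof -
  \<comment> \<open>Replacing y by -y turns minus infinity into plus infinity and multiplies the
    leading coefficient by (-1)^degree.\<close>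
  let ?q = "pcompose p [:0, -1:]"
  have "?q \<noteq> 0" using assms by (simp add: pcompose_eq_0_iff)
  then obtain R where R: "\<forall>y\<ge>R. sgn (poly ?q y) = sgn (lead_coeff ?q)"
    using poly_sgn_at_top by blast
  have "lead_coeff ?q = lead_coeff p * (- 1) ^ degree p"
    by (subst lead_coeff_comp) auto
  then have "sgn (poly p y) = sgn (lead_coeff p) * (- 1) ^ degree p" if "y \<le> - R" for y
    using that R[rule_format, of "- y"] by (simp add: poly_pcompose sgn_mult power_sgn)
  then show ?thesis by blast
qed

lemma sgn_eq_mult_neg:
  fixes a b a' b' :: real
  assumes "sgn a = sgn a'" "sgn b = sgn b'" "a * b < 0"
  shows "a' * b' < 0"
proof -
  have "sgn (a' * b') = sgn (a * b)" using assms(1,2) by (simp add: sgn_mult)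
  then show ?thesis using assms(3) by (metis sgn_less)
qed

text \<open>The extension step of the elimination method; \<open>p'\<close> is the partner of
  \<open>p\<close>, not its derivative. \<open>\<phi>\<close> already matches the signs of all
  \<open>q i\<close> and \<open>q' i\<close>, among them the two derivatives. Between consecutive
  zeros of the \<open>q i\<close> the polynomial \<open>p\<close> is strictly monotone, so its signs
  at these zeros and at infinity tell which gaps contain a zero, and likewise for \<open>p'\<close>.
  Only the position inside a gap can be wrong, and there \<open>\<phi>\<close> may be
  changed.\<close>

lemma order_isomorphism_extend:
  fixes p p' :: "real poly" and q q' :: "'i \<Rightarrow> real poly"
  assumes fin: "finite I" and phi: "strict_mono \<phi>" "surj \<phi>"
    and sq: "\<And>i y. i \<in> I \<Longrightarrow> sgn (poly (q i) y) = sgn (poly (q' i) (\<phi> y))"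
    and sp: "\<And>i y. i \<in> I \<Longrightarrow> q i \<noteq> 0 \<Longrightarrow> poly (q i) y = 0 \<Longrightarrow> sgn (poly p y) = sgn (poly p' (\<phi> y))"
    and der: "j \<in> I" "q j = pderiv p" "q' j = pderiv p'"
    and deg: "degree p = degree p'" "degree p > 0"
    and lc: "sgn (lead_coeff p) = sgn (lead_coeff p')"
  shows "\<exists>\<psi>. strict_mono \<psi> \<and> surj \<psi> \<and>
           (\<forall>i\<in>I. \<forall>y. sgn (poly (q i) y) = sgn (poly (q' i) (\<psi> y))) \<and>
           (\<forall>y. sgn (poly p y) = sgn (poly p' (\<psi> y)))"
proof -
  have nz: "p \<noteq> 0" "p' \<noteq> 0" "pderiv p \<noteq> 0"
    using deg by (auto simp: pderiv_eq_0_iff)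
  obtain L1 where L1: "\<forall>y\<le>L1. sgn (poly p y) = sgn (lead_coeff p) * (- 1) ^ degree p"
    using poly_sgn_at_bot nz by blast
  obtain L2 where L2: "\<forall>y\<le>L2. sgn (poly p' y) = sgn (lead_coeff p) * (- 1) ^ degree p"
    using poly_sgn_at_bot nz lc deg by metis
  obtain R1 where R1: "\<forall>y\<ge>R1. sgn (poly p y) = sgn (lead_coeff p)"
    using poly_sgn_at_top nz by blast
  obtain R2 where R2: "\<forall>y\<ge>R2. sgn (poly p' y) = sgn (lead_coeff p)"
    using poly_sgn_at_top nz lc by metis
  \<comment> \<open>\<open>L\<close> and \<open>R\<close> have to be far out for \<open>p\<close>
    and, after applying \<open>\<phi>\<close>, for \<open>p'\<close>; hence the preimages of
    \<open>L2\<close> and \<open>R2\<close>.\<close>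
  obtain L2' where L2': "\<phi> L2' = L2" using phi(2) by (metis surj_def)
  obtain R2' where R2': "\<phi> R2' = R2" using phi(2) by (metis surj_def)
  have mle: "f x \<le> f y \<longleftrightarrow> x \<le> y" "f x < f y \<longleftrightarrow> x < y" if "strict_mono f" for f :: "real \<Rightarrow> real" and x y
    using that by (auto simp: strict_mono_less_eq strict_mono_less)
  define L where "L = min L1 L2'"
  define R where "R = max R1 R2'"
  have pL: "sgn (poly p y) = sgn (lead_coeff p) * (- 1) ^ degree p"
           "sgn (poly p' (\<phi> y)) = sgn (lead_coeff p) * (- 1) ^ degree p" if "y \<le> L" for y
    using that L1 L2 L2' mle(1)[OF phi(1), of y L2'] by (auto simp: L_def)
  have pR: "sgn (poly p y) = sgn (lead_coeff p)"
           "sgn (poly p' (\<phi> y)) = sgn (lead_coeff p)" if "y \<ge> R" for y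
    using that R1 R2 R2' mle(1)[OF phi(1), of R2' y] by (auto simp: R_def)
  have snz: "sgn (lead_coeff p) \<noteq> 0" using nz by (simp add: sgn_zero_iff)
  \<comment> \<open>Every zero of \<open>p\<close> lies strictly between \<open>L\<close> and
    \<open>R\<close>. With these two included it is thus in \<open>Z\<close> or in a bounded gap of
    \<open>Z\<close>.\<close>
  define Z where "Z = {L, R} \<union> {y. \<exists>i\<in>I. q i \<noteq> 0 \<and> poly (q i) y = 0}"
  define W where "W = {y. poly p y = 0}"
  have finZ: "finite Z"
  proof -
    have "{y. \<exists>i\<in>I. q i \<noteq> 0 \<and> poly (q i) y = 0} = (\<Union>i\<in>{i\<in>I. q i \<noteq> 0}. {y. poly (q i) y = 0})"
      by auto
    then show ?thesis unfolding Z_def using fin poly_roots_finite by auto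
  qed
  have LR: "L \<in> Z" "R \<in> Z" by (auto simp: Z_def)
  have Zroot: "y \<in> Z" if "i \<in> I" "q i \<noteq> 0" "poly (q i) y = 0" for i y
    using that by (auto simp: Z_def)
  have dZ: "y \<in> Z" if "poly (pderiv p) y = 0" for y
    using Zroot[of j y] der nz that by simp
  have finW: "finite W" unfolding W_def using nz poly_roots_finite by blast
  have spZ: "sgn (poly p z) = sgn (poly p' (\<phi> z))" if "z \<in> Z" for z
    using that sp pL[of z] pR[of z] unfolding Z_def by auto
  have WLR: "L < w \<and> w < R" if "poly p w = 0" for w
    using that pL(1)[of w] pR(1)[of w] snz by (metis linorder_not_less mult_eq_0_iff power_eq_0_iff sgn_0 zero_neq_neg_one)
  have nbr: "\<exists>a b. a \<in> S \<and> b \<in> S \<and> a < y \<and> y < b \<and> (\<forall>z\<in>S. \<not> (a < z \<and> z < b))"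
    if "finite S" "L \<in> S" "R \<in> S" "y \<notin> S" "L < y" "y < R" for S :: "real set" and y
  proof -
    have "Max {s\<in>S. s < y} \<in> {s\<in>S. s < y}" "Min {s\<in>S. s > y} \<in> {s\<in>S. s > y}"
      using that by (intro Max_in Min_in; auto)+
    moreover have "s \<le> Max {s\<in>S. s < y}" if "s \<in> S" "s < y" for s
      using that \<open>finite S\<close> by (intro Max_ge) auto
    moreover have "s \<ge> Min {s\<in>S. s > y}" if "s \<in> S" "s > y" for s
      using that \<open>finite S\<close> by (intro Min_le) auto
    ultimately show ?thesis using \<open>y \<notin> S\<close>
      by (intro exI[of _ "Max {s\<in>S. s < y}"] exI[of _ "Min {s\<in>S. s > y}"]) force
  qed
  \<comment> \<open>Zero polynomials contribute no points to \<open>Z\<close>, so it has to be known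
    that \<open>q i\<close> and \<open>q' i\<close> vanish identically together.\<close>
  have q0: "q i = 0 \<longleftrightarrow> q' i = 0" if "i \<in> I" for i
  proof -
    have "(\<forall>y. poly (q i) y = 0) \<longleftrightarrow> (\<forall>y. poly (q' i) y = 0)"
      using sq[OF that] phi(2) by (metis sgn_0_0 surj_def)
    then show ?thesis by (simp add: poly_all_0_iff_0)
  qed
  have inv: "\<exists>y. \<psi> y = z" if "surj \<psi>" for \<psi> :: "real \<Rightarrow> real" and z using that by (metis surj_def)
  text \<open>Move the zeros of \<open>p\<close> one at a time; between two consecutive points of \<open>Z\<close> there is at
    most one of them, and \<open>p'\<close> has a zero between the images of these points.\<close>
  have "\<exists>\<psi>. strict_mono \<psi> \<and> surj \<psi> \<and>
           (\<forall>i\<in>I. \<forall>y. sgn (poly (q i) y) = sgn (poly (q' i) (\<psi> y))) \<and>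
           (\<forall>z\<in>Z. \<psi> z = \<phi> z) \<and> (\<forall>w\<in>V. poly p' (\<psi> w) = 0)"
    if "finite V" "V \<subseteq> W - Z" for V
    using that
  proof (induction V rule: finite_induct)
    case empty
    then show ?case using phi sq by (intro exI[of _ \<phi>]) auto
  next
    case (insert w V)
    then obtain \<psi> where psi: "strict_mono \<psi>" "surj \<psi>"
      "\<And>i y. i \<in> I \<Longrightarrow> sgn (poly (q i) y) = sgn (poly (q' i) (\<psi> y))"
      "\<And>z. z \<in> Z \<Longrightarrow> \<psi> z = \<phi> z" "\<And>w. w \<in> V \<Longrightarrow> poly p' (\<psi> w) = 0"
      by auto
    have w: "poly p w = 0" "w \<notin> Z" using insert by (auto simp: W_def)
    then have "L < w" "w < R" using WLR by auto
    with nbr[OF finZ LR w(2)] obtain a b where ab: "a \<in> Z" "b \<in> Z" "a < w" "w < b" "\<And>z. z \<in> Z \<Longrightarrow> \<not> (a < z \<and> z < b)"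
      by blast
    have dnz: "poly (pderiv p) z \<noteq> 0" if "a < z" "z < b" for z
      using ab(5)[of z] that dZ[of z] by blast
    have "poly p a * poly p b < 0" using poly_sgn_opposite[OF ab(3,4) w(1) dnz] by blast
    then have "poly p' (\<psi> a) * poly p' (\<psi> b) < 0"
      using sgn_eq_mult_neg[OF spZ[OF ab(1)] spZ[OF ab(2)]] psi(4)[OF ab(1)] psi(4)[OF ab(2)]
      by simp
    then obtain v where v: "\<psi> a < v" "v < \<psi> b" "poly p' v = 0"
      using poly_zero_between[of "\<psi> a" "\<psi> b" p'] ab mle(2)[OF psi(1)] by auto
    define g where "g = bend (\<psi> a) (\<psi> b) (\<psi> w) v"
    have cd: "\<psi> a < \<psi> w" "\<psi> w < \<psi> b" using ab mle(2)[OF psi(1)] by auto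
    note g = bend_strict_mono[OF cd v(1,2), folded g_def] bend_surj[OF cd v(1,2), folded g_def]
    have out: "g y = y" if "y \<le> \<psi> a \<or> \<psi> b \<le> y" for y
      using bend_outside[OF that] by (simp add: g_def)
    have "strict_mono (g \<circ> \<psi>)" using g psi by (auto simp: strict_mono_def)
    moreover have "surj (g \<circ> \<psi>)" using comp_surj[OF psi(2) g(2)] .
    moreover have "sgn (poly (q i) y) = sgn (poly (q' i) ((g \<circ> \<psi>) y))" if i: "i \<in> I" for i y
    proof (cases "\<psi> y \<le> \<psi> a \<or> \<psi> b \<le> \<psi> y \<or> q' i = 0")
      case True
      then show ?thesis using out[of "\<psi> y"] psi(3)[OF i, of y] q0[OF i] by auto
    next
      case False
      then have y: "\<psi> a < \<psi> y" "\<psi> y < \<psi> b" and ne: "q' i \<noteq> 0" by auto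
      then have gy: "\<psi> a < g (\<psi> y)" "g (\<psi> y) < \<psi> b"
        using out[of "\<psi> a"] out[of "\<psi> b"] strict_monoD[OF g(1) y(1)] strict_monoD[OF g(1) y(2)]
        by simp_all
      \<comment> \<open>\<open>g\<close> moves points only inside a gap without zeros of
        \<open>q' i\<close>: the \<open>\<psi>\<close>-preimage of such a zero would be a point of
        \<open>Z\<close> strictly between \<open>a\<close> and \<open>b\<close>.\<close>
      have "sgn (poly (q' i) (\<psi> y)) = sgn (poly (q' i) (g (\<psi> y)))"
      proof (rule poly_sgn_constant')
        fix z assume "min (\<psi> y) (g (\<psi> y)) \<le> z" "z \<le> max (\<psi> y) (g (\<psi> y))"
        then have z: "\<psi> a < z" "z < \<psi> b" using y gy by linarith+
        obtain x where x: "\<psi> x = z" using inv[OF psi(2)] by blast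
        then have "a < x" "x < b" using z mle(2)[OF psi(1)] by auto
        then have "poly (q i) x \<noteq> 0" using ab(5)[of x] q0[OF i] ne Zroot[OF i, of x] by blast
        then show "poly (q' i) z \<noteq> 0" using psi(3)[OF i, of x] x by (metis sgn_0_0)
      qed
      then show ?thesis using psi(3)[OF i] by simp
    qed
    moreover have "(g \<circ> \<psi>) z = \<phi> z" if "z \<in> Z" for z
    proof -
      have "z \<le> a \<or> b \<le> z" using ab(5)[OF that] by linarith
      then have "g (\<psi> z) = \<psi> z"
        using out[of "\<psi> z"] mle(1)[OF psi(1), of z a] mle(1)[OF psi(1), of b z] by blast
      then show ?thesis using psi(4)[OF that] by simp
    qed
    moreover have "poly p' ((g \<circ> \<psi>) x) = 0" if "x \<in> insert w V" for x
    proof (cases "x = w")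
      case True
      then show ?thesis using v bend_at[OF cd, of v] by (simp add: g_def)
    next
      case False
      then have x: "x \<in> V" using that by simp
      \<comment> \<open>By Rolle's theorem two zeros of \<open>p\<close> in one gap would force a
        zero of its derivative there. So the zeros treated earlier lie outside the gap and are not
        moved again.\<close>
      have "\<not> (a < x \<and> x < b)"
      proof
        assume x': "a < x \<and> x < b"
        have px: "poly p x = 0" using x insert by (auto simp: W_def)
        define l h where "l = min x w" and "h = max x w"
        have lh: "l < h" "a < l" "h < b" using False x' ab(3,4) unfolding l_def h_def by linarith+
        have "poly p l = 0" "poly p h = 0"
          using px w(1) by (simp_all add: l_def h_def min_def max_def)
        note lh = lh this
        obtain z where z: "l < z" "z < h" "poly p h - poly p l = (h - l) * poly (pderiv p) z"
          using poly_MVT[OF lh(1)] by blast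
        have "poly (pderiv p) z = 0" using z(3) lh by simp
        then show False using dnz[of z] z lh by simp
      qed
      then have "x \<le> a \<or> b \<le> x" by linarith
      then have "g (\<psi> x) = \<psi> x"
        using out[of "\<psi> x"] mle(1)[OF psi(1), of x a] mle(1)[OF psi(1), of b x] by blast
      then show ?thesis using psi(5)[OF x] by simp
    qed
    ultimately show ?case by blast
  qed
  from this[of "W - Z"] finW obtain \<psi> where psi: "strict_mono \<psi>" "surj \<psi>"
      "\<And>i y. i \<in> I \<Longrightarrow> sgn (poly (q i) y) = sgn (poly (q' i) (\<psi> y))"
      "\<And>z. z \<in> Z \<Longrightarrow> \<psi> z = \<phi> z" "\<And>w. w \<in> W - Z \<Longrightarrow> poly p' (\<psi> w) = 0"
    by auto
  \<comment> \<open>All zeros of \<open>p\<close> are now matched. Left to show is that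
    \<open>p'\<close> has no others, which is done on the gaps of \<open>Z\<close> refined by the
    zeros of \<open>p\<close>.\<close>
  define S where "S = Z \<union> W"
  have finS: "finite S" using finZ finW by (simp add: S_def)
  have spS: "sgn (poly p s) = sgn (poly p' (\<psi> s))" if "s \<in> S" for s
  proof (cases "s \<in> Z")
    case True then show ?thesis using spZ psi(4) by simp
  next
    case False
    then show ?thesis using that psi(5)[of s] by (auto simp: S_def W_def)
  qed
  have p: "sgn (poly p y) = sgn (poly p' (\<psi> y))" for y
  proof -
    consider "y \<in> S" | "y \<le> L" | "R \<le> y" | "y \<notin> S" "L < y" "y < R" by linarith
    then show ?thesis
    proof cases
      case 1 then show ?thesis using spS by blast
    next
      case 2
      \<comment> \<open>\<open>\<psi>\<close> and \<open>\<phi>\<close> agree at \<open>L\<close>,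
        so \<open>\<psi> y\<close> is \<open>\<phi> x\<close> for some x \<le> L, where the sign of
        \<open>p'\<close> is known.\<close>
      then have "\<psi> y \<le> \<phi> L" using mle(1)[OF psi(1), of y L] psi(4)[OF LR(1)] by simp
      moreover obtain x where x: "\<phi> x = \<psi> y" using inv[OF phi(2)] by blast
      ultimately have "x \<le> L" using mle(1)[OF phi(1), of x L] by simp
      then show ?thesis using pL(1)[OF 2] pL(2)[of x] x by simp
    next
      case 3
      then have "\<psi> y \<ge> \<phi> R" using mle(1)[OF psi(1), of R y] psi(4)[OF LR(2)] by simp
      moreover obtain x where x: "\<phi> x = \<psi> y" using inv[OF phi(2)] by blast
      ultimately have "x \<ge> R" using mle(1)[OF phi(1), of R x] by simp
      then show ?thesis using pR(1)[OF 3] pR(2)[of x] x by simp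
    next
      case 4
      then obtain a b where ab: "a \<in> S" "b \<in> S" "a < y" "y < b" "\<And>z. z \<in> S \<Longrightarrow> \<not> (a < z \<and> z < b)"
        using nbr[OF finS _ _ 4] LR by (auto simp: S_def)
      have pnz: "poly p z \<noteq> 0" "poly (pderiv p) z \<noteq> 0" if "a < z" "z < b" for z
        using ab(5)[of z] that dZ[of z] by (auto simp: S_def W_def)
      \<comment> \<open>A zero of \<open>p'\<close> in the gap would give \<open>p'\<close> opposite
        signs at the end points, hence also \<open>p\<close>, and then \<open>p\<close> would vanish
        inside the gap.\<close>
      have p'nz: "poly p' z \<noteq> 0" if z: "\<psi> a < z" "z < \<psi> b" for z
      proof
        assume z0: "poly p' z = 0"
        have "poly (pderiv p') x \<noteq> 0" if x: "\<psi> a < x" "x < \<psi> b" for x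
        proof -
          obtain u where u: "\<psi> u = x" using inv[OF psi(2)] by blast
          then have "a < u" "u < b" using x mle(2)[OF psi(1)] by auto
          then show ?thesis using pnz(2)[of u] psi(3)[OF der(1), of u] u der by (metis sgn_0_0)
        qed
        from poly_sgn_opposite[OF z z0 this] have "poly p' (\<psi> a) * poly p' (\<psi> b) < 0" by blast
        then have "poly p a * poly p b < 0"
          using sgn_eq_mult_neg[OF spS[OF ab(1), symmetric] spS[OF ab(2), symmetric]] by simp
        then show False using poly_zero_between[of a b p] ab pnz(1) by auto
      qed
      \<comment> \<open>By the mean value theorem \<open>p\<close> cannot vanish at both ends; its
        sign inside is read off at an end where it does not.\<close>
      have "poly p a \<noteq> 0 \<or> poly p b \<noteq> 0"
      proof (rule ccontr)
        assume "\<not> ?thesis"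
        moreover obtain z where "a < z" "z < b" "poly p b - poly p a = (b - a) * poly (pderiv p) z"
          using poly_MVT[of a b p] ab by auto
        ultimately show False using pnz(2)[of z] ab by auto
      qed
      then show ?thesis
      proof
        assume a0: "poly p a \<noteq> 0"
        then have a0': "poly p' (\<psi> a) \<noteq> 0" using spS[OF ab(1)] by (metis sgn_0_0)
        have "sgn (poly p a) = sgn (poly p y)"
        proof (rule poly_sgn_constant)
          show "poly p z \<noteq> 0" if "a \<le> z" "z \<le> y" for z
            using that a0 pnz(1)[of z] ab by (cases "z = a") auto
        qed (use ab in simp)
        moreover have "sgn (poly p' (\<psi> a)) = sgn (poly p' (\<psi> y))"
        proof (rule poly_sgn_constant)
          show "poly p' z \<noteq> 0" if "\<psi> a \<le> z" "z \<le> \<psi> y" for z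
            using that a0' p'nz[of z] ab mle(2)[OF psi(1), of y b] by (cases "z = \<psi> a") auto
        qed (use ab mle(1)[OF psi(1)] in simp)
        ultimately show ?thesis using spS[OF ab(1)] by simp
      next
        assume b0: "poly p b \<noteq> 0"
        then have b0': "poly p' (\<psi> b) \<noteq> 0" using spS[OF ab(2)] by (metis sgn_0_0)
        have "sgn (poly p y) = sgn (poly p b)"
        proof (rule poly_sgn_constant)
          show "poly p z \<noteq> 0" if "y \<le> z" "z \<le> b" for z
            using that b0 pnz(1)[of z] ab by (cases "z = b") auto
        qed (use ab in simp)
        moreover have "sgn (poly p' (\<psi> y)) = sgn (poly p' (\<psi> b))"
        proof (rule poly_sgn_constant)
          show "poly p' z \<noteq> 0" if "\<psi> y \<le> z" "z \<le> \<psi> b" for z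
            using that b0' p'nz[of z] ab mle(2)[OF psi(1), of a y] by (cases "z = \<psi> b") auto
        qed (use ab mle(1)[OF psi(1)] in simp)
        ultimately show ?thesis using spS[OF ab(2)] by simp
      qed
    qed
  qed
  then show ?thesis using psi by blast
qed

section \<open>Sign diagrams of parametrised polynomials\<close>

text \<open>Polynomial functions of the parameter vector, taken as functions generated by the ring
  operations, so that bounds are proved by induction on the rules and no normal form is carried
  along.\<close>

inductive param_poly :: "((nat \<Rightarrow> real) \<Rightarrow> real) \<Rightarrow> bool" where
  const: "param_poly (\<lambda>a. c)"
| var: "param_poly (\<lambda>a. a i)"
| add: "param_poly f \<Longrightarrow> param_poly g \<Longrightarrow> param_poly (\<lambda>a. f a + g a)"
| mult: "param_poly f \<Longrightarrow> param_poly g \<Longrightarrow> param_poly (\<lambda>a. f a * g a)"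

lemma param_poly_diff:
  assumes "param_poly f" "param_poly g"
  shows "param_poly (\<lambda>a. f a - g a)"
  using add[OF assms(1) mult[OF const assms(2)], of "-1"] by simp

text \<open>\<open>D\<close> depends on \<open>e\<close> and \<open>t\<close> alone and not on the
  polynomials put in for the parameters. This is the source of the uniformity in the
  coefficients.\<close>

lemma param_poly_subst:
  assumes "param_poly e"
  shows "\<exists>D. \<forall>c. (\<forall>j. degree (c j) \<le> t) \<longrightarrow>
           (\<exists>q. degree q \<le> D \<and> (\<forall>x. poly q x = e (\<lambda>j. poly (c j) x)))"
  using assms
proof induction
  case (const c)
  show ?case by (intro exI[of _ 0] allI impI exI[of _ "[:c:]"]) simp
next
  case (var i)
  show ?case by (intro exI[of _ t]) auto
next
  case (add f g)
  then obtain D1 D2 where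
    D: "\<And>c. (\<forall>j. degree (c j) \<le> t) \<Longrightarrow> (\<exists>q. degree q \<le> D1 \<and> (\<forall>x. poly q x = f (\<lambda>j. poly (c j) x)))"
       "\<And>c. (\<forall>j. degree (c j) \<le> t) \<Longrightarrow> (\<exists>q. degree q \<le> D2 \<and> (\<forall>x. poly q x = g (\<lambda>j. poly (c j) x)))"
    by blast
  have "\<exists>q. degree q \<le> D1 + D2 \<and> (\<forall>x. poly q x = f (\<lambda>j. poly (c j) x) + g (\<lambda>j. poly (c j) x))"
    if c: "\<forall>j. degree (c j) \<le> t" for c
  proof -
    obtain q r where "degree q \<le> D1" "\<forall>x. poly q x = f (\<lambda>j. poly (c j) x)"
        "degree r \<le> D2" "\<forall>x. poly r x = g (\<lambda>j. poly (c j) x)"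
      using D[OF c] by blast
    then show ?thesis by (intro exI[of _ "q + r"]) (auto intro: degree_add_le)
  qed
  then show ?case by blast
next
  case (mult f g)
  then obtain D1 D2 where
    D: "\<And>c. (\<forall>j. degree (c j) \<le> t) \<Longrightarrow> (\<exists>q. degree q \<le> D1 \<and> (\<forall>x. poly q x = f (\<lambda>j. poly (c j) x)))"
       "\<And>c. (\<forall>j. degree (c j) \<le> t) \<Longrightarrow> (\<exists>q. degree q \<le> D2 \<and> (\<forall>x. poly q x = g (\<lambda>j. poly (c j) x)))"
    by blast
  have "\<exists>q. degree q \<le> D1 + D2 \<and> (\<forall>x. poly q x = f (\<lambda>j. poly (c j) x) * g (\<lambda>j. poly (c j) x))"
    if c: "\<forall>j. degree (c j) \<le> t" for c
  proof -
    obtain q r where "degree q \<le> D1" "\<forall>x. poly q x = f (\<lambda>j. poly (c j) x)"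
        "degree r \<le> D2" "\<forall>x. poly r x = g (\<lambda>j. poly (c j) x)"
      using D[OF c] by blast
    then show ?thesis
      by (intro exI[of _ "q * r"]) (auto intro: order.trans[OF degree_mult_le])
  qed
  then show ?case by blast
qed

text \<open>A list holds the coefficients, lowest first, of a polynomial in one variable whose
  coefficients depend on the parameter. Its last entry may vanish at some parameters, so the length
  only bounds the degree from above.\<close>

definition specialize :: "((nat \<Rightarrow> real) \<Rightarrow> real) list \<Rightarrow> (nat \<Rightarrow> real) \<Rightarrow> real poly" where
  "specialize P a = Poly (map (\<lambda>c. c a) P)"

lemma coeff_specialize: "coeff (specialize P a) i = (if i < length P then (P ! i) a else 0)"
  by (simp add: specialize_def coeff_Poly_eq nth_default_def)

lemma specialize_butlast:
  assumes "P \<noteq> []" "last P a = 0"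
  shows "specialize (butlast P) a = specialize P a"
proof (rule poly_eqI)
  fix i
  show "coeff (specialize (butlast P) a) i = coeff (specialize P a) i"
    using assms by (cases "i = length P - 1") (auto simp: coeff_specialize nth_butlast last_conv_nth)
qed

lemma degree_specialize:
  assumes "P \<noteq> []" "last P a \<noteq> 0"
  shows "degree (specialize P a) = length P - 1" "lead_coeff (specialize P a) = last P a"
proof -
  have "coeff (specialize P a) (length P - 1) = last P a"
    using assms by (simp add: coeff_specialize last_conv_nth)
  moreover have "degree (specialize P a) \<le> length P - 1"
    by (rule degree_le) (auto simp: coeff_specialize)
  moreover have "length P - 1 \<le> degree (specialize P a)"
    using calculation(1) assms by (intro le_degree) simp
  ultimately show "degree (specialize P a) = length P - 1" "lead_coeff (specialize P a) = last P a"
    by (metis le_antisym)+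
qed

definition param_deriv :: "((nat \<Rightarrow> real) \<Rightarrow> real) list \<Rightarrow> ((nat \<Rightarrow> real) \<Rightarrow> real) list" where
  "param_deriv P = map (\<lambda>i a. real (Suc i) * (P ! Suc i) a) [0..<length P - 1]"

lemma specialize_param_deriv: "specialize (param_deriv P) a = pderiv (specialize P a)"
  by (rule poly_eqI) (auto simp: coeff_specialize coeff_pderiv param_deriv_def)

lemma length_param_deriv [simp]: "length (param_deriv P) = length P - 1"
  by (simp add: param_deriv_def)

lemma param_poly_param_deriv:
  assumes "\<forall>c\<in>set P. param_poly c"
  shows "\<forall>c\<in>set (param_deriv P). param_poly c"
  using assms by (auto simp: param_deriv_def intro!: param_poly.intros)

text \<open>The leading coefficient of the derivative vanishes only together with that of
  \<open>P\<close>, so a case distinction on the latter settles both.\<close>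

lemma last_param_deriv:
  assumes "length P \<ge> 2"
  shows "last (param_deriv P) a = real (length P - 1) * last P a"
proof -
  have "P \<noteq> []" "param_deriv P \<noteq> []" using assms by (auto simp: param_deriv_def)
  then show ?thesis using assms
    by (auto simp: last_conv_nth param_deriv_def Suc_diff_Suc numeral_2_eq_2)
qed

text \<open>Multiplying by the square of the leading coefficient keeps signs.\<close>

lemma param_remainder:
  assumes "Q \<noteq> []" "\<forall>c\<in>set P. param_poly c" "\<forall>c\<in>set Q. param_poly c"
  shows "\<exists>R. length R < length Q \<and> (\<forall>c\<in>set R. param_poly c) \<and>
           (\<forall>a y. last Q a \<noteq> 0 \<longrightarrow> poly (specialize Q a) y = 0 \<longrightarrow>
              sgn (poly (specialize R a) y) = sgn (poly (specialize P a) y))"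
  using assms(2)
proof (induction "length P" arbitrary: P rule: less_induct)
  case less
  show ?case
  proof (cases "length P < length Q")
    case True
    then show ?thesis using less.prems by blast
  next
    case False
    define n k where "n = length P - 1" and "k = length Q - 1"
    have len: "length P = Suc n" "length Q = Suc k" "k \<le> n"
      using False assms(1) by (auto simp: n_def k_def simp flip: length_greater_0_conv)
    define l c where "l = last Q" and "c = last P"
    have lc: "l = Q ! k" "c = P ! n"
      using len by (auto simp: l_def c_def last_conv_nth simp flip: length_greater_0_conv)
    have pl: "param_poly l" "param_poly c" "\<And>i. i \<le> n \<Longrightarrow> param_poly (P ! i)" "\<And>i. i \<le> k \<Longrightarrow> param_poly (Q ! i)"
      using less.prems assms(3) len by (auto simp: lc)
    \<comment> \<open>One step of pseudo-division, l^2 P - l c y^(n - k) Q. The coefficient of y^n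
      cancels formally, so the list gets shorter, and on the zeros of \<open>Q\<close> the value is
      l^2 times that of \<open>P\<close>.\<close>
    define S where "S = map (\<lambda>i. if n - k \<le> i
        then (\<lambda>a. l a * (l a * (P ! i) a) - (l a * (c a * (Q ! (i - (n - k))) a)))
        else (\<lambda>a. l a * (l a * (P ! i) a))) [0..<n]"
    have S: "length S = n" "\<forall>c\<in>set S. param_poly c"
      using pl len by (auto simp: S_def intro!: param_poly.intros param_poly_diff)
    have eq: "specialize S a = smult (l a * l a) (specialize P a) - monom (l a * c a) (n - k) * specialize Q a" for a
    proof (rule poly_eqI)
      fix i
      consider "i < n" | "i = n" | "i > n" by linarith
      then show "coeff (specialize S a) i =
          coeff (smult (l a * l a) (specialize P a) - monom (l a * c a) (n - k) * specialize Q a) i"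
        unfolding coeff_diff coeff_smult coeff_monom_mult coeff_specialize
        by cases (use len in \<open>auto simp: S_def lc algebra_simps\<close>)
    qed
    obtain R where R: "length R < length Q" "\<forall>c\<in>set R. param_poly c"
        "\<And>a y. last Q a \<noteq> 0 \<Longrightarrow> poly (specialize Q a) y = 0 \<Longrightarrow>
           sgn (poly (specialize R a) y) = sgn (poly (specialize S a) y)"
      using less.hyps[of S] S len by auto
    have "sgn (poly (specialize S a) y) = sgn (poly (specialize P a) y)"
      if "last Q a \<noteq> 0" "poly (specialize Q a) y = 0" for a y
      using that by (simp add: eq sgn_mult flip: l_def)
    then show ?thesis using R by (intro exI[of _ R]) auto
  qed
qed

definition sign_isomorphic ::
    "((nat \<Rightarrow> real) \<Rightarrow> real) list set \<Rightarrow> (nat \<Rightarrow> real) \<Rightarrow> (nat \<Rightarrow> real) \<Rightarrow> bool" where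
  "sign_isomorphic F a b \<longleftrightarrow> (\<exists>\<psi>. strict_mono \<psi> \<and> surj \<psi> \<and>
     (\<forall>P\<in>F. \<forall>y. sgn (poly (specialize P a) y) = sgn (poly (specialize P b) (\<psi> y))))"

definition sign_decisive ::
    "((nat \<Rightarrow> real) \<Rightarrow> real) set \<Rightarrow> ((nat \<Rightarrow> real) \<Rightarrow> real) list set \<Rightarrow> bool" where
  "sign_decisive E F \<longleftrightarrow> finite E \<and> (\<forall>e\<in>E. param_poly e) \<and>
     (\<forall>a b. (\<forall>e\<in>E. sgn (e a) = sgn (e b)) \<longrightarrow> sign_isomorphic F a b)"

text \<open>Induction over the multiset of lengths, since one list is traded for many shorter ones.
  Where some leading coefficient vanishes, it is dropped. Elsewhere a longest list is replaced by
  its derivative and by its remainders modulo the other lists and modulo the derivative. The leading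
  coefficients themselves enter \<open>E\<close>, so that their signs tell which of these cases
  applies.\<close>

lemma exists_sign_decisive_mset:
  assumes "\<forall>P\<in>#M. \<forall>c\<in>set P. param_poly c"
  shows "\<exists>E. sign_decisive E (set_mset M)"
proof -
  define r where "r = inv_image (mult less_than)
     (image_mset length :: ((nat \<Rightarrow> real) \<Rightarrow> real) list multiset \<Rightarrow> nat multiset)"
  have wf: "wf r" unfolding r_def by (intro wf_inv_image wf_mult) simp
  have smaller: "(N + K, N + {#P#}) \<in> r" if "\<forall>Q\<in>#K. length Q < length P" for N K P
    using that one_step_implies_mult[of "{#length P#}" "image_mset length K" less_than "image_mset length N"]
    by (auto simp: r_def)
  show ?thesis using assms
  proof (induction M rule: wf_induct_rule[OF wf])
    case (1 M)
    show ?case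
    proof (cases "\<exists>P\<in>#M. length P \<ge> 2")
      case False
      \<comment> \<open>Lists of length at most 1 are constant in \<open>y\<close>, so the identity
        serves as the order isomorphism.\<close>
      have "sign_decisive (\<Union>P\<in>set_mset M. set P) (set_mset M)"
        unfolding sign_decisive_def
      proof (intro conjI allI impI)
        fix a b :: "nat \<Rightarrow> real" assume *: "\<forall>e\<in>(\<Union>P\<in>set_mset M. set P). sgn (e a) = sgn (e b)"
        have "sgn (poly (specialize P a) y) = sgn (poly (specialize P b) y)" if "P \<in># M" for P y
        proof -
          have "P = [] \<or> (\<exists>c. P = [c])" using False that
            by (metis One_nat_def Suc_1 length_0_conv length_Suc_conv not_less_eq_eq le_0_eq le_Suc_eq)
          then show ?thesis using * that by (auto simp: specialize_def)
        qed
        then show "sign_isomorphic (set_mset M) a b"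
          unfolding sign_isomorphic_def by (intro exI[of _ id]) (auto simp: strict_mono_def)
      qed (use 1 in auto)
      then show ?thesis by blast
    next
      case True
      \<comment> \<open>A longest list is chosen so that every remainder, being shorter than its
        divisor, is shorter than \<open>P\<close> as well.\<close>
      define d where "d = Max (length ` set_mset M)"
      have "d \<in> length ` set_mset M" unfolding d_def using True by (intro Max_in) auto
      then obtain P where P: "P \<in># M" "length P = d" by blast
      have dmax: "length Q \<le> d" if "Q \<in># M" for Q unfolding d_def using that by (intro Max_ge) auto
      have d2: "d \<ge> 2" using True dmax by fastforce
      define M' where "M' = M - {#P#}"
      have M: "M = M' + {#P#}" using P by (simp add: M'_def)
      define J where "J = M' + {#param_deriv P#}"
      have ppJ: "\<forall>c\<in>set Q. param_poly c" if "Q \<in># J" for Q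
        using that 1(2) param_poly_param_deriv[of P] by (auto simp: J_def M)
      have lenJ: "length Q \<le> d" if "Q \<in># J" for Q
        using that dmax P by (auto simp: J_def M)
      have "\<forall>Q\<in>#J. Q \<noteq> [] \<longrightarrow> (\<exists>R. length R < length Q \<and> (\<forall>c\<in>set R. param_poly c) \<and>
           (\<forall>a y. last Q a \<noteq> 0 \<longrightarrow> poly (specialize Q a) y = 0 \<longrightarrow>
              sgn (poly (specialize R a) y) = sgn (poly (specialize P a) y)))"
        using param_remainder ppJ 1(2) P by blast
      then obtain R where R: "\<And>Q. Q \<in># J \<Longrightarrow> Q \<noteq> [] \<Longrightarrow> length (R Q) < length Q \<and> (\<forall>c\<in>set (R Q). param_poly c) \<and>
           (\<forall>a y. last Q a \<noteq> 0 \<longrightarrow> poly (specialize Q a) y = 0 \<longrightarrow>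
              sgn (poly (specialize (R Q) a) y) = sgn (poly (specialize P a) y))"
        by metis
      \<comment> \<open>The empty list is the zero polynomial, which does not serve as a divisor;
        the default only has to be shorter than \<open>P\<close>.\<close>
      define R' where "R' Q = (if Q = [] then [] else R Q)" for Q
      define K where "K = {#param_deriv P#} + image_mset R' J"
      have "(M' + K, M) \<in> r" unfolding M
      proof (rule smaller)
        have "length (R' Q) < d" if "Q \<in># J" for Q
          using R[OF that] lenJ[OF that] d2 by (cases "Q = []") (auto simp: R'_def)
        then show "\<forall>Q\<in>#K. length Q < length P" using d2 P by (auto simp: K_def)
      qed
      moreover have "\<forall>Q\<in>#M' + K. \<forall>c\<in>set Q. param_poly c"
      proof -
        have "\<forall>c\<in>set (R' Q). param_poly c" if "Q \<in># J" for Q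
          using R[OF that] by (cases "Q = []") (auto simp: R'_def)
        then show ?thesis using ppJ by (auto simp: K_def J_def)
      qed
      ultimately obtain E' where E': "sign_decisive E' (set_mset (M' + K))"
        using 1(1)[of "M' + K"] by blast
      \<comment> \<open>At parameters where the leading coefficient of \<open>Q\<close> vanishes,
        \<open>butlast Q\<close> represents the same polynomial by a shorter list.\<close>
      have "\<forall>Q\<in>#M. Q \<noteq> [] \<longrightarrow> (\<exists>E. sign_decisive E (set_mset (M - {#Q#} + {#butlast Q#})))"
      proof (intro ballI impI)
        fix Q assume Q: "Q \<in># M" "Q \<noteq> []"
        then have "(M - {#Q#} + {#butlast Q#}, M - {#Q#} + {#Q#}) \<in> r"
          by (intro smaller) auto
        then have "(M - {#Q#} + {#butlast Q#}, M) \<in> r" using Q by simp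
        moreover have "\<forall>P\<in>#M - {#Q#} + {#butlast Q#}. \<forall>c\<in>set P. param_poly c"
          using 1(2) Q by (auto dest: in_diffD in_set_butlastD)
        ultimately show "\<exists>E. sign_decisive E (set_mset (M - {#Q#} + {#butlast Q#}))"
          using 1(1) by blast
      qed
      then obtain EE where EE: "\<And>Q. Q \<in># M \<Longrightarrow> Q \<noteq> [] \<Longrightarrow>
          sign_decisive (EE Q) (set_mset (M - {#Q#} + {#butlast Q#}))"
        by metis
      define N where "N = {Q. Q \<in># M \<and> Q \<noteq> []}"
      define E where "E = E' \<union> (\<Union>Q\<in>N. insert (last Q) (EE Q))"
      have "sign_decisive E (set_mset M)" unfolding sign_decisive_def
      proof (intro conjI allI impI)
        have "finite N" unfolding N_def by simp
        then show "finite E" using E' EE by (auto simp: E_def N_def sign_decisive_def)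
        show "\<forall>e\<in>E. param_poly e" using E' EE 1(2) by (fastforce simp: E_def N_def sign_decisive_def)
        fix a b :: "nat \<Rightarrow> real" assume ab: "\<forall>e\<in>E. sgn (e a) = sgn (e b)"
        show "sign_isomorphic (set_mset M) a b"
        \<comment> \<open>The distinction may be made at \<open>a\<close> alone: the leading
          coefficients belong to \<open>E\<close>, so they vanish at \<open>b\<close> exactly if
          they vanish at \<open>a\<close>.\<close>
        proof (cases "\<exists>Q\<in>N. last Q a = 0")
          case True
          then obtain Q where Q: "Q \<in># M" "Q \<noteq> []" "last Q a = 0" "Q \<in> N" by (auto simp: N_def)
          moreover have "sgn (last Q a) = sgn (last Q b)" using ab Q unfolding E_def by blast
          ultimately have Qb: "last Q b = 0" by (metis sgn_0_0)
          have "sign_isomorphic (set_mset (M - {#Q#} + {#butlast Q#})) a b"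
            using EE[OF Q(1,2)] ab Q(4) unfolding sign_decisive_def E_def by blast
          then obtain \<psi> where \<psi>: "strict_mono \<psi>" "surj \<psi>"
            "\<And>P y. P \<in># M - {#Q#} + {#butlast Q#} \<Longrightarrow>
               sgn (poly (specialize P a) y) = sgn (poly (specialize P b) (\<psi> y))"
            unfolding sign_isomorphic_def by blast
          have "sgn (poly (specialize P a) y) = sgn (poly (specialize P b) (\<psi> y))" if "P \<in># M" for P y
          proof (cases "P = Q")
            case True
            then show ?thesis using \<psi>(3)[of "butlast Q" y] Q Qb by (simp add: specialize_butlast)
          next
            case False
            then have "P \<in># M - {#Q#} + {#butlast Q#}" using that by (simp add: in_diff_count)
            then show ?thesis by (rule \<psi>(3))
          qed
          then show ?thesis using \<psi> unfolding sign_isomorphic_def by blast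
        next
          case False
          then have la: "last Q a \<noteq> 0" if "Q \<in> N" for Q using that by blast
          have sl: "sgn (last Q a) = sgn (last Q b)" if "Q \<in> N" for Q
            using that ab by (auto simp: E_def)
          have lb: "last Q b \<noteq> 0" if "Q \<in> N" for Q using la[OF that] sl[OF that] by (metis sgn_0_0)
          have PN: "P \<in> N" "P \<noteq> []" using P d2 by (auto simp: N_def)
          have lJ: "last Q a \<noteq> 0" "last Q b \<noteq> 0" if "Q \<in># J" "Q \<noteq> []" for Q
            using that la lb PN P d2 by (auto simp: J_def N_def M last_param_deriv)
          have "sign_isomorphic (set_mset (M' + K)) a b"
            using E' ab unfolding sign_decisive_def E_def by blast
          then obtain \<phi> where \<phi>: "strict_mono \<phi>" "surj \<phi>"
            "\<And>P y. P \<in># M' + K \<Longrightarrow>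
               sgn (poly (specialize P a) y) = sgn (poly (specialize P b) (\<phi> y))"
            unfolding sign_isomorphic_def by blast
          have J\<phi>: "sgn (poly (specialize Q a) y) = sgn (poly (specialize Q b) (\<phi> y))" if "Q \<in># J" for Q y
            using that by (intro \<phi>(3)) (auto simp: J_def K_def)
          have "\<exists>\<psi>. strict_mono \<psi> \<and> surj \<psi> \<and>
             (\<forall>Q\<in>set_mset J. \<forall>y. sgn (poly (specialize Q a) y) = sgn (poly (specialize Q b) (\<psi> y))) \<and>
             (\<forall>y. sgn (poly (specialize P a) y) = sgn (poly (specialize P b) (\<psi> y)))"
          proof (rule order_isomorphism_extend[where j = "param_deriv P"])
            show "finite (set_mset J)" by simp
            show "strict_mono \<phi>" "surj \<phi>" by fact+
            show "sgn (poly (specialize Q a) y) = sgn (poly (specialize Q b) (\<phi> y))" if "Q \<in># J" for Q y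
              using that by (rule J\<phi>)
            show "param_deriv P \<in># J" by (simp add: J_def)
            show "specialize (param_deriv P) a = pderiv (specialize P a)"
                 "specialize (param_deriv P) b = pderiv (specialize P b)"
              by (rule specialize_param_deriv)+
            show "degree (specialize P a) = degree (specialize P b)" "0 < degree (specialize P a)"
              using la[OF PN(1)] lb[OF PN(1)] PN(2) d2 P by (simp_all add: degree_specialize(1))
            show "sgn (lead_coeff (specialize P a)) = sgn (lead_coeff (specialize P b))"
              using sl[OF PN(1)]
              by (simp only: degree_specialize(2)[OF PN(2) la[OF PN(1)]] degree_specialize(2)[OF PN(2) lb[OF PN(1)]])
            fix Q y assume Q: "Q \<in># J" "specialize Q a \<noteq> 0" "poly (specialize Q a) y = 0"
            then have ne: "Q \<noteq> []" by (auto simp: specialize_def)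
            have z: "poly (specialize Q b) (\<phi> y) = 0" using J\<phi>[OF Q(1), of y] Q by (simp add: sgn_0_0)
            \<comment> \<open>At a zero of \<open>Q\<close> the sign of \<open>P\<close> is that of
              the remainder \<open>R Q\<close>, which belongs to the family already matched by
              \<open>\<phi>\<close>.\<close>
            have "R Q \<in># M' + K" using Q ne by (auto simp: K_def R'_def)
            then have "sgn (poly (specialize (R Q) a) y) = sgn (poly (specialize (R Q) b) (\<phi> y))"
              by (rule \<phi>(3))
            then show "sgn (poly (specialize P a) y) = sgn (poly (specialize P b) (\<phi> y))"
              using R[OF Q(1) ne] lJ[OF Q(1) ne] Q(3) z by metis
          qed
          then show ?thesis unfolding sign_isomorphic_def M J_def by auto
        qed
      qed
      then show ?thesis by blast
    qed
  qed
qed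

lemma exists_sign_decisive:
  assumes "finite F" "\<forall>P\<in>F. \<forall>c\<in>set P. param_poly c"
  shows "\<exists>E. sign_decisive E F"
  using exists_sign_decisive_mset[of "mset_set F"] assms by simp

section \<open>Sign patterns on the line and in the plane\<close>

text \<open>The at most \<open>card S * D\<close> zeros of the nonzero members cut the line into
  points and open intervals with constant signs. Such a cell is named by the number of zeros to its
  left and by whether it is itself a zero, hence the factor 2.\<close>

lemma card_sign_determined_le:
  fixes S :: "real poly set" and f :: "real \<Rightarrow> 'c"
  assumes fin: "finite S" and deg: "\<And>q. q \<in> S \<Longrightarrow> degree q \<le> D"
    and det: "\<And>x x'. (\<And>q. q \<in> S \<Longrightarrow> sgn (poly q x) = sgn (poly q x')) \<Longrightarrow> f x = f x'"
  shows "finite (range f)" and "card (range f) \<le> 2 * (card S * D + 1)"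
proof -
  define Z where "Z = (\<Union>q\<in>S - {0}. {x. poly q x = 0})"
  have finZ: "finite Z" using fin by (auto simp: Z_def poly_roots_finite)
  have "card Z \<le> (\<Sum>q\<in>S - {0}. card {x. poly q x = 0})"
    unfolding Z_def using fin by (intro card_UN_le) auto
  also have "\<dots> \<le> (\<Sum>q\<in>S - {0}. D)"
    using deg by (intro sum_mono) (auto intro: order.trans[OF card_poly_roots_bound])
  also have "\<dots> \<le> card S * D" using fin by (simp add: card_Diff1_le)
  finally have cardZ: "card Z \<le> card S * D" .
  define g where "g x = (card {z\<in>Z. z < x}, x \<in> Z)" for x
  have sub: "range g \<subseteq> {..card Z} \<times> UNIV"
    using finZ by (auto simp: g_def intro: card_mono)
  then have fing: "finite (range g)" by (rule finite_subset) simp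
  have "card (range g) \<le> card ({..card Z} \<times> (UNIV :: bool set))"
    using sub by (intro card_mono) auto
  then have cardg: "card (range g) \<le> 2 * (card S * D + 1)" using cardZ by simp
  have *: "f x = f x'" if gx: "g x = g x'" and lt: "x < x'" for x x'
  proof (rule det)
    fix q assume q: "q \<in> S"
    have gx': "card {z\<in>Z. z < x} = card {z\<in>Z. z < x'}" "x \<in> Z \<longleftrightarrow> x' \<in> Z"
      using gx by (simp_all add: g_def)
    have "{z\<in>Z. z < x} = {z\<in>Z. z < x'}"
      by (intro card_subset_eq gx'(1)) (use lt finZ in auto)
    then have noZ: "z \<notin> Z" if "x \<le> z" "z < x'" for z
      using that by (blast dest: leD)
    moreover have "x' \<notin> Z" using noZ[of x] gx'(2) lt by simp
    ultimately have "z \<notin> Z" if "x \<le> z" "z \<le> x'" for z using that by (cases "z = x'") auto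
    then show "sgn (poly q x) = sgn (poly q x')"
      using q lt by (cases "q = 0") (auto intro!: poly_sgn_constant simp: Z_def)
  qed
  have fg: "f x = f x'" if "g x = g x'" for x x'
    using * that by (metis linorder_neqE)
  have rf: "range f \<subseteq> (\<lambda>v. f (SOME x. g x = v)) ` range g"
  proof
    fix w assume "w \<in> range f"
    then obtain x where "w = f x" by blast
    moreover have "g (SOME x'. g x' = g x) = g x" by (rule someI) simp
    ultimately show "w \<in> (\<lambda>v. f (SOME x. g x = v)) ` range g" using fg by (metis imageI rangeI)
  qed
  show "finite (range f)" by (rule finite_surj[OF fing rf])
  show "card (range f) \<le> 2 * (card S * D + 1)"
    by (rule order.trans[OF surj_card_le[OF fing rf] cardg])
qed

text \<open>A polynomial in two variables is kept as the family \<open>C\<close> of its coefficients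
  with respect to the second variable, each a polynomial in the first; this is its restriction to
  the vertical line at \<open>x\<close>.\<close>

definition slice :: "nat \<Rightarrow> (nat \<Rightarrow> real poly) \<Rightarrow> real \<Rightarrow> real poly" where
  "slice t C x = Poly (map (\<lambda>j. poly (C j) x) [0..<Suc t])"

lemma degree_slice: "degree (slice t C x) \<le> t"
  by (rule degree_le) (auto simp: slice_def coeff_Poly_eq nth_default_def simp del: upt_Suc)

lemma poly_slice: "poly (slice t C x) y = (\<Sum>j\<le>t. poly (C j) x * y ^ j)"
proof -
  have "coeff (slice t C x) j = (if j \<le> t then poly (C j) x else 0)" for j
    by (simp add: slice_def coeff_Poly_eq nth_default_def del: upt_Suc)
  then have coeffs: "coeff (slice t C x) j = poly (C j) x" if "j \<le> t" for j using that by simp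
  have "poly (slice t C x) y = poly (\<Sum>j\<le>t. monom (coeff (slice t C x) j) j) y"
    by (subst poly_as_sum_of_monoms'[OF degree_slice]) simp
  also have "\<dots> = (\<Sum>j\<le>t. poly (C j) x * y ^ j)"
    by (simp add: poly_sum poly_monom coeffs)
  finally show ?thesis .
qed

text \<open>The polynomials in \<open>S\<close> arise from a decisive family for two generic
  polynomials of degree t by putting the coefficients, as polynomials in the abscissa, in place of
  the parameters. Hence \<open>K\<close> and \<open>D\<close> depend on \<open>t\<close>
  only.\<close>

lemma exists_slice_sign_polys:
  "\<exists>K D. \<forall>C C'. (\<forall>j. degree (C j) \<le> t) \<longrightarrow> (\<forall>j. degree (C' j) \<le> t) \<longrightarrow>
     (\<exists>S. finite S \<and> card S \<le> K \<and> (\<forall>q\<in>S. degree q \<le> D) \<and>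
       (\<forall>x x'. (\<forall>q\<in>S. sgn (poly q x) = sgn (poly q x')) \<longrightarrow>
          (\<exists>\<psi>::real\<Rightarrow>real. strict_mono \<psi> \<and> surj \<psi> \<and>
             (\<forall>y. sgn (poly (slice t C x) y) = sgn (poly (slice t C x') (\<psi> y))) \<and>
             (\<forall>y. sgn (poly (slice t C' x) y) = sgn (poly (slice t C' x') (\<psi> y))))))"
proof -
  \<comment> \<open>Disjoint parameters: numbers 0 to t for the first generic polynomial, t + 1 to 2
    t + 1 for the second.\<close>
  define F G :: "((nat \<Rightarrow> real) \<Rightarrow> real) list" where
    "F = map (\<lambda>j a. a j) [0..<Suc t]" and "G = map (\<lambda>j a. a (Suc t + j)) [0..<Suc t]"
  have "\<forall>P\<in>{F, G}. \<forall>c\<in>set P. param_poly c"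
    by (auto simp: F_def G_def intro: param_poly.intros)
  with exists_sign_decisive[of "{F, G}"] obtain E where sd: "sign_decisive E {F, G}" by auto
  then have E: "finite E" "\<And>e. e \<in> E \<Longrightarrow> param_poly e"
      "\<And>a b. \<forall>e\<in>E. sgn (e a) = sgn (e b) \<Longrightarrow> sign_isomorphic {F, G} a b"
    by (simp_all add: sign_decisive_def)
  have "\<forall>e\<in>E. \<exists>D. \<forall>c. (\<forall>j. degree (c j) \<le> t) \<longrightarrow>
      (\<exists>q. degree q \<le> D \<and> (\<forall>x. poly q x = e (\<lambda>j. poly (c j) x)))"
    by (intro ballI param_poly_subst E(2))
  from bchoice[OF this] obtain B where B: "\<forall>e\<in>E. \<forall>c. (\<forall>j. degree (c j) \<le> t) \<longrightarrow>
      (\<exists>q. degree q \<le> B e \<and> (\<forall>x. poly q x = e (\<lambda>j. poly (c j) x)))" ..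
  define D where "D = (\<Sum>e\<in>E. B e)"
  have BD: "B e \<le> D" if "e \<in> E" for e
    unfolding D_def using E(1) that by (intro member_le_sum) auto
  show ?thesis
  proof (rule exI[of _ "card E"], rule exI[of _ D], intro allI impI)
    fix C C' :: "nat \<Rightarrow> real poly"
    assume C: "\<forall>j. degree (C j) \<le> t" "\<forall>j. degree (C' j) \<le> t"
    define c where "c i = (if i \<le> t then C i else C' (i - Suc t))" for i
    have c: "\<forall>j. degree (c j) \<le> t" using C by (simp add: c_def)
    have "\<forall>e\<in>E. \<exists>q. degree q \<le> B e \<and> (\<forall>x. poly q x = e (\<lambda>j. poly (c j) x))"
      using B c by simp
    from bchoice[OF this] obtain q
      where "\<forall>e\<in>E. degree (q e) \<le> B e \<and> (\<forall>x. poly (q e) x = e (\<lambda>j. poly (c j) x))" ..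
    then have q: "\<And>e. e \<in> E \<Longrightarrow> degree (q e) \<le> B e"
        "\<And>e x. e \<in> E \<Longrightarrow> poly (q e) x = e (\<lambda>j. poly (c j) x)"
      by simp_all
    have sF: "specialize F (\<lambda>j. poly (c j) x) = slice t C x" for x
      by (rule poly_eqI)
        (auto simp: coeff_specialize F_def slice_def coeff_Poly_eq nth_default_def c_def simp del: upt_Suc)
    have sG: "specialize G (\<lambda>j. poly (c j) x) = slice t C' x" for x
      by (rule poly_eqI)
        (auto simp: coeff_specialize G_def slice_def coeff_Poly_eq nth_default_def c_def simp del: upt_Suc)
    show "\<exists>S. finite S \<and> card S \<le> card E \<and> (\<forall>q\<in>S. degree q \<le> D) \<and>
       (\<forall>x x'. (\<forall>q\<in>S. sgn (poly q x) = sgn (poly q x')) \<longrightarrow>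
          (\<exists>\<psi>::real\<Rightarrow>real. strict_mono \<psi> \<and> surj \<psi> \<and>
             (\<forall>y. sgn (poly (slice t C x) y) = sgn (poly (slice t C x') (\<psi> y))) \<and>
             (\<forall>y. sgn (poly (slice t C' x) y) = sgn (poly (slice t C' x') (\<psi> y)))))"
    proof (intro exI[of _ "q ` E"] conjI allI impI)
      show "finite (q ` E)" "card (q ` E) \<le> card E" using E(1) by (auto intro: card_image_le)
      show "\<forall>p\<in>q ` E. degree p \<le> D" using q(1) BD by (auto intro: order.trans)
      fix x x' assume "\<forall>p\<in>q ` E. sgn (poly p x) = sgn (poly p x')"
      then have "sign_isomorphic {F, G} (\<lambda>j. poly (c j) x) (\<lambda>j. poly (c j) x')"
        using q(2) by (intro E(3)) auto
      then show "\<exists>\<psi>::real\<Rightarrow>real. strict_mono \<psi> \<and> surj \<psi> \<and>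
             (\<forall>y. sgn (poly (slice t C x) y) = sgn (poly (slice t C x') (\<psi> y))) \<and>
             (\<forall>y. sgn (poly (slice t C' x) y) = sgn (poly (slice t C' x') (\<psi> y)))"
        unfolding sign_isomorphic_def by (simp add: sF sG)
    qed
  qed
qed

text \<open>The zero with exactly \<open>k\<close> zeros below it is the point over a given abscissa
  of the branch number \<open>k\<close>, counted from 0. Described in this way it is invariant under
  order isomorphisms.\<close>

definition nonneg_at_root :: "real poly \<Rightarrow> real poly \<Rightarrow> nat \<Rightarrow> bool" where
  "nonneg_at_root h g k \<longleftrightarrow>
     (\<exists>y. poly h y = 0 \<and> card {z. z < y \<and> poly h z = 0} = k \<and> poly g y \<ge> 0)"

text \<open>For the points that meet no curve when they are slid downwards.\<close>

definition nonneg_at_bot :: "real poly \<Rightarrow> bool" where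
  "nonneg_at_bot g \<longleftrightarrow> (\<exists>Y. \<forall>y\<le>Y. poly g y \<ge> 0)"

lemma sgn_transfer:
  fixes a b :: real
  assumes "sgn a = sgn b"
  shows "a = 0 \<longleftrightarrow> b = 0" "a \<ge> 0 \<longleftrightarrow> b \<ge> 0"
  using assms by (auto simp: sgn_if split: if_splits)

lemma surj_ex_iff: "surj f \<Longrightarrow> (\<exists>x. P (f x)) \<longleftrightarrow> (\<exists>y. P y)"
  by (metis surj_def)

lemma surj_all_iff: "surj f \<Longrightarrow> (\<forall>x. P (f x)) \<longleftrightarrow> (\<forall>y. P y)"
  by (metis surj_def)

text \<open>An order isomorphism matching the signs of \<open>h\<close> and \<open>h'\<close>
  carries the zeros below \<open>y\<close> onto the zeros below the image of \<open>y\<close>, so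
  the number of a branch is preserved.\<close>

lemma nonneg_at_root_cong:
  fixes \<psi> :: "real \<Rightarrow> real"
  assumes "strict_mono \<psi>" "surj \<psi>"
    and "\<And>y. sgn (poly h y) = sgn (poly h' (\<psi> y))" "\<And>y. sgn (poly g y) = sgn (poly g' (\<psi> y))"
  shows "nonneg_at_root h g k = nonneg_at_root h' g' k"
proof -
  have "{z. z < \<psi> y \<and> poly h' z = 0} = \<psi> ` {z. z < y \<and> poly h z = 0}" (is "?A = ?B") for y
  proof
    show "?A \<subseteq> ?B"
    proof
      fix z assume z: "z \<in> ?A"
      obtain x where x: "z = \<psi> x" using assms(2) by (metis surj_def)
      then show "z \<in> ?B" using z strict_mono_less[OF assms(1)] sgn_transfer(1)[OF assms(3)] by auto
    qed
    show "?B \<subseteq> ?A" using strict_mono_less[OF assms(1)] sgn_transfer(1)[OF assms(3)] by auto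
  qed
  then have "card {z. z < \<psi> y \<and> poly h' z = 0} = card {z. z < y \<and> poly h z = 0}" for y
    by (simp add: card_image strict_mono_imp_inj_on[OF assms(1)])
  then have "nonneg_at_root h g k \<longleftrightarrow>
     (\<exists>y. poly h' (\<psi> y) = 0 \<and> card {z. z < \<psi> y \<and> poly h' z = 0} = k \<and> poly g' (\<psi> y) \<ge> 0)"
    unfolding nonneg_at_root_def using sgn_transfer(1)[OF assms(3)] sgn_transfer(2)[OF assms(4)] by simp
  also have "\<dots> \<longleftrightarrow> nonneg_at_root h' g' k"
    unfolding nonneg_at_root_def by (rule surj_ex_iff[OF assms(2)])
  finally show ?thesis .
qed

lemma nonneg_at_bot_cong:
  fixes \<psi> :: "real \<Rightarrow> real"
  assumes "strict_mono \<psi>" "surj \<psi>" and "\<And>y. sgn (poly g y) = sgn (poly g' (\<psi> y))"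
  shows "nonneg_at_bot g = nonneg_at_bot g'"
proof -
  have "(\<forall>y\<le>Y. poly g y \<ge> 0) \<longleftrightarrow> (\<forall>y\<le>\<psi> Y. poly g' y \<ge> 0)" for Y
  proof -
    have "(\<forall>y. \<psi> y \<le> \<psi> Y \<longrightarrow> poly g' (\<psi> y) \<ge> 0) \<longleftrightarrow> (\<forall>y\<le>\<psi> Y. poly g' y \<ge> 0)"
      by (rule surj_all_iff[OF assms(2)])
    then show ?thesis using sgn_transfer(2)[OF assms(3)] strict_mono_less_eq[OF assms(1)] by simp
  qed
  then have "nonneg_at_bot g \<longleftrightarrow> (\<exists>Y. \<forall>y\<le>\<psi> Y. poly g' y \<ge> 0)" by (simp add: nonneg_at_bot_def)
  also have "\<dots> \<longleftrightarrow> nonneg_at_bot g'" unfolding nonneg_at_bot_def by (rule surj_ex_iff[OF assms(2)])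
  finally show ?thesis .
qed

text \<open>For nonzero \<open>h\<close> the number of zeros below increases strictly from one zero
  to the next, so \<open>k\<close> singles out one zero.\<close>

lemma nonneg_at_root_iff:
  assumes "h \<noteq> 0" "poly h y = 0" "card {z. z < y \<and> poly h z = 0} = k"
  shows "nonneg_at_root h g k \<longleftrightarrow> poly g y \<ge> 0"
proof -
  have fin: "finite {z. z < u \<and> poly h z = 0}" for u
    using poly_roots_finite[OF assms(1)] by (rule rev_finite_subset) auto
  have less: "card {z. z < u \<and> poly h z = 0} < card {z. z < v \<and> poly h z = 0}" if "u < v" "poly h u = 0" for u v
    using that by (intro psubset_card_mono fin) auto
  have uniq: "y' = y" if y': "poly h y' = 0" "card {z. z < y' \<and> poly h z = 0} = k" for y'
  proof (rule ccontr)
    assume "y' \<noteq> y"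
    then consider "y' < y" | "y < y'" by linarith
    then show False
      using less[of y' y] less[of y y'] y' assms(2,3) by cases simp_all
  qed
  show ?thesis
  proof
    assume "nonneg_at_root h g k"
    then obtain y' where y': "poly h y' = 0" "card {z. z < y' \<and> poly h z = 0} = k" "poly g y' \<ge> 0"
      unfolding nonneg_at_root_def by blast
    then show "poly g y \<ge> 0" using uniq[OF y'(1,2)] by simp
  qed (use assms(2,3) in \<open>auto simp: nonneg_at_root_def\<close>)
qed

text \<open>\<open>y0\<close> is the largest ordinate up to \<open>y\<close> at which some value is
  at most \<eta> in absolute value. It exists because the set of these ordinates is closed, and by
  the intermediate value theorem no value can be below \<eta> there.\<close>

lemma slide_to_level:
  fixes g :: "'l \<Rightarrow> real poly"
  assumes fin: "finite L" and \<eta>: "\<And>l. l \<in> L \<Longrightarrow> \<bar>poly (g l) y\<bar> > \<eta>"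
    and hit: "l0 \<in> L" "y' \<le> y" "\<bar>poly (g l0) y'\<bar> \<le> \<eta>"
  shows "\<exists>y0\<le>y. (\<exists>i\<in>L. \<bar>poly (g i) y0\<bar> = \<eta>) \<and> (\<forall>l\<in>L. \<forall>z. y0 \<le> z \<longrightarrow> z \<le> y \<longrightarrow> \<bar>poly (g l) z\<bar> \<ge> \<eta>)"
proof -
  define S where "S = (\<Union>l\<in>L. {z. z \<le> y \<and> \<bar>poly (g l) z\<bar> \<le> \<eta>})"
  have "closed S" unfolding S_def
    by (intro closed_UN fin) (auto intro!: closed_Collect_conj closed_Collect_le continuous_intros)
  moreover have ne: "S \<noteq> {}" using hit by (auto simp: S_def)
  moreover have bdd: "bdd_above S" by (auto simp: S_def bdd_above_def)
  ultimately have y0S: "Sup S \<in> S" by (rule closed_contains_Sup[rotated 2])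
  define y0 where "y0 = Sup S"
  have y0: "y0 \<le> y" using y0S by (auto simp: S_def y0_def)
  have above: "\<bar>poly (g l) z\<bar> > \<eta>" if "l \<in> L" "y0 < z" "z \<le> y" for l z
  proof (rule ccontr)
    assume "\<not> ?thesis"
    then have "z \<in> S" using that by (auto simp: S_def intro!: bexI[of _ l])
    then have "z \<le> y0" unfolding y0_def using bdd by (rule cSup_upper)
    then show False using that by simp
  qed
  have at: "\<bar>poly (g l) y0\<bar> \<ge> \<eta>" if l: "l \<in> L" for l
  proof (rule ccontr)
    assume c: "\<not> ?thesis"
    then have "y0 \<noteq> y" using \<eta>[OF l] by auto
    have "\<exists>z\<ge>y0. z \<le> y \<and> \<bar>poly (g l) z\<bar> = \<eta>"
      using c \<eta>[OF l] y0 by (intro IVT') (auto intro!: continuous_intros)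
    then obtain z where z: "y0 \<le> z" "z \<le> y" "\<bar>poly (g l) z\<bar> = \<eta>" by blast
    then have "y0 < z" using c by (cases "z = y0") auto
    then show False using above[OF l _ z(2)] z by simp
  qed
  obtain i where "i \<in> L" "\<bar>poly (g i) y0\<bar> \<le> \<eta>" using y0S by (auto simp: S_def y0_def)
  then have "\<exists>i\<in>L. \<bar>poly (g i) y0\<bar> = \<eta>" using at by force
  moreover have "\<bar>poly (g l) z\<bar> \<ge> \<eta>" if "l \<in> L" "y0 \<le> z" "z \<le> y" for l z
    using at[OF that(1)] above[OF that(1), of z] that by (cases "z = y0") auto
  ultimately show ?thesis using y0 by blast
qed

text \<open>Adds a constant to a polynomial in two variables, so that its level curves become zero
  sets.\<close>

definition shift0 :: "real \<Rightarrow> (nat \<Rightarrow> real poly) \<Rightarrow> nat \<Rightarrow> real poly" where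
  "shift0 s C = C(0 := C 0 + [:s:])"

lemma degree_shift0: "\<forall>j. degree (C j) \<le> t \<Longrightarrow> \<forall>j. degree (shift0 s C j) \<le> t"
  by (auto simp: shift0_def intro!: degree_add_le)

lemma poly_slice_shift0: "poly (slice t (shift0 s C) x) y = poly (slice t C x) y + s"
  by (simp add: poly_slice shift0_def sum.atMost_shift algebra_simps)

text \<open>Each of the N entries has its own deciding family. The union of these families decides
  the whole pattern, and it has at most N K members, so the count is linear in N.\<close>

lemma card_range_sign_decided:
  fixes R :: "nat \<Rightarrow> real \<Rightarrow> bool"
  assumes S: "\<And>l. l < N \<Longrightarrow> \<exists>S. finite S \<and> card S \<le> K \<and> (\<forall>q\<in>S. degree q \<le> D) \<and>
      (\<forall>x x'. (\<forall>q\<in>S. sgn (poly q x) = sgn (poly q x')) \<longrightarrow> R l x = R l x')"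
  shows "finite (range (\<lambda>x. {l. l < N \<and> R l x}))"
    and "card (range (\<lambda>x. {l. l < N \<and> R l x})) \<le> 2 * (N * K * D + 1)"
proof -
  have "\<forall>l\<in>{..<N}. \<exists>S. finite S \<and> card S \<le> K \<and> (\<forall>q\<in>S. degree q \<le> D) \<and>
      (\<forall>x x'. (\<forall>q\<in>S. sgn (poly q x) = sgn (poly q x')) \<longrightarrow> R l x = R l x')"
    using S by simp
  from bchoice[OF this] obtain S where S: "\<forall>l\<in>{..<N}. finite (S l) \<and> card (S l) \<le> K \<and>
      (\<forall>q\<in>S l. degree q \<le> D) \<and>
      (\<forall>x x'. (\<forall>q\<in>S l. sgn (poly q x) = sgn (poly q x')) \<longrightarrow> R l x = R l x')" ..
  define U where "U = (\<Union>l<N. S l)"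
  have U: "finite U" "\<And>q. q \<in> U \<Longrightarrow> degree q \<le> D" using S by (auto simp: U_def)
  have "card U \<le> (\<Sum>l<N. card (S l))" unfolding U_def by (intro card_UN_le) simp
  also have "\<dots> \<le> (\<Sum>l<N. K)" using S by (intro sum_mono) simp
  finally have "card U \<le> N * K" by simp
  then have cU: "2 * (card U * D + 1) \<le> 2 * (N * K * D + 1)" by simp
  have det: "{l. l < N \<and> R l x} = {l. l < N \<and> R l x'}"
    if "\<And>q. q \<in> U \<Longrightarrow> sgn (poly q x) = sgn (poly q x')" for x x'
  proof -
    have "R l x = R l x'" if "l < N" for l
    proof -
      have "\<forall>q\<in>S l. sgn (poly q x) = sgn (poly q x')"
        using \<open>l < N\<close> \<open>\<And>q. q \<in> U \<Longrightarrow> sgn (poly q x) = sgn (poly q x')\<close> by (auto simp: U_def)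
      then show ?thesis using S \<open>l < N\<close> by (meson lessThan_iff)
    qed
    then show ?thesis by blast
  qed
  show "finite (range (\<lambda>x. {l. l < N \<and> R l x}))"
    by (rule card_sign_determined_le(1)[OF U det])
  show "card (range (\<lambda>x. {l. l < N \<and> R l x})) \<le> 2 * (N * K * D + 1)"
    by (rule order.trans[OF card_sign_determined_le(2)[OF U det] cU])
qed

lemma card_sign_patterns_line:
  fixes C :: "nat \<Rightarrow> real poly"
  assumes "\<And>l. degree (C l) \<le> t"
  shows "card ((\<lambda>x. {l. l < N \<and> poly (C l) x \<ge> 0}) ` X) \<le> 2 * (N * t + 1)"
proof -
  have 1: "\<exists>S. finite S \<and> card S \<le> 1 \<and> (\<forall>q\<in>S. degree q \<le> t) \<and>
      (\<forall>x x'. (\<forall>q\<in>S. sgn (poly q x) = sgn (poly q x')) \<longrightarrow>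
        (poly (C l) x \<ge> 0) = (poly (C l) x' \<ge> 0))" for l
  proof (intro exI[of _ "{C l}"] conjI allI impI)
    fix x x' assume "\<forall>q\<in>{C l}. sgn (poly q x) = sgn (poly q x')"
    then show "(poly (C l) x \<ge> 0) = (poly (C l) x' \<ge> 0)" by (intro sgn_transfer(2)) simp
  qed (use assms in auto)
  have "card ((\<lambda>x. {l. l < N \<and> poly (C l) x \<ge> 0}) ` X) \<le>
      card (range (\<lambda>x. {l. l < N \<and> poly (C l) x \<ge> 0}))"
    by (intro card_mono card_range_sign_decided(1)[where R = "\<lambda>l x. poly (C l) x \<ge> 0", OF 1]) auto
  also have "\<dots> \<le> 2 * (N * 1 * t + 1)"
    by (rule card_range_sign_decided(2)[where R = "\<lambda>l x. poly (C l) x \<ge> 0", OF 1])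
  finally show ?thesis by simp
qed

text \<open>The factor 3 leaves room for a shift by 2 \<eta>: afterwards the negative values lie
  below -\<eta> and the others above \<eta>. Inserting -1 covers the case without negative
  values.\<close>

lemma exists_gap_below_zero:
  fixes V :: "real set"
  assumes "finite V"
  shows "\<exists>\<eta>>0. \<forall>v\<in>V. v < 0 \<longrightarrow> v < - 3 * \<eta>"
proof -
  define M where "M = Max (insert (- 1) {v\<in>V. v < 0})"
  have "M \<in> insert (- 1) {v\<in>V. v < 0}" unfolding M_def using assms by (intro Max_in) auto
  then have "M < 0" by auto
  moreover have "v \<le> M" if "v \<in> V" "v < 0" for v unfolding M_def using that assms by (intro Max_ge) auto
  ultimately show ?thesis by (intro exI[of _ "- M / 4"]) fastforce
qed

text \<open>After a small perturbation every point can be slid down its vertical line to a point of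
  some curve \<open>f\<^sub>i = const\<close> without changing its pattern. On the \<open>k\<close>-th branch of this curve the
  pattern is a function of the abscissa alone, and each entry changes boundedly often.\<close>

lemma card_sign_patterns_plane:
  "\<exists>c. \<forall>N\<ge>1. \<forall>C :: nat \<Rightarrow> nat \<Rightarrow> real poly. \<forall>X :: (real \<times> real) set.
     (\<forall>l j. degree (C l j) \<le> t) \<longrightarrow> finite X \<longrightarrow>
     card ((\<lambda>(x, y). {l. l < N \<and> poly (slice t (C l) x) y \<ge> 0}) ` X) \<le> c * N ^ 2"
proof -
  from exists_slice_sign_polys[of t] obtain K D where KD:
    "\<forall>C C'. (\<forall>j. degree (C j) \<le> t) \<longrightarrow> (\<forall>j. degree (C' j) \<le> t) \<longrightarrow>
     (\<exists>S. finite S \<and> card S \<le> K \<and> (\<forall>q\<in>S. degree q \<le> D) \<and>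
       (\<forall>x x'. (\<forall>q\<in>S. sgn (poly q x) = sgn (poly q x')) \<longrightarrow>
          (\<exists>\<psi>::real\<Rightarrow>real. strict_mono \<psi> \<and> surj \<psi> \<and>
             (\<forall>y. sgn (poly (slice t C x) y) = sgn (poly (slice t C x') (\<psi> y))) \<and>
             (\<forall>y. sgn (poly (slice t C' x) y) = sgn (poly (slice t C' x') (\<psi> y))))))"
    by blast
  show ?thesis
  proof (intro exI[of _ "2 * (2 * t + 3) * (K * D + 1)"] allI impI)
    fix N :: nat and C :: "nat \<Rightarrow> nat \<Rightarrow> real poly" and X :: "(real \<times> real) set"
    assume N: "1 \<le> N" and C: "\<forall>l j. degree (C l j) \<le> t" and X: "finite X"
    define f where "f l p = poly (slice t (C l) (fst p)) (snd p)" for l p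
    obtain \<eta> where \<eta>: "\<eta> > 0" "\<And>l p. l < N \<Longrightarrow> p \<in> X \<Longrightarrow> f l p < 0 \<Longrightarrow> f l p < - 3 * \<eta>"
      using exists_gap_below_zero[of "(\<Union>l<N. f l ` X)"] X by auto
    \<comment> \<open>Adding 2 \<eta> keeps the pattern on \<open>X\<close> and makes all values
      there larger than \<eta> in absolute value.\<close>
    define G where "G l = slice t (shift0 (2 * \<eta>) (C l))" for l
    \<comment> \<open>The level |G i| = \<eta> consists of the curves f i + s = 0 with s = \<eta>
      and s = 3 \<eta>.\<close>
    define H where "H i s = slice t (shift0 s (C i))" for i s
    define T where "T i s k x = {l. l < N \<and> nonneg_at_root (H i s x) (G l x) k}" for i s k x
    define Tb where "Tb x = {l. l < N \<and> nonneg_at_bot (G l x)}" for x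
    define B where "B = 2 * (N * K * D + 1)"
    have sh: "\<forall>j. degree (shift0 s (C l) j) \<le> t" for s l using C by (intro degree_shift0) auto
    have "\<exists>S. finite S \<and> card S \<le> K \<and> (\<forall>q\<in>S. degree q \<le> D) \<and>
      (\<forall>x x'. (\<forall>q\<in>S. sgn (poly q x) = sgn (poly q x')) \<longrightarrow>
         nonneg_at_root (H i s x) (G l x) k = nonneg_at_root (H i s x') (G l x') k)" for i s k l
    proof -
      obtain S where S: "finite S" "card S \<le> K" "\<forall>q\<in>S. degree q \<le> D"
        "\<And>x x'. \<forall>q\<in>S. sgn (poly q x) = sgn (poly q x') \<Longrightarrow>
          (\<exists>\<psi>::real\<Rightarrow>real. strict_mono \<psi> \<and> surj \<psi> \<and>
             (\<forall>y. sgn (poly (H i s x) y) = sgn (poly (H i s x') (\<psi> y))) \<and>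
             (\<forall>y. sgn (poly (G l x) y) = sgn (poly (G l x') (\<psi> y))))"
        using mp[OF mp[OF spec[OF spec[OF KD, of "shift0 s (C i)"], of "shift0 (2 * \<eta>) (C l)"] sh] sh]
        unfolding H_def G_def by blast
      have "nonneg_at_root (H i s x) (G l x) k = nonneg_at_root (H i s x') (G l x') k"
        if eq: "\<forall>q\<in>S. sgn (poly q x) = sgn (poly q x')" for x x'
      proof -
        obtain \<psi> :: "real \<Rightarrow> real" where "strict_mono \<psi>" "surj \<psi>"
          "\<forall>y. sgn (poly (H i s x) y) = sgn (poly (H i s x') (\<psi> y))"
          "\<forall>y. sgn (poly (G l x) y) = sgn (poly (G l x') (\<psi> y))"
          using S(4)[OF eq] by blast
        then show ?thesis by (intro nonneg_at_root_cong) blast+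
      qed
      then show ?thesis using S(1-3) by blast
    qed
    note dec1 = this
    have T1: "finite (range (T i s k))" "card (range (T i s k)) \<le> B" for i s k
    proof -
      have "T i s k = (\<lambda>x. {l. l < N \<and> nonneg_at_root (H i s x) (G l x) k})"
        by (rule ext) (simp add: T_def)
      then show "finite (range (T i s k))" "card (range (T i s k)) \<le> B"
        using card_range_sign_decided[of N K D "\<lambda>l x. nonneg_at_root (H i s x) (G l x) k", OF dec1]
        by (simp_all only: B_def)
    qed
    have "\<exists>S. finite S \<and> card S \<le> K \<and> (\<forall>q\<in>S. degree q \<le> D) \<and>
      (\<forall>x x'. (\<forall>q\<in>S. sgn (poly q x) = sgn (poly q x')) \<longrightarrow>
         nonneg_at_bot (G l x) = nonneg_at_bot (G l x'))" for l
    proof -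
      obtain S where S: "finite S" "card S \<le> K" "\<forall>q\<in>S. degree q \<le> D"
        "\<And>x x'. \<forall>q\<in>S. sgn (poly q x) = sgn (poly q x') \<Longrightarrow>
          (\<exists>\<psi>::real\<Rightarrow>real. strict_mono \<psi> \<and> surj \<psi> \<and>
             (\<forall>y. sgn (poly (G l x) y) = sgn (poly (G l x') (\<psi> y))) \<and>
             (\<forall>y. sgn (poly (G l x) y) = sgn (poly (G l x') (\<psi> y))))"
        using mp[OF mp[OF spec[OF spec[OF KD, of "shift0 (2 * \<eta>) (C l)"], of "shift0 (2 * \<eta>) (C l)"] sh] sh]
        unfolding G_def by blast
      have "nonneg_at_bot (G l x) = nonneg_at_bot (G l x')"
        if eq: "\<forall>q\<in>S. sgn (poly q x) = sgn (poly q x')" for x x'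
      proof -
        obtain \<psi> :: "real \<Rightarrow> real" where "strict_mono \<psi>" "surj \<psi>"
          "\<forall>y. sgn (poly (G l x) y) = sgn (poly (G l x') (\<psi> y))"
          using S(4)[OF eq] by blast
        then show ?thesis by (intro nonneg_at_bot_cong) blast+
      qed
      then show ?thesis using S(1-3) by blast
    qed
    note dec2 = this
    have T2: "finite (range Tb)" "card (range Tb) \<le> B"
    proof -
      have "Tb = (\<lambda>x. {l. l < N \<and> nonneg_at_bot (G l x)})"
        by (rule ext) (simp add: Tb_def)
      then show "finite (range Tb)" "card (range Tb) \<le> B"
        using card_range_sign_decided[of N K D "\<lambda>l x. nonneg_at_bot (G l x)", OF dec2]
        by (simp_all only: B_def)
    qed
    \<comment> \<open>A curve, one of its two levels and a branch: at most 2 (t + 1) N choices, each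
      leaving at most \<open>B\<close> patterns. As \<open>B\<close> is linear in N, the total is
      quadratic.\<close>
    define J where "J = {..<N} \<times> {\<eta>, 3 * \<eta>} \<times> {..t}"
    have finJ: "finite J" by (simp add: J_def)
    have "{l. l < N \<and> f l p \<ge> 0} \<in> (\<Union>(i, s, k)\<in>J. range (T i s k)) \<union> range Tb" if p: "p \<in> X" for p
    proof -
      define x y where "x = fst p" and "y = snd p"
      have Gf: "poly (G l x) y = f l p + 2 * \<eta>" for l
        by (simp add: G_def f_def x_def y_def poly_slice_shift0)
      have Gy: "\<bar>poly (G l x) y\<bar> > \<eta>" if "l < N" for l
        using \<eta>(2)[OF that p] \<eta>(1) unfolding Gf by linarith
      have fG: "f l p \<ge> 0 \<longleftrightarrow> poly (G l x) y \<ge> 0" if "l < N" for l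
        using \<eta>(2)[OF that p] \<eta>(1) unfolding Gf by linarith
      show ?thesis
      proof (cases "\<exists>l<N. \<exists>y'\<le>y. \<bar>poly (G l x) y'\<bar> \<le> \<eta>")
        case True
        then obtain l0 y' where "l0 \<in> {..<N}" "y' \<le> y" "\<bar>poly (G l0 x) y'\<bar> \<le> \<eta>" by auto
        from slide_to_level[of "{..<N}" \<eta> "\<lambda>l. G l x" y, OF _ _ this] Gy
        obtain y0 i where y0: "y0 \<le> y" "i < N" "\<bar>poly (G i x) y0\<bar> = \<eta>"
          "\<And>l z. l < N \<Longrightarrow> y0 \<le> z \<Longrightarrow> z \<le> y \<Longrightarrow> \<bar>poly (G l x) z\<bar> \<ge> \<eta>"
          by auto
        \<comment> \<open>All values stay at least \<eta> in absolute value along the segment, so no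
          sign changes on the way down.\<close>
        have sg: "sgn (poly (G l x) y0) = sgn (poly (G l x) y)" if "l < N" for l
          using y0(1) y0(4)[OF that] \<eta>(1) by (intro poly_sgn_constant) force+
        have fG0: "f l p \<ge> 0 \<longleftrightarrow> poly (G l x) y0 \<ge> 0" if "l < N" for l
          using fG[OF that] sgn_transfer(2)[OF sg[OF that]] by simp
        have GH: "poly (H i s x) z = poly (G i x) z + (s - 2 * \<eta>)" for s z
          by (simp add: H_def G_def poly_slice_shift0)
        obtain s where s: "s = \<eta> \<or> s = 3 * \<eta>" "poly (H i s x) y0 = 0"
        proof (cases "poly (G i x) y0 \<ge> 0")
          case True
          then have "poly (H i \<eta> x) y0 = 0" using y0(3) GH[of \<eta> y0] by linarith
          then show ?thesis using that by blast
        next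
          case False
          then have "poly (H i (3 * \<eta>) x) y0 = 0" using y0(3) GH[of "3 * \<eta>" y0] by linarith
          then show ?thesis using that by blast
        qed
        \<comment> \<open>If the vertical line belonged to the curve, then f i p would be -\<eta> or
          -3 \<eta>, and no value on \<open>X\<close> is in the gap between -3 \<eta> and 0.\<close>
        have Hne: "H i s x \<noteq> 0"
        proof
          assume "H i s x = 0"
          then have "f i p + s = 0" using GH[of s y] Gf[of i] by simp
          then show False using s(1) \<eta>(1) \<eta>(2)[OF y0(2) p] by linarith
        qed
        define k where "k = card {z. z < y0 \<and> poly (H i s x) z = 0}"
        have "k \<le> card {z. poly (H i s x) z = 0}"
          unfolding k_def using poly_roots_finite[OF Hne] by (intro card_mono) auto
        also have "\<dots> \<le> degree (H i s x)" by (rule card_poly_roots_bound[OF Hne])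
        also have "\<dots> \<le> t" unfolding H_def by (rule degree_slice)
        finally have "(i, s, k) \<in> J" using y0(2) s(1) by (auto simp: J_def)
        moreover have "{l. l < N \<and> f l p \<ge> 0} = T i s k x"
          unfolding T_def nonneg_at_root_iff[OF Hne s(2) k_def[symmetric]] using fG0 by auto
        ultimately show ?thesis by blast
      next
        case False
        \<comment> \<open>No level is met below p, so all signs are constant on the downward ray and
          can be read off at minus infinity.\<close>
        have "nonneg_at_bot (G l x) \<longleftrightarrow> f l p \<ge> 0" if l: "l < N" for l
        proof -
          have sgz: "sgn (poly (G l x) z) = sgn (poly (G l x) y)" if "z \<le> y" for z
            using that False l \<eta>(1) by (intro poly_sgn_constant) force+
          have eq: "poly (G l x) z \<ge> 0 \<longleftrightarrow> f l p \<ge> 0" if "z \<le> y" for z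
            using sgn_transfer(2)[OF sgz[OF that]] fG[OF l] by simp
          show ?thesis
          proof
            assume "nonneg_at_bot (G l x)"
            then obtain Y where "\<forall>y\<le>Y. poly (G l x) y \<ge> 0" by (auto simp: nonneg_at_bot_def)
            then show "f l p \<ge> 0" using eq[of "min Y y"] by simp
          qed (use eq in \<open>auto simp: nonneg_at_bot_def\<close>)
        qed
        then have "{l. l < N \<and> f l p \<ge> 0} = Tb x" by (auto simp: Tb_def)
        then show ?thesis by blast
      qed
    qed
    then have sub: "(\<lambda>p. {l. l < N \<and> f l p \<ge> 0}) ` X \<subseteq> (\<Union>(i, s, k)\<in>J. range (T i s k)) \<union> range Tb"
      by blast
    have "card ((\<lambda>p. {l. l < N \<and> f l p \<ge> 0}) ` X) \<le> card ((\<Union>(i, s, k)\<in>J. range (T i s k)) \<union> range Tb)"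
      using finJ T1(1) T2(1) by (intro card_mono[OF _ sub]) auto
    also have "\<dots> \<le> card (\<Union>(i, s, k)\<in>J. range (T i s k)) + card (range Tb)" by (rule card_Un_le)
    also have "card (\<Union>(i, s, k)\<in>J. range (T i s k)) \<le> (\<Sum>(i, s, k)\<in>J. card (range (T i s k)))"
      using card_UN_le[OF finJ, of "\<lambda>(i, s, k). range (T i s k)"] by (simp add: case_prod_beta)
    also have "\<dots> \<le> (\<Sum>j\<in>J. B)" using T1(2) by (intro sum_mono) auto
    also have "\<dots> = card J * B" by simp
    also have "card J \<le> N * (2 * (t + 1))"
      by (simp add: J_def card_cartesian_product card_insert_if)
    also have "card (range Tb) \<le> B" by (rule T2(2))
    also have "N * (2 * (t + 1)) * B + B \<le> 2 * (2 * t + 3) * (K * D + 1) * N ^ 2"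
    proof -
      have "N * (2 * (t + 1)) * B + B = (N * (2 * (t + 1)) + 1) * (2 * (N * K * D + 1))"
        by (simp add: B_def algebra_simps)
      also have "\<dots> \<le> (N * (2 * t + 3)) * (2 * (N * (K * D + 1)))"
        using N by (intro mult_le_mono) (auto simp: algebra_simps)
      also have "\<dots> = 2 * (2 * t + 3) * (K * D + 1) * N ^ 2"
        by (simp add: power2_eq_square algebra_simps)
      finally show ?thesis .
    qed
    finally show "card ((\<lambda>(x, y). {l. l < N \<and> poly (slice t (C l) x) y \<ge> 0}) ` X)
        \<le> 2 * (2 * t + 3) * (K * D + 1) * N ^ 2"
      by (simp add: f_def case_prod_beta)
  qed
qed

section \<open>Paths with few crossings\<close>

definition distinguishing :: "'q set \<Rightarrow> ('p \<Rightarrow> 'q \<Rightarrow> bool) \<Rightarrow> 'p \<Rightarrow> 'p \<Rightarrow> 'q set" where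
  "distinguishing Q R p p' = {q \<in> Q. R p q \<noteq> R p' q}"

lemma distinguishing_commute: "distinguishing Q R p p' = distinguishing Q R p' p"
  by (auto simp: distinguishing_def)

text \<open>Sampling done by counting: every r-tuple from \<open>Q\<close> fails to separate some
  pair, hence avoids the points distinguishing it. If all pairs had more than x n such points, x = 2
  ln i / r, a fixed pair would be missed by at most n^r exp (- x r) = n^r / i^2 tuples. Fewer than
  i^2 ordered pairs cannot account for all n^r tuples.\<close>

lemma exists_close_pair_length:
  fixes R :: "'p \<Rightarrow> 'q \<Rightarrow> bool"
  assumes fin: "finite A" "finite Q" and A: "card A \<ge> 2" and r: "r \<ge> 1"
    and traces: "\<And>qs. set qs \<subseteq> Q \<Longrightarrow> length qs = r \<Longrightarrow> card ((\<lambda>p. map (R p) qs) ` A) < card A"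
  shows "\<exists>p\<in>A. \<exists>p'\<in>A. p \<noteq> p' \<and>
           real (card (distinguishing Q R p p')) \<le> 2 * ln (card A) / r * card Q"
proof (rule ccontr)
  assume "\<not> ?thesis"
  then have far: "real (card (distinguishing Q R p p')) > 2 * ln (card A) / r * card Q"
    if "p \<in> A" "p' \<in> A" "p \<noteq> p'" for p p' using that by force
  define n i x where "n = card Q" and "i = card A" and "x = 2 * ln (card A) / r"
  define W where "W = {(p, p'). p \<in> A \<and> p' \<in> A \<and> p \<noteq> p'}"
  have W: "W \<subseteq> A \<times> A" by (auto simp: W_def)
  have finW: "finite W" using W fin(1) by (meson finite_SigmaI finite_subset)
  have cW: "card W < i * i"
  proof -
    obtain p where "p \<in> A" using A by fastforce
    then have "W \<subset> A \<times> A" using W by (auto simp: W_def)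
    then have "card W < card (A \<times> A)" using fin by (intro psubset_card_mono) auto
    then show ?thesis by (simp add: card_cartesian_product i_def)
  qed
  define L where "L S = {qs. set qs \<subseteq> S \<and> length qs = r}" for S :: "'q set"
  have cL: "card (L S) = card S ^ r" "finite (L S)" if "finite S" for S
    using that by (auto simp: L_def card_lists_length_eq finite_lists_length_eq)
  have "L Q \<subseteq> (\<Union>(p, p')\<in>W. L (Q - distinguishing Q R p p'))"
  proof
    fix qs assume qs: "qs \<in> L Q"
    then have "card ((\<lambda>p. map (R p) qs) ` A) < card A" using traces by (auto simp: L_def)
    then have "\<not> inj_on (\<lambda>p. map (R p) qs) A" using pigeonhole by blast
    then obtain p p' where pp: "p \<in> A" "p' \<in> A" "p \<noteq> p'" "map (R p) qs = map (R p') qs"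
      by (auto simp: inj_on_def)
    then have "qs \<in> L (Q - distinguishing Q R p p')"
      using qs by (auto simp: L_def distinguishing_def)
    then show "qs \<in> (\<Union>(p, p')\<in>W. L (Q - distinguishing Q R p p'))" using pp by (auto simp: W_def)
  qed
  then have "card (L Q) \<le> card (\<Union>(p, p')\<in>W. L (Q - distinguishing Q R p p'))"
    using finW cL(2) fin(2) by (intro card_mono) auto
  also have "\<dots> \<le> (\<Sum>w\<in>W. card (case w of (p, p') \<Rightarrow> L (Q - distinguishing Q R p p')))"
    by (rule card_UN_le[OF finW])
  finally have "real (n ^ r) \<le> (\<Sum>w\<in>W. real (card (case w of (p, p') \<Rightarrow> L (Q - distinguishing Q R p p'))))"
    using cL fin(2) by (simp add: n_def flip: of_nat_sum)
  also have "\<dots> \<le> (\<Sum>w\<in>W. real n ^ r / (real i * real i))"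
  proof (rule sum_mono)
    fix w assume "w \<in> W"
    then obtain p p' where w: "w = (p, p')" "p \<in> A" "p' \<in> A" "p \<noteq> p'" by (auto simp: W_def)
    let ?d = "distinguishing Q R p p'"
    have i0: "real i > 0" using A by (simp add: i_def)
    have sub: "?d \<subseteq> Q" by (auto simp: distinguishing_def)
    then have "real (card (Q - ?d)) = real n - real (card ?d)"
      using fin(2) by (simp add: card_Diff_subset finite_subset n_def of_nat_diff card_mono)
    also have "\<dots> \<le> real n * (1 - x)" using far[OF w(2-4)] by (simp add: x_def n_def algebra_simps)
    also have "\<dots> \<le> real n * exp (- x)" using exp_ge_add_one_self[of "- x"] by (intro mult_left_mono) auto
    finally have "real (card (Q - ?d)) ^ r \<le> (real n * exp (- x)) ^ r" by (intro power_mono) auto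
    also have "\<dots> = real n ^ r * exp (- (x * r))" by (simp add: power_mult_distrib mult.commute flip: exp_of_nat_mult)
    also have "x * r = ln (real i) + ln (real i)" using r by (simp add: x_def i_def)
    also have "exp (- (ln (real i) + ln (real i))) = 1 / (real i * real i)"
      by (simp only: exp_minus exp_add exp_ln[OF i0] inverse_eq_divide)
    finally show "real (card (case w of (p, p') \<Rightarrow> L (Q - distinguishing Q R p p'))) \<le> real n ^ r / (real i * real i)"
      using cL(1)[of "Q - ?d"] fin(2) w(1) by simp
  qed
  also have "\<dots> = real (card W) / (real i * real i) * real n ^ r" by simp
  finally have le: "real n ^ r \<le> real (card W) / (real i * real i) * real n ^ r" by simp
  have "real (card W) < real i * real i" using cW by (metis of_nat_less_iff of_nat_mult)
  then have "real (card W) / (real i * real i) < 1" using A by (simp add: i_def)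
  \<comment> \<open>The final comparison is strict only if n^r is positive; over an empty
    \<open>Q\<close> no pair would be far apart.\<close>
  moreover have "n > 0"
  proof -
    obtain p p' where "p \<in> A" "p' \<in> A" "p \<noteq> p'"
      using A by (metis card_le_Suc0_iff_eq fin(1) not_less_eq_eq numeral_2_eq_2)
    then have "real (card (distinguishing Q R p p')) > 2 * ln (card A) / r * card Q" by (rule far)
    moreover have "2 * ln (card A) / r * card Q \<ge> 0" using A by simp
    ultimately have "distinguishing Q R p p' \<noteq> {}" by auto
    then show ?thesis using fin(2) by (auto simp: distinguishing_def n_def card_gt_0_iff)
  qed
  ultimately have "real (card W) / (real i * real i) * real n ^ r < 1 * real n ^ r"
    by (intro mult_strict_right_mono) auto
  then show False using le by simp
qed

text \<open>The sample size r is the integer part of (j / c)^(1/\<kappa>), so that c r^\<kappa>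
  \<le> j < card A. Rounding costs a factor 2, and c^(1/\<kappa>) \<le> c; with the 2 of the
  sampling bound this gives 4 c.\<close>

lemma exists_close_pair:
  fixes R :: "'p \<Rightarrow> 'q \<Rightarrow> bool"
  assumes fin: "finite A" "finite Q" and A: "card A = Suc j" "j \<ge> 1" and "\<kappa> \<ge> 1" "c \<ge> 1"
    and traces: "\<And>qs. set qs \<subseteq> Q \<Longrightarrow> qs \<noteq> [] \<Longrightarrow> card ((\<lambda>p. map (R p) qs) ` A) \<le> c * length qs ^ \<kappa>"
  shows "\<exists>p\<in>A. \<exists>p'\<in>A. p \<noteq> p' \<and> real (card (distinguishing Q R p p')) \<le>
           4 * real c * ln (Suc j) * real j powr (- 1 / \<kappa>) * card Q"
proof (cases "j < c")
  case True
  obtain p p' where pp: "p \<in> A" "p' \<in> A" "p \<noteq> p'"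
    using A by (metis One_nat_def card_le_Suc0_iff_eq fin(1) not_less_eq_eq Suc_le_mono)
  have "distinguishing Q R p p' \<subseteq> Q" by (auto simp: distinguishing_def)
  then have "real (card (distinguishing Q R p p')) \<le> 1 * real (card Q)" using fin(2) by (simp add: card_mono)
  \<comment> \<open>For j < c no sample is taken: the claimed bound is at least
    \<open>card Q\<close>, because 4 ln 2 \<ge> 1 and j^(1/\<kappa>) \<le> c.\<close>
  also have "\<dots> \<le> (4 * real c * ln (Suc j) * real j powr (- 1 / \<kappa>)) * card Q"
  proof (rule mult_right_mono)
    have "ln (Suc j) \<ge> ln (2::real)" using A by simp
    then have "4 * ln (Suc j) \<ge> 1" using ln2_ge_two_thirds by linarith
    moreover have "real c * real j powr (- 1 / \<kappa>) \<ge> 1"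
    proof -
      have "real j powr (1 / \<kappa>) \<le> real j powr 1"
        using A \<open>\<kappa> \<ge> 1\<close> by (intro powr_mono) auto
      also have "\<dots> \<le> c" using True A by simp
      finally show ?thesis using A by (simp add: powr_minus field_simps)
    qed
    ultimately have "1 * 1 \<le> (4 * ln (Suc j)) * (real c * real j powr (- 1 / \<kappa>))"
      by (intro mult_mono) auto
    then show "1 \<le> 4 * real c * ln (Suc j) * real j powr (- 1 / \<kappa>)" by (simp add: mult_ac)
  qed simp
  finally have le: "real (card (distinguishing Q R p p')) \<le>
      4 * real c * ln (Suc j) * real j powr (- 1 / \<kappa>) * card Q" .
  show ?thesis by (rule bexI[of _ p], rule bexI[of _ p']) (intro conjI pp(1-3) le)+
next
  case False
  define y where "y = (real j / c) powr (1 / \<kappa>)"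
  have "y \<ge> 1" using False \<open>c \<ge> 1\<close> by (simp add: y_def ge_one_powr_ge_zero)
  define r where "r = nat \<lfloor>y\<rfloor>"
  have r: "r \<ge> 1" "real r \<le> y" "y \<le> 2 * real r"
  proof -
    have fl: "\<lfloor>y\<rfloor> \<ge> 1" using \<open>y \<ge> 1\<close> by (simp add: le_floor_iff)
    then have "real r = of_int \<lfloor>y\<rfloor>" by (simp add: r_def)
    then show "r \<ge> 1" "real r \<le> y" "y \<le> 2 * real r" using fl floor_correct[of y] by linarith+
  qed
  have "real (c * r ^ \<kappa>) \<le> c * y ^ \<kappa>" using r by (simp add: mult_left_mono power_mono)
  also have "y ^ \<kappa> = y powr real \<kappa>" using \<open>y \<ge> 1\<close> by (simp add: powr_realpow)
  also have "y powr real \<kappa> = real j / c" using \<open>\<kappa> \<ge> 1\<close> A \<open>c \<ge> 1\<close> by (simp add: y_def powr_powr)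
  finally have "real (c * r ^ \<kappa>) \<le> real j" using \<open>c \<ge> 1\<close> by simp
  then have cr: "c * r ^ \<kappa> \<le> j" by linarith
  have "card ((\<lambda>p. map (R p) qs) ` A) < card A" if "set qs \<subseteq> Q" "length qs = r" for qs
    using traces[of qs] that r cr A by fastforce
  with exists_close_pair_length[OF fin _ r(1), of R] A
  obtain p p' where pp: "p \<in> A" "p' \<in> A" "p \<noteq> p'"
    "real (card (distinguishing Q R p p')) \<le> 2 * ln (card A) / r * card Q" by auto
  have "2 * ln (card A) / r \<le> 4 * real c * ln (Suc j) * real j powr (- 1 / \<kappa>)"
  proof -
    have "2 * ln (card A) / r \<le> 2 * ln (Suc j) * (2 / y)"
    proof -
      have "1 / real r \<le> 2 / y" using r \<open>y \<ge> 1\<close> by (simp add: field_simps)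
      then have "2 * ln (Suc j) * (1 / real r) \<le> 2 * ln (Suc j) * (2 / y)"
        by (intro mult_left_mono) auto
      then show ?thesis using A by simp
    qed
    also have "1 / y \<le> c * real j powr (- 1 / \<kappa>)"
    proof -
      have "1 / y = real c powr (1 / \<kappa>) * real j powr (- 1 / \<kappa>)"
        using A \<open>c \<ge> 1\<close> by (simp add: y_def powr_divide powr_minus_divide)
      also have "real c powr (1 / \<kappa>) \<le> real c powr 1"
        using \<open>c \<ge> 1\<close> \<open>\<kappa> \<ge> 1\<close> by (intro powr_mono) auto
      finally show ?thesis using \<open>c \<ge> 1\<close> by (simp add: mult_right_mono)
    qed
    then have "2 * ln (Suc j) * (2 / y) \<le> 4 * real c * ln (Suc j) * real j powr (- 1 / \<kappa>)"
      using mult_left_mono[of "1 / y" "c * real j powr (- 1 / \<kappa>)" "4 * ln (Suc j)"]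
      by (simp add: mult_ac)
    finally show ?thesis .
  qed
  then have "2 * ln (card A) / r * card Q \<le> 4 * real c * ln (Suc j) * real j powr (- 1 / \<kappa>) * card Q"
    by (intro mult_right_mono) auto
  with pp(4) have le: "real (card (distinguishing Q R p p')) \<le>
      4 * real c * ln (Suc j) * real j powr (- 1 / \<kappa>) * card Q" by (rule order.trans)
  show ?thesis by (rule bexI[of _ p], rule bexI[of _ p']) (intro conjI pp(1-3) le)+
qed

section \<open>Paths along which neighbourhoods change rarely\<close>

fun path_cost :: "'q set \<Rightarrow> ('p \<Rightarrow> 'q \<Rightarrow> bool) \<Rightarrow> 'p list \<Rightarrow> nat" where
  "path_cost Q R (x # y # xs) = card (distinguishing Q R x y) + path_cost Q R (y # xs)"
| "path_cost Q R _ = 0"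

lemma path_cost_append:
  assumes "ys \<noteq> []"
  shows "xs \<noteq> [] \<Longrightarrow> path_cost Q R (xs @ ys) =
    path_cost Q R xs + card (distinguishing Q R (last xs) (hd ys)) + path_cost Q R ys"
proof (induction xs rule: induct_list012)
  case (2 x)
  then show ?case using assms by (cases ys) auto
qed auto

lemma path_cost_rev: "path_cost Q R (rev xs) = path_cost Q R xs"
proof (induction xs rule: induct_list012)
  case (3 x y zs)
  then show ?case using path_cost_append[of "[x]" "rev zs @ [y]" Q R]
    by (simp add: distinguishing_commute)
qed auto

lemma path_cost_eq_sum:
  "path_cost Q R xs = (\<Sum>j<length xs - 1. card (distinguishing Q R (xs ! j) (xs ! Suc j)))"
proof (induction xs rule: induct_list012)
  case (3 x y zs)
  then show ?case by (simp add: sum.lessThan_Suc_shift del: sum.lessThan_Suc)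
qed auto

text \<open>Starting from one-point paths, two are joined at a time. Among i + 1 paths some two have
  heads at distance at most \<open>f i\<close>, and reversing one path makes these heads adjacent;
  each join therefore adds at most \<open>f i\<close> to the total cost.\<close>

lemma exists_path_family:
  fixes f :: "nat \<Rightarrow> real"
  assumes P: "finite P" and j: "1 \<le> j" "j \<le> card P"
    and close: "\<And>A i. A \<subseteq> P \<Longrightarrow> 1 \<le> i \<Longrightarrow> card A = Suc i \<Longrightarrow>
      \<exists>p\<in>A. \<exists>p'\<in>A. p \<noteq> p' \<and> real (card (distinguishing Q R p p')) \<le> f i"
  shows "\<exists>\<L>. finite \<L> \<and> card \<L> = j \<and> (\<forall>L\<in>\<L>. L \<noteq> [] \<and> distinct L) \<and>
    (\<forall>L\<in>\<L>. \<forall>L'\<in>\<L>. L \<noteq> L' \<longrightarrow> set L \<inter> set L' = {}) \<and> (\<Union>L\<in>\<L>. set L) = P \<and>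
    (\<Sum>L\<in>\<L>. real (path_cost Q R L)) \<le> (\<Sum>i=j..<card P. f i)"
  using j(2,1)
proof (induction rule: inc_induct)
  case base
  define \<L> where "\<L> = (\<lambda>p. [p]) ` P"
  have "card \<L> = card P" unfolding \<L>_def by (rule card_image) (auto simp: inj_on_def)
  then show ?case using P by (intro exI[of _ \<L>]) (auto simp: \<L>_def sum.reindex inj_on_def)
next
  case (step i)
  then obtain \<L> where L: "finite \<L>" "card \<L> = Suc i" "\<And>L. L \<in> \<L> \<Longrightarrow> L \<noteq> [] \<and> distinct L"
    "\<And>L L'. L \<in> \<L> \<Longrightarrow> L' \<in> \<L> \<Longrightarrow> L \<noteq> L' \<Longrightarrow> set L \<inter> set L' = {}" "(\<Union>L\<in>\<L>. set L) = P"
    "(\<Sum>L\<in>\<L>. real (path_cost Q R L)) \<le> (\<Sum>i=Suc i..<card P. f i)"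
    by auto
  \<comment> \<open>Disjoint paths have different heads, so the heads form a set of i + 1 points to
    which \<open>close\<close> applies.\<close>
  have inj: "inj_on hd \<L>"
  proof (rule inj_onI, rule ccontr)
    fix L L' assume "L \<in> \<L>" "L' \<in> \<L>" "hd L = hd L'" "L \<noteq> L'"
    then show False using L(3)[of L] L(3)[of L'] L(4)[of L L'] hd_in_set[of L] hd_in_set[of L'] by auto
  qed
  then have "card (hd ` \<L>) = Suc i" using L(2) by (simp add: card_image)
  moreover have "hd ` \<L> \<subseteq> P" using L(3,5) by (auto intro!: hd_in_set)
  ultimately obtain L1 L2 where 12: "L1 \<in> \<L>" "L2 \<in> \<L>" "hd L1 \<noteq> hd L2"
    "real (card (distinguishing Q R (hd L1) (hd L2))) \<le> f i"
    using close[of "hd ` \<L>" i] step.prems by auto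
  define N where "N = rev L1 @ L2"
  define \<M> where "\<M> = \<L> - {L1, L2}"
  have ne: "L1 \<noteq> L2" "L1 \<noteq> []" "L2 \<noteq> []" using 12 L(3) by auto
  have LM: "\<L> = insert L1 (insert L2 \<M>)" using 12 by (auto simp: \<M>_def)
  have notin: "L1 \<notin> insert L2 \<M>" "L2 \<notin> \<M>" "finite \<M>" using ne L(1) by (auto simp: \<M>_def)
  have disjM: "set N \<inter> set L = {}" if "L \<in> \<M>" for L
    using L(4)[of L1 L] L(4)[of L2 L] that 12 by (auto simp: \<M>_def N_def)
  have Nnot: "N \<notin> \<M>" using disjM[of N] ne by (auto simp: N_def)
  have "(\<Sum>L\<in>insert N \<M>. real (path_cost Q R L)) \<le> (\<Sum>i=i..<card P. f i)"
  proof -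
    have "path_cost Q R N = path_cost Q R L1 + card (distinguishing Q R (hd L1) (hd L2)) + path_cost Q R L2"
      using ne by (simp add: N_def path_cost_append path_cost_rev last_rev)
    then have "(\<Sum>L\<in>insert N \<M>. real (path_cost Q R L)) =
        (\<Sum>L\<in>\<L>. real (path_cost Q R L)) + card (distinguishing Q R (hd L1) (hd L2))"
      using notin Nnot by (simp add: LM)
    also have "\<dots> \<le> (\<Sum>i=Suc i..<card P. f i) + f i" using L(6) 12(4) by linarith
    also have "\<dots> = (\<Sum>i=i..<card P. f i)" using step.hyps by (simp add: sum.atLeast_Suc_lessThan)
    finally show ?thesis .
  qed
  moreover have "card (insert N \<M>) = i" using L(2) notin Nnot by (simp add: LM)
  moreover have "(\<Union>L\<in>insert N \<M>. set L) = P" using L(5) by (auto simp: LM N_def)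
  moreover have "distinct N" using L(3,4) 12 ne by (auto simp: N_def)
  moreover have "L \<noteq> [] \<and> distinct L" if "L \<in> insert N \<M>" for L
    using that L(3) \<open>distinct N\<close> ne by (auto simp: \<M>_def N_def)
  moreover have "set L \<inter> set L' = {}" if "L \<in> insert N \<M>" "L' \<in> insert N \<M>" "L \<noteq> L'" for L L'
    using that disjM L(4)[of L L'] by (auto simp: \<M>_def)
  ultimately show ?case using notin by (intro exI[of _ "insert N \<M>"]) auto
qed

lemma exists_path:
  assumes P: "finite P" "P \<noteq> {}"
    and close: "\<And>A i. A \<subseteq> P \<Longrightarrow> 1 \<le> i \<Longrightarrow> card A = Suc i \<Longrightarrow>
      \<exists>p\<in>A. \<exists>p'\<in>A. p \<noteq> p' \<and> real (card (distinguishing Q R p p')) \<le> f i"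
  shows "\<exists>xs. distinct xs \<and> set xs = P \<and> real (path_cost Q R xs) \<le> (\<Sum>i=1..<card P. f i)"
proof -
  have "1 \<le> card P" using P by (simp add: Suc_le_eq card_gt_0_iff)
  from exists_path_family[where f = f and Q = Q and R = R, OF P(1) order_refl this close]
  obtain \<L> where L: "card \<L> = 1" "\<forall>L\<in>\<L>. L \<noteq> [] \<and> distinct L" "(\<Union>L\<in>\<L>. set L) = P"
    "(\<Sum>L\<in>\<L>. real (path_cost Q R L)) \<le> (\<Sum>i=1..<card P. f i)" by blast
  then obtain xs where "\<L> = {xs}" by (metis card_1_singletonE)
  then show ?thesis using L by auto
qed


section \<open>Cutting a path into blocks\<close>

lemma exists_change_between:
  fixes i j :: nat
  assumes "i < j" "T i \<noteq> T j"
  shows "\<exists>k. i \<le> k \<and> k < j \<and> T k \<noteq> T (Suc k)"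
proof (rule ccontr)
  assume "\<not> ?thesis"
  then have same: "T k = T (Suc k)" if "i \<le> k" "k < j" for k using that by blast
  have "T i = T k" if "i \<le> k" "k \<le> j" for k
    using that by (induction k rule: dec_induct) (use same in auto)
  then show False using assms by simp
qed

lemma card_div_eq:
  assumes "s > 0"
  shows "card {j. j div s = (k::nat)} = s" and "finite {j. j div s = (k::nat)}"
proof -
  have "{j. j div s = k} = {k * s..<k * s + s}"
  proof (intro set_eqI iffI)
    fix j assume "j \<in> {j. j div s = k}"
    then have "k * s + j mod s = j" using div_mult_mod_eq[of j s] by simp
    moreover have "j mod s < s" using assms by simp
    ultimately have "k * s \<le> j" "j < k * s + s" by linarith+
    then show "j \<in> {k * s..<k * s + s}" by simp
  next
    fix j assume "j \<in> {k * s..<k * s + s}"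
    then show "j \<in> {j. j div s = k}" using assms
      by (auto intro!: div_nat_eqI simp: mult.commute)
  qed
  then show "card {j. j div s = k} = s" "finite {j. j div s = k}" by auto
qed

text \<open>A block consists of the positions with equal \<open>j div s\<close>. If \<open>q\<close>
  is adjacent to the whole block, the edge lies in the product of the block with its common
  neighbourhood, which has at most \<open>M\<close> elements. Otherwise adjacency to
  \<open>q\<close> changes inside the block, and the edge is charged to such a change. The path has
  \<open>path_cost\<close> changes, and each is charged by at most \<open>s\<close>
  positions.\<close>

lemma card_edges_le_blocks:
  fixes R :: "'p \<Rightarrow> 'q \<Rightarrow> bool"
  assumes Q: "finite Q" and xs: "distinct xs" "set xs = P" and s: "s > 0"
    and M: "\<And>A B. A \<subseteq> P \<Longrightarrow> B \<subseteq> Q \<Longrightarrow> (\<forall>p\<in>A. \<forall>q\<in>B. R p q) \<Longrightarrow> card A * card B \<le> M"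
  shows "card {(p, q). p \<in> P \<and> q \<in> Q \<and> R p q} \<le> s * path_cost Q R xs + ((length xs - 1) div s + 1) * M"
proof -
  define m where "m = length xs"
  define D where "D j = distinguishing Q R (xs ! j) (xs ! Suc j)" for j
  define J where "J k = {j. j < m \<and> j div s = k}" for k
  define F where "F k = {q \<in> Q. \<forall>j\<in>J k. R (xs ! j) q}" for k
  define Bad where "Bad = (\<Union>j<m - 1. {i. i div s = j div s} \<times> D j)"
  define Good where "Good = (\<Union>k\<in>{..(m - 1) div s}. J k \<times> F k)"
  have finD: "finite (D j)" for j using Q by (auto simp: D_def distinguishing_def)
  have finJ: "finite (J k)" "finite (F k)" for k using Q by (auto simp: J_def F_def)
  have sub: "{(j, q). j < m \<and> q \<in> Q \<and> R (xs ! j) q} \<subseteq> Bad \<union> Good"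
  proof (rule subrelI)
    fix j q assume "(j, q) \<in> {(j, q). j < m \<and> q \<in> Q \<and> R (xs ! j) q}"
    then have j: "j < m" "q \<in> Q" "R (xs ! j) q" by auto
    show "(j, q) \<in> Bad \<union> Good"
    proof (cases "q \<in> F (j div s)")
      case True
      have "j div s \<le> (m - 1) div s" using j by (intro div_le_mono) auto
      then show ?thesis using True j by (auto simp: Good_def J_def)
    next
      case False
      then obtain i where i: "i < m" "i div s = j div s" "\<not> R (xs ! i) q"
        using j by (auto simp: F_def J_def)
      define l h where "l = min i j" and "h = max i j"
      have "i \<noteq> j" using i j by auto
      then have lh: "l < h" "R (xs ! l) q \<noteq> R (xs ! h) q" "h < m" "l div s = j div s" "h div s = j div s"
        using i j by (auto simp: l_def h_def min_def max_def)
      obtain k where k: "l \<le> k" "k < h" "R (xs ! k) q \<noteq> R (xs ! Suc k) q"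
        using exists_change_between[of l h "\<lambda>i. R (xs ! i) q"] lh by auto
      \<comment> \<open>The change occurs between two positions of one block, hence in the block of
        j.\<close>
      have "j div s = k div s"
        using div_le_mono[OF k(1), of s] div_le_mono[of k h s] k(2) lh by simp
      then show ?thesis using k lh j(2) by (auto simp: Bad_def D_def distinguishing_def intro!: bexI[of _ k])
    qed
  qed
  have "{(p, q). p \<in> P \<and> q \<in> Q \<and> R p q} = (\<lambda>(j, q). (xs ! j, q)) ` {(j, q). j < m \<and> q \<in> Q \<and> R (xs ! j) q}"
    unfolding xs(2)[symmetric] m_def by (auto simp: in_set_conv_nth image_iff) 
  moreover have fin: "finite {(j, q). j < m \<and> q \<in> Q \<and> R (xs ! j) q}"
    by (rule finite_subset[of _ "{..<m} \<times> Q"]) (use Q in auto)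
  ultimately have "card {(p, q). p \<in> P \<and> q \<in> Q \<and> R p q} \<le> card {(j, q). j < m \<and> q \<in> Q \<and> R (xs ! j) q}"
    by (simp add: card_image_le)
  also have "\<dots> \<le> card (Bad \<union> Good)"
    using sub finD finJ card_div_eq(2)[OF s] by (intro card_mono) (auto simp: Bad_def Good_def)
  also have "\<dots> \<le> card Bad + card Good" by (rule card_Un_le)
  also have "card Bad \<le> (\<Sum>j<m - 1. card ({i. i div s = j div s} \<times> D j))"
    unfolding Bad_def by (rule card_UN_le) simp
  also have "\<dots> = s * path_cost Q R xs"
    by (simp add: card_cartesian_product card_div_eq[OF s] path_cost_eq_sum D_def m_def sum_distrib_left)
  also have "card Good \<le> (\<Sum>k\<in>{..(m - 1) div s}. card (J k \<times> F k))"
    unfolding Good_def by (rule card_UN_le) simp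
  also have "\<dots> \<le> (\<Sum>k\<in>{..(m - 1) div s}. M)"
  proof (rule sum_mono)
    fix k
    have "card ((!) xs ` J k) * card (F k) \<le> M"
      by (rule M) (auto simp: J_def F_def xs(2)[symmetric] m_def)
    moreover have "card ((!) xs ` J k) = card (J k)"
      using xs(1) by (intro card_image) (auto simp: inj_on_def J_def m_def nth_eq_iff_index_eq)
    ultimately show "card (J k \<times> F k) \<le> M" by (simp add: card_cartesian_product)
  qed
  finally show ?thesis by (simp add: m_def)
qed

lemma exists_max_degree:
  assumes "finite P" "P \<noteq> {}" "finite Q" "E \<subseteq> P \<times> Q"
  shows "\<exists>p\<in>P. card E \<le> card P * card {q\<in>Q. (p, q) \<in> E}"
proof (rule ccontr)
  assume "\<not> ?thesis"
  then have less: "card P * card {q\<in>Q. (p, q) \<in> E} < card E" if "p \<in> P" for p using that by force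
  have "E = Sigma P (\<lambda>p. {q\<in>Q. (p, q) \<in> E})" using assms(4) by auto
  then have "card E = (\<Sum>p\<in>P. card {q\<in>Q. (p, q) \<in> E})"
    using card_SigmaI[of P "\<lambda>p. {q\<in>Q. (p, q) \<in> E}"] assms by simp
  then have "card P * card E = (\<Sum>p\<in>P. card P * card {q\<in>Q. (p, q) \<in> E})"
    by (simp add: sum_distrib_left)
  also have "\<dots> < (\<Sum>p\<in>P. card E)" using assms less by (intro sum_strict_mono) auto
  finally show False by simp
qed

text \<open>With s about I / (2 X) at most I / 2 edges are bad. The others lie in at most 2 m / s
  products, so the largest product M satisfies I / 2 \<le> 2 (m / s) M. Rounding gives s \<ge> I /
  (4 X), whence I^2 \<le> 16 m X M.\<close>

lemma exists_biclique_path: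
  fixes X :: real
  assumes P: "finite P" "P \<noteq> {}" and Q: "finite Q" and E: "E \<subseteq> P \<times> Q" "E \<noteq> {}"
    and xs: "distinct xs" "set xs = P"
    and X: "real (path_cost Q (\<lambda>p q. (p, q) \<in> E) xs) \<le> X" "real (card Q) \<le> X"
  shows "\<exists>A B. A \<subseteq> P \<and> B \<subseteq> Q \<and> A \<times> B \<subseteq> E \<and>
           (real (card E))\<^sup>2 / (16 * card P * X) \<le> real (card A * card B)"
proof -
  define I m where "I = real (card E)" and "m = real (card P)"
  have finE: "finite E" using E P Q by (meson finite_SigmaI finite_subset)
  have m: "m \<ge> 1" using P by (simp add: m_def Suc_le_eq card_gt_0_iff)
  have I: "I \<ge> 1" using E finE by (simp add: I_def Suc_le_eq card_gt_0_iff)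
  have "card E \<le> card (P \<times> Q)" using E P Q by (intro card_mono) auto
  then have ImX: "I \<le> m * card Q"
    unfolding I_def m_def card_cartesian_product by (metis of_nat_le_iff of_nat_mult)
  have "Q \<noteq> {}" using E by auto
  then have X0: "X \<ge> 1" using X(2) Q by (metis One_nat_def Suc_leI card_gt_0_iff of_nat_1 of_nat_le_iff order.trans)
  show ?thesis
  proof (cases "I < 2 * X")
    case True
    \<comment> \<open>Here I / (2 X) would be rounded to 0. A star of maximum degree has at least I
      / m edges, which is enough since I < 2 X.\<close>
    obtain p where p: "p \<in> P" "card E \<le> card P * card {q\<in>Q. (p, q) \<in> E}"
      using exists_max_degree[OF P Q E(1)] by blast
    define B where "B = {q\<in>Q. (p, q) \<in> E}"
    have IB: "I \<le> m * card B" using p(2) unfolding I_def m_def B_def by (metis of_nat_le_iff of_nat_mult)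
    have "I\<^sup>2 / (16 * m * X) \<le> I / m"
    proof -
      have "I * I \<le> I * (16 * X)" using True X0 I by (intro mult_left_mono) auto
      then show ?thesis using m X0 by (simp add: field_simps power2_eq_square)
    qed
    also have "\<dots> \<le> card B" using IB m by (simp add: field_simps)
    finally show ?thesis using p(1)
      by (intro exI[of _ "{p}"] exI[of _ B]) (auto simp: B_def I_def m_def)
  next
    case False
    define s where "s = nat \<lfloor>I / (2 * X)\<rfloor>"
    define y where "y = I / (2 * X)"
    have y1: "y \<ge> 1" using False X0 by (simp add: y_def)
    have s: "s \<ge> 1" "real s \<le> y" "y \<le> 2 * real s"
    proof -
      have fl: "\<lfloor>y\<rfloor> \<ge> 1" using y1 by (simp add: le_floor_iff)
      then have "real s = of_int \<lfloor>y\<rfloor>" by (simp add: s_def y_def)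
      then show "s \<ge> 1" "real s \<le> y" "y \<le> 2 * real s" using fl floor_correct[of y] by linarith+
    qed
    define \<S> where "\<S> = {card A * card B | A B. A \<subseteq> P \<and> B \<subseteq> Q \<and> A \<times> B \<subseteq> E}"
    have "finite \<S>"
    proof (rule finite_subset)
      show "\<S> \<subseteq> (\<lambda>(A, B). card A * card B) ` (Pow P \<times> Pow Q)" by (auto simp: \<S>_def)
    qed (use P Q in auto)
    moreover have "\<S> \<noteq> {}" by (auto simp: \<S>_def)
    ultimately have "Max \<S> \<in> \<S>" "\<And>v. v \<in> \<S> \<Longrightarrow> v \<le> Max \<S>" by auto
    then obtain A B where AB: "A \<subseteq> P" "B \<subseteq> Q" "A \<times> B \<subseteq> E" "Max \<S> = card A * card B"
      by (auto simp: \<S>_def)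
    define M where "M = card A * card B"
    have Mmax: "card A' * card B' \<le> M" if "A' \<subseteq> P" "B' \<subseteq> Q" "A' \<times> B' \<subseteq> E" for A' B'
    proof -
      have "card A' * card B' \<in> \<S>" using that unfolding \<S>_def by blast
      then show ?thesis using \<open>\<And>v. v \<in> \<S> \<Longrightarrow> v \<le> Max \<S>\<close> AB(4) by (simp add: M_def)
    qed
    have "card {(p, q). p \<in> P \<and> q \<in> Q \<and> (p, q) \<in> E} \<le>
        s * path_cost Q (\<lambda>p q. (p, q) \<in> E) xs + ((length xs - 1) div s + 1) * M"
      using s(1) by (intro card_edges_le_blocks[OF Q xs]) (auto intro!: Mmax)
    moreover have "{(p, q). p \<in> P \<and> q \<in> Q \<and> (p, q) \<in> E} = E" using E by auto
    ultimately have "card E \<le> s * path_cost Q (\<lambda>p q. (p, q) \<in> E) xs + ((length xs - 1) div s + 1) * M"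
      by simp
    then have "real (card E) \<le> real (s * path_cost Q (\<lambda>p q. (p, q) \<in> E) xs + ((length xs - 1) div s + 1) * M)"
      by (simp only: of_nat_le_iff)
    then have I1: "I \<le> s * real (path_cost Q (\<lambda>p q. (p, q) \<in> E) xs) + (real ((length xs - 1) div s) + 1) * M"
      unfolding I_def of_nat_add of_nat_mult of_nat_1 .
    have "s * real (path_cost Q (\<lambda>p q. (p, q) \<in> E) xs) \<le> y * X"
      using s X X0 y1 by (intro mult_mono) auto
    also have "\<dots> = I / 2" using X0 by (simp add: y_def)
    finally have I2: "I / 2 \<le> (real ((length xs - 1) div s) + 1) * M" using I1 by linarith
    have lm: "length xs = card P" using xs distinct_card by force
    have "real ((length xs - 1) div s) \<le> real (length xs - 1) / real s" 
    proof -
      have "real ((length xs - 1) div s * s) \<le> real (length xs - 1)"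
        by (simp only: of_nat_le_iff div_times_less_eq_dividend)
      then show ?thesis using s(1) by (simp add: field_simps)
    qed
    also have "\<dots> \<le> m / s" using s by (intro divide_right_mono) (auto simp: lm m_def)
    finally have b: "real ((length xs - 1) div s) \<le> m / s" .
    \<comment> \<open>From I \<le> m n and n \<le> X: a block is not longer than the path, so the
      possibly incomplete last block is absorbed into 2 m / s.\<close>
    have sm: "real s \<le> m"
    proof -
      have "I \<le> m * X" using ImX X(2) m by (meson mult_left_mono order.trans zero_le_one)
      then have "y \<le> m / 2" using X0 by (simp add: y_def field_simps)
      then show ?thesis using s m by linarith
    qed
    then have "1 \<le> m / s" using s by simp
    with b have "real ((length xs - 1) div s) + 1 \<le> 2 * (m / s)" by linarith
    then have "I / 2 \<le> 2 * (m / s) * M"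
      using I2 by (meson mult_right_mono of_nat_0_le_iff order.trans)
    then have "I * s \<le> 4 * m * M" using s by (simp add: field_simps)
    moreover have "I * (I / (4 * X)) \<le> I * s" using s(3) I X0 by (intro mult_left_mono) (auto simp: y_def)
    ultimately have "I\<^sup>2 / (4 * X) \<le> 4 * m * M" by (simp add: power2_eq_square)
    then have "I\<^sup>2 / (16 * m * X) \<le> M" using m X0 by (simp add: field_simps)
    then show ?thesis using AB by (intro exI[of _ A] exI[of _ B]) (auto simp: I_def m_def M_def)
  qed
qed

text \<open>Writing i^(-1/\<kappa>) as i^(1 - 1/\<kappa>) / i reduces every \<kappa> to the harmonic
  sum. The logarithm lost in this way for \<kappa> = 2 is absorbed later together with the
  others.\<close>

lemma sum_powr_le:
  assumes "\<kappa> \<ge> 1" "m \<ge> 1"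
  shows "(\<Sum>i=1..<m. real i powr (- 1 / real \<kappa>)) \<le> real m powr (1 - 1 / \<kappa>) * (1 + ln m)"
proof -
  have "(\<Sum>i=1..<m. real i powr (- 1 / real \<kappa>)) \<le> (\<Sum>i=1..<m. real m powr (1 - 1 / \<kappa>) * (1 / i))"
  proof (rule sum_mono)
    fix i assume i: "i \<in> {1..<m}"
    have "real i powr (- 1 / \<kappa>) = real i powr (1 - 1 / \<kappa>) * real i powr (- 1)"
    proof -
      have e: "- 1 / real \<kappa> = (1 - 1 / real \<kappa>) + (- 1)" by simp
      show ?thesis by (subst e) (rule powr_add)
    qed
    also have "real i powr (- 1) = 1 / i" using i by (simp add: powr_minus_divide)
    also have "real i powr (1 - 1 / \<kappa>) \<le> real m powr (1 - 1 / \<kappa>)"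
      using i assms by (intro powr_mono2) auto
    finally show "real i powr (- 1 / \<kappa>) \<le> real m powr (1 - 1 / \<kappa>) * (1 / i)"
      by (simp add: divide_right_mono)
  qed
  also have "\<dots> = real m powr (1 - 1 / \<kappa>) * (\<Sum>i=1..<m. 1 / i)" by (simp add: sum_distrib_left)
  also have "(\<Sum>i=1..<m. 1 / real i) \<le> 1 + ln m"
  proof -
    have "(\<Sum>i=1..<m. 1 / real i) \<le> (\<Sum>i=1..m. 1 / real i)" by (intro sum_mono2) auto
    also have "\<dots> = harm m" by (simp add: harm_def inverse_eq_divide)
    also have "\<dots> \<le> ln m + 1" 
      using decseqD[OF decseq_harm_diff_ln, of 0 "m - 1"] assms(2) by (simp add: harm_def)
    finally show ?thesis by simp
  qed
  finally show ?thesis by (simp add: mult_left_mono)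
qed

lemma exists_biclique_of_traces:
  fixes \<kappa> c :: nat
  assumes P: "finite P" and Q: "finite Q" and E: "E \<subseteq> P \<times> Q" "E \<noteq> {}" and "\<kappa> \<ge> 1" "c \<ge> 1"
    and traces: "\<And>qs. set qs \<subseteq> Q \<Longrightarrow> qs \<noteq> [] \<Longrightarrow>
      card ((\<lambda>p. map (\<lambda>q. (p, q) \<in> E) qs) ` P) \<le> c * length qs ^ \<kappa>"
  shows "\<exists>A B. A \<subseteq> P \<and> B \<subseteq> Q \<and> A \<times> B \<subseteq> E \<and>
     (real (card E))\<^sup>2 / (16 * (4 * real c + 1) * (card P * real (card P) powr (1 - 1 / \<kappa>) * card Q * (1 + ln (card P))\<^sup>2))
       \<le> real (card A * card B)"
proof -
  define R where "R p q \<longleftrightarrow> (p, q) \<in> E" for p q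
  define m n where "m = card P" and "n = card Q"
  have ne: "P \<noteq> {}" "Q \<noteq> {}" using E by auto
  then have m1: "m \<ge> 1" using P by (simp add: m_def Suc_le_eq card_gt_0_iff)
  \<comment> \<open>One logarithm stems from the close pairs, the other from the sum over i.\<close>
  define u where "u = real m powr (1 - 1 / \<kappa>) * (1 + ln m)\<^sup>2"
  define f where "f i = 4 * real c * ln m * real n * real i powr (- 1 / \<kappa>)" for i :: nat
  have "\<exists>p\<in>A. \<exists>p'\<in>A. p \<noteq> p' \<and> real (card (distinguishing Q R p p')) \<le> f i"
    if A: "A \<subseteq> P" "1 \<le> i" "card A = Suc i" for A i
  proof -
    have finA: "finite A" using A P finite_subset by blast
    have "card ((\<lambda>p. map (R p) qs) ` A) \<le> c * length qs ^ \<kappa>" if "set qs \<subseteq> Q" "qs \<noteq> []" for qs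
    proof -
      have "card ((\<lambda>p. map (R p) qs) ` A) \<le> card ((\<lambda>p. map (R p) qs) ` P)"
        using A P by (intro card_mono image_mono) auto
      also have "\<dots> \<le> c * length qs ^ \<kappa>" using traces[OF that] by (simp add: R_def[abs_def])
      finally show ?thesis .
    qed
    from exists_close_pair[OF finA Q A(3,2) \<open>\<kappa> \<ge> 1\<close> \<open>c \<ge> 1\<close> this]
    obtain p p' where pp: "p \<in> A" "p' \<in> A" "p \<noteq> p'" "real (card (distinguishing Q R p p')) \<le>
           4 * real c * ln (Suc i) * real i powr (- 1 / \<kappa>) * card Q" by blast
    have "Suc i \<le> m" using card_mono[OF P A(1)] A(3) by (simp add: m_def)
    then have "ln (Suc i) \<le> ln (real m)" by simp
    then have "4 * real c * ln (Suc i) * real i powr (- 1 / \<kappa>) * card Q \<le>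
        4 * real c * ln (real m) * real i powr (- 1 / \<kappa>) * card Q"
      by (intro mult_right_mono mult_left_mono) auto
    also have "\<dots> = f i" by (simp add: f_def n_def)
    finally have "real (card (distinguishing Q R p p')) \<le> f i" using pp(4) by linarith
    then show ?thesis using pp(1-3) by blast
  qed
  from exists_path[where f = f and Q = Q and R = R, OF P ne(1) this] obtain xs where xs: "distinct xs" "set xs = P"
    "real (path_cost Q R xs) \<le> (\<Sum>i=1..<m. f i)" unfolding m_def by blast
  have ln0: "ln (real m) \<ge> 0" using m1 by simp
  have u1: "u \<ge> 1"
  proof -
    have "1 * 1 \<le> real m powr (1 - 1 / \<kappa>) * (1 + ln m)\<^sup>2"
      using m1 ln0 \<open>\<kappa> \<ge> 1\<close> by (intro mult_mono) (auto simp: ge_one_powr_ge_zero one_le_power)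
    then show ?thesis by (simp add: u_def)
  qed
  define X where "X = (4 * real c + 1) * n * u"
  have "(\<Sum>i=1..<m. f i) = 4 * real c * ln m * real n * (\<Sum>i=1..<m. real i powr (- 1 / \<kappa>))"
    by (simp add: f_def sum_distrib_left)
  also have "\<dots> \<le> 4 * real c * (1 + ln m) * real n * (real m powr (1 - 1 / \<kappa>) * (1 + ln m))"
    using sum_powr_le[OF \<open>\<kappa> \<ge> 1\<close> m1] ln0 by (intro mult_mono) (auto intro!: mult_nonneg_nonneg sum_nonneg)
  also have "\<dots> = 4 * real c * n * u" by (simp add: u_def power2_eq_square)
  also have "\<dots> \<le> X" using u1 by (simp add: X_def mult_right_mono)
  finally have X: "real (path_cost Q R xs) \<le> X" using xs(3) by linarith
  have "1 * real n * 1 \<le> (4 * real c + 1) * n * u" using u1 by (intro mult_mono) auto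
  then have "real (card Q) \<le> X" by (simp add: X_def n_def)
  from exists_biclique_path[OF P ne(1) Q E xs(1,2) _ this] X
  obtain A B where "A \<subseteq> P" "B \<subseteq> Q" "A \<times> B \<subseteq> E"
     "(real (card E))\<^sup>2 / (16 * card P * X) \<le> real (card A * card B)"
    by (auto simp: R_def[abs_def])
  moreover have "16 * card P * X = 16 * (4 * real c + 1) * (card P * real (card P) powr (1 - 1 / \<kappa>) * card Q * (1 + ln (card P))\<^sup>2)"
    by (simp add: X_def u_def m_def n_def)
  ultimately show ?thesis by metis
qed

section \<open>Semialgebraic graphs of low dimension\<close>

lemma monom_value_case_sum:
  fixes p :: "'a::finite \<Rightarrow> real" and q :: "'b::finite \<Rightarrow> real"
  shows "monom_value \<mu> (case_sum p q) =
    (\<Prod>i\<in>UNIV. p i ^ Poly_Mapping.lookup \<mu> (Inl i)) * (\<Prod>j\<in>UNIV. q j ^ Poly_Mapping.lookup \<mu> (Inr j))"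
proof -
  have "monom_value \<mu> (case_sum p q) = (\<Prod>i\<in>UNIV. case_sum p q i ^ Poly_Mapping.lookup \<mu> i)"
    unfolding monom_value_def by (rule prod.mono_neutral_left) (auto simp: in_keys_iff)
  also have "\<dots> = (\<Prod>i\<in>UNIV <+> UNIV. case_sum p q i ^ Poly_Mapping.lookup \<mu> i)"
    by (simp only: UNIV_Plus_UNIV)
  also have "\<dots> = (\<Prod>i\<in>UNIV. p i ^ Poly_Mapping.lookup \<mu> (Inl i)) * (\<Prod>j\<in>UNIV. q j ^ Poly_Mapping.lookup \<mu> (Inr j))"
    by (subst prod.Plus) (auto simp: comp_def)
  finally show ?thesis .
qed

lemma lookup_le_mpoly_degree:
  fixes f :: "('v::finite) real_mpoly"
  assumes "\<mu> \<in> Poly_Mapping.keys f"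
  shows "Poly_Mapping.lookup \<mu> i \<le> mpoly_degree f"
proof -
  have "Poly_Mapping.lookup \<mu> i \<le> monom_degree \<mu>"
  proof (cases "i \<in> Poly_Mapping.keys \<mu>")
    case True
    then show ?thesis unfolding monom_degree_def by (intro member_le_sum) auto
  qed (simp add: in_keys_iff)
  also have "\<dots> \<le> mpoly_degree f"
    unfolding mpoly_degree_def using assms by (intro Max_ge) auto
  finally show ?thesis .
qed

text \<open>Monomials are collected by their exponent \<open>e2\<close> of the second
  variable.\<close>

lemma exists_slice_of_monomials:
  assumes "finite S" "\<And>\<mu>. \<mu> \<in> S \<Longrightarrow> e1 \<mu> \<le> t" "\<And>\<mu>. \<mu> \<in> S \<Longrightarrow> e2 \<mu> \<le> t"
  shows "\<exists>C. (\<forall>j. degree (C j) \<le> t) \<and>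
    (\<forall>x y. (\<Sum>\<mu>\<in>S. w \<mu> * (x ^ e1 \<mu> * y ^ e2 \<mu>)) = poly (slice t C x) y)"
proof -
  define C where "C j = (\<Sum>\<mu>\<in>S. if e2 \<mu> = j then monom (w \<mu>) (e1 \<mu>) else 0)" for j
  have "degree (C j) \<le> t" for j
    unfolding C_def using assms by (intro degree_sum_le) (auto intro: order.trans[OF degree_monom_le])
  moreover have "(\<Sum>\<mu>\<in>S. w \<mu> * (x ^ e1 \<mu> * y ^ e2 \<mu>)) = poly (slice t C x) y" for x y
  proof -
    have "poly (slice t C x) y = (\<Sum>j\<le>t. \<Sum>\<mu>\<in>S. if e2 \<mu> = j then w \<mu> * (x ^ e1 \<mu> * y ^ e2 \<mu>) else 0)"
      unfolding poly_slice C_def poly_sum sum_distrib_right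
      by (intro sum.cong) (auto simp: poly_monom mult.assoc)
    also have "\<dots> = (\<Sum>\<mu>\<in>S. \<Sum>j\<le>t. if e2 \<mu> = j then w \<mu> * (x ^ e1 \<mu> * y ^ e2 \<mu>) else 0)"
      by (rule sum.swap)
    also have "\<dots> = (\<Sum>\<mu>\<in>S. w \<mu> * (x ^ e1 \<mu> * y ^ e2 \<mu>))"
      using assms by (intro sum.cong) (auto simp: sum.delta)
    finally show ?thesis by simp
  qed
  ultimately show ?thesis by blast
qed

lemma exists_poly_of_monomials:
  assumes "finite S" "\<And>\<mu>. \<mu> \<in> S \<Longrightarrow> e \<mu> \<le> t"
  shows "\<exists>C::real poly. degree C \<le> t \<and> (\<forall>x. (\<Sum>\<mu>\<in>S. w \<mu> * x ^ e \<mu>) = poly C x)"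
proof (intro exI conjI allI)
  show "degree (\<Sum>\<mu>\<in>S. monom (w \<mu>) (e \<mu>)) \<le> t"
    using assms by (intro degree_sum_le) (auto intro: order.trans[OF degree_monom_le])
  show "(\<Sum>\<mu>\<in>S. w \<mu> * x ^ e \<mu>) = poly (\<Sum>\<mu>\<in>S. monom (w \<mu>) (e \<mu>)) x" for x
    by (simp add: poly_sum poly_monom)
qed

lemma card_image_le_determined:
  assumes "finite P" and det: "\<And>p p'. p \<in> P \<Longrightarrow> p' \<in> P \<Longrightarrow> h p = h p' \<Longrightarrow> g p = g p'"
  shows "card (g ` P) \<le> card (h ` P)"
proof (rule surj_card_le)
  show "finite (h ` P)" using assms(1) by simp
  show "g ` P \<subseteq> (\<lambda>v. g (SOME p. p \<in> P \<and> h p = v)) ` (h ` P)"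
  proof
    fix w assume "w \<in> g ` P"
    then obtain p where p: "p \<in> P" "w = g p" by blast
    have "(SOME p'. p' \<in> P \<and> h p' = h p) \<in> P \<and> h (SOME p'. p' \<in> P \<and> h p' = h p) = h p"
      by (rule someI[of _ p]) (simp add: p)
    then have "g (SOME p'. p' \<in> P \<and> h p' = h p) = w" using det p by metis
    then show "w \<in> (\<lambda>v. g (SOME p. p \<in> P \<and> h p = v)) ` (h ` P)" using p(1) by blast
  qed
qed

text \<open>\<open>P\<close> stands for the side of dimension \<kappa>, so the denominator, m^(2 -
  1/\<kappa>) n up to \<open>K\<close> and logarithms, is not symmetric in the two sides.\<close>

definition biclique_bound :: "real \<Rightarrow> nat \<Rightarrow> 'p set \<Rightarrow> 'q set \<Rightarrow> ('p \<times> 'q) set \<Rightarrow> bool" where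
  "biclique_bound K \<kappa> P Q E \<longleftrightarrow> (\<exists>A B. A \<subseteq> P \<and> B \<subseteq> Q \<and> A \<times> B \<subseteq> E \<and>
     (real (card E))\<^sup>2 / (K * (card P * real (card P) powr (1 - 1 / \<kappa>) * card Q * (1 + ln (card P))\<^sup>2))
       \<le> real (card A * card B))"

text \<open>An edge depends on t signs, so the trace of p on r vertices is determined by the signs
  of r t polynomials. This multiplies c by t^\<kappa>.\<close>

lemma exists_biclique_of_patterns:
  fixes val :: "nat \<Rightarrow> 'p \<Rightarrow> 'q \<Rightarrow> real" and \<kappa> c t :: nat
  assumes P: "finite P" and Q: "finite Q" and E: "E \<subseteq> P \<times> Q" "E \<noteq> {}"
    and pos: "\<kappa> \<ge> 1" "c \<ge> 1" "t \<ge> 1"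
    and rel: "\<And>p q. p \<in> P \<Longrightarrow> q \<in> Q \<Longrightarrow> (p, q) \<in> E \<longleftrightarrow> \<Phi> (map (\<lambda>j. val j p q \<ge> 0) [0..<t])"
    and patterns: "\<And>N j q. N \<ge> 1 \<Longrightarrow> (\<And>l. j l < t \<and> q l \<in> Q) \<Longrightarrow>
      card ((\<lambda>p. {l. l < N \<and> val (j l) p (q l) \<ge> 0}) ` P) \<le> c * N ^ \<kappa>"
  shows "biclique_bound (16 * (4 * real (c * t ^ \<kappa>) + 1)) \<kappa> P Q E"
  unfolding biclique_bound_def
proof (rule exists_biclique_of_traces[OF P Q E pos(1)])
  show "1 \<le> c * t ^ \<kappa>" using pos by simp
  fix qs assume qs: "set qs \<subseteq> Q" "qs \<noteq> []"
  define r where "r = length qs"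
  have r: "r \<ge> 1" using qs by (simp add: r_def Suc_le_eq)
  \<comment> \<open>Number i t + k stands for the k-th polynomial at the i-th vertex. From r t on
    the value is an arbitrary vertex, because \<open>patterns\<close> asks for \<open>q l\<close> in
    \<open>Q\<close> at every \<open>l\<close>.\<close>
  define q where "q l = (if l < r * t then qs ! (l div t) else hd qs)" for l
  define j where "j l = l mod t" for l
  have jq: "j l < t \<and> q l \<in> Q" for l
  proof
    show "j l < t" using pos by (simp add: j_def)
    show "q l \<in> Q"
    proof (cases "l < r * t")
      case True
      then have "l div t < r" using pos by (simp add: less_mult_imp_div_less)
      then show ?thesis using True qs by (auto simp: q_def r_def)
    qed (use qs in \<open>auto simp: q_def\<close>)
  qed
  have "card ((\<lambda>p. map (\<lambda>q. (p, q) \<in> E) qs) ` P) \<le> card ((\<lambda>p. {l. l < r * t \<and> val (j l) p (q l) \<ge> 0}) ` P)"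
  proof (rule card_image_le_determined[OF P])
    fix p p' assume pp: "p \<in> P" "p' \<in> P"
      and eq: "{l. l < r * t \<and> val (j l) p (q l) \<ge> 0} = {l. l < r * t \<and> val (j l) p' (q l) \<ge> 0}"
    have "(p, qs ! i) \<in> E \<longleftrightarrow> (p', qs ! i) \<in> E" if i: "i < r" for i
    proof -
      have "(val k p (qs ! i) \<ge> 0) = (val k p' (qs ! i) \<ge> 0)" if k: "k < t" for k
      proof -
        have "i * t + k < Suc i * t" using k by simp
        also have "\<dots> \<le> r * t" using i by (intro mult_le_mono1) simp
        finally have l: "i * t + k < r * t" .
        have "(i * t + k) div t = i" "(i * t + k) mod t = k" using k by auto
        with l have "q (i * t + k) = qs ! i" "j (i * t + k) = k" by (simp_all add: q_def j_def)
        moreover have "i * t + k \<in> {l. l < r * t \<and> val (j l) p (q l) \<ge> 0} \<longleftrightarrow>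
            i * t + k \<in> {l. l < r * t \<and> val (j l) p' (q l) \<ge> 0}"
          by (simp only: eq)
        ultimately show ?thesis using l by simp
      qed
      then have eqm: "map (\<lambda>j. val j p (qs ! i) \<ge> 0) [0..<t] = map (\<lambda>j. val j p' (qs ! i) \<ge> 0) [0..<t]"
        by simp
      have qi: "qs ! i \<in> Q" using i qs by (auto simp: r_def)
      show ?thesis using rel[OF pp(1) qi] rel[OF pp(2) qi] by (simp only: eqm)
    qed
    then show "map (\<lambda>q. (p, q) \<in> E) qs = map (\<lambda>q. (p', q) \<in> E) qs"
      by (intro nth_equalityI) (auto simp: r_def)
  qed
  also have "\<dots> \<le> c * (r * t) ^ \<kappa>" using r pos by (intro patterns jq) simp
  finally show "card ((\<lambda>p. map (\<lambda>q. (p, q) \<in> E) qs) ` P) \<le> c * t ^ \<kappa> * length qs ^ \<kappa>"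
    by (simp add: r_def power_mult_distrib mult_ac)
qed

text \<open>Stated for abstract values \<open>val\<close> and an abstract coordinate
  \<open>\<pi>\<close>, so that either side of the graph can take the part of the line, with
  \<open>K\<close> fixed before the graph.\<close>

lemma exists_biclique_line:
  assumes "t \<ge> 1"
  shows "\<exists>K>0. \<forall>P Q E \<Phi> (val :: nat \<Rightarrow> 'p \<Rightarrow> 'q \<Rightarrow> real) (C :: nat \<Rightarrow> 'q \<Rightarrow> real poly) \<pi>.
    finite P \<longrightarrow> finite Q \<longrightarrow> E \<subseteq> P \<times> Q \<longrightarrow> E \<noteq> {} \<longrightarrow>
    (\<forall>p\<in>P. \<forall>q\<in>Q. (p, q) \<in> E \<longleftrightarrow> \<Phi> (map (\<lambda>j. val j p q \<ge> 0) [0..<t])) \<longrightarrow>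
    (\<forall>j<t. \<forall>q\<in>Q. degree (C j q) \<le> t \<and> (\<forall>p. val j p q = poly (C j q) (\<pi> p))) \<longrightarrow>
    biclique_bound K 1 P Q E"
proof (intro exI[of _ "16 * (4 * real (2 * (t + 1) * t ^ 1) + 1)"] conjI allI impI)
  fix P :: "'p set" and Q :: "'q set" and E \<Phi> and val :: "nat \<Rightarrow> 'p \<Rightarrow> 'q \<Rightarrow> real"
    and C :: "nat \<Rightarrow> 'q \<Rightarrow> real poly" and \<pi>
  assume P: "finite P" and Q: "finite Q" and E: "E \<subseteq> P \<times> Q" "E \<noteq> {}"
    and rel: "\<forall>p\<in>P. \<forall>q\<in>Q. (p, q) \<in> E \<longleftrightarrow> \<Phi> (map (\<lambda>j. val j p q \<ge> 0) [0..<t])"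
    and C: "\<forall>j<t. \<forall>q\<in>Q. degree (C j q) \<le> t \<and> (\<forall>p. val j p q = poly (C j q) (\<pi> p))"
  show "biclique_bound (16 * (4 * real (2 * (t + 1) * t ^ 1) + 1)) 1 P Q E"
  proof (rule exists_biclique_of_patterns[where val = val and \<Phi> = \<Phi>, OF P Q E])
    show "(p, q) \<in> E \<longleftrightarrow> \<Phi> (map (\<lambda>j. val j p q \<ge> 0) [0..<t])" if "p \<in> P" "q \<in> Q" for p q
      using rel that by blast
    fix N :: nat and j and q :: "nat \<Rightarrow> 'q"
    assume N: "N \<ge> 1" and jq: "\<And>l. j l < t \<and> q l \<in> Q"
    have "(\<lambda>p. {l. l < N \<and> val (j l) p (q l) \<ge> 0}) ` P =
        (\<lambda>x. {l. l < N \<and> poly (C (j l) (q l)) x \<ge> 0}) ` (\<pi> ` P)"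
      using C jq by (simp add: image_image)
    then have "card ((\<lambda>p. {l. l < N \<and> val (j l) p (q l) \<ge> 0}) ` P) \<le> 2 * (N * t + 1)"
      using card_sign_patterns_line[of "\<lambda>l. C (j l) (q l)" t N "\<pi> ` P"] C jq by simp
    also have "\<dots> \<le> 2 * (t + 1) * N ^ 1" using N by (simp add: algebra_simps)
    finally show "card ((\<lambda>p. {l. l < N \<and> val (j l) p (q l) \<ge> 0}) ` P) \<le> 2 * (t + 1) * N ^ 1" .
  qed (use assms in auto)
qed (intro mult_pos_pos add_nonneg_pos mult_nonneg_nonneg of_nat_0_le_iff; simp)

lemma exists_biclique_plane:
  assumes "t \<ge> 1"
  shows "\<exists>K>0. \<forall>P Q E \<Phi> (val :: nat \<Rightarrow> 'p \<Rightarrow> 'q \<Rightarrow> real) (C :: nat \<Rightarrow> 'q \<Rightarrow> nat \<Rightarrow> real poly) \<pi>\<^sub>1 \<pi>\<^sub>2.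
    finite P \<longrightarrow> finite Q \<longrightarrow> E \<subseteq> P \<times> Q \<longrightarrow> E \<noteq> {} \<longrightarrow>
    (\<forall>p\<in>P. \<forall>q\<in>Q. (p, q) \<in> E \<longleftrightarrow> \<Phi> (map (\<lambda>j. val j p q \<ge> 0) [0..<t])) \<longrightarrow>
    (\<forall>j<t. \<forall>q\<in>Q. (\<forall>i. degree (C j q i) \<le> t) \<and>
       (\<forall>p. val j p q = poly (slice t (C j q) (\<pi>\<^sub>1 p)) (\<pi>\<^sub>2 p))) \<longrightarrow>
    biclique_bound K 2 P Q E"
proof -
  obtain c0 where c0: "\<forall>N\<ge>1. \<forall>C :: nat \<Rightarrow> nat \<Rightarrow> real poly. \<forall>X :: (real \<times> real) set.
     (\<forall>l j. degree (C l j) \<le> t) \<longrightarrow> finite X \<longrightarrow>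
     card ((\<lambda>(x, y). {l. l < N \<and> poly (slice t (C l) x) y \<ge> 0}) ` X) \<le> c0 * N ^ 2"
    using card_sign_patterns_plane[of t] by blast
  show ?thesis
  \<comment> \<open>c0 + 1 in place of c0, since \<open>exists_biclique_of_patterns\<close> wants a
    constant of at least 1.\<close>
  proof (intro exI[of _ "16 * (4 * real ((c0 + 1) * t ^ 2) + 1)"] conjI allI impI)
    fix P :: "'p set" and Q :: "'q set" and E \<Phi> and val :: "nat \<Rightarrow> 'p \<Rightarrow> 'q \<Rightarrow> real"
      and C :: "nat \<Rightarrow> 'q \<Rightarrow> nat \<Rightarrow> real poly" and \<pi>\<^sub>1 \<pi>\<^sub>2
    assume P: "finite P" and Q: "finite Q" and E: "E \<subseteq> P \<times> Q" "E \<noteq> {}"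
      and rel: "\<forall>p\<in>P. \<forall>q\<in>Q. (p, q) \<in> E \<longleftrightarrow> \<Phi> (map (\<lambda>j. val j p q \<ge> 0) [0..<t])"
      and C: "\<forall>j<t. \<forall>q\<in>Q. (\<forall>i. degree (C j q i) \<le> t) \<and>
         (\<forall>p. val j p q = poly (slice t (C j q) (\<pi>\<^sub>1 p)) (\<pi>\<^sub>2 p))"
    show "biclique_bound (16 * (4 * real ((c0 + 1) * t ^ 2) + 1)) 2 P Q E"
    proof (rule exists_biclique_of_patterns[where val = val and \<Phi> = \<Phi>, OF P Q E])
      show "(p, q) \<in> E \<longleftrightarrow> \<Phi> (map (\<lambda>j. val j p q \<ge> 0) [0..<t])" if "p \<in> P" "q \<in> Q" for p q
        using rel that by blast
      fix N :: nat and j and q :: "nat \<Rightarrow> 'q"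
      assume N: "N \<ge> 1" and jq: "\<And>l. j l < t \<and> q l \<in> Q"
      have eq: "(\<lambda>p. {l. l < N \<and> val (j l) p (q l) \<ge> 0}) ` P =
          (\<lambda>(x, y). {l. l < N \<and> poly (slice t (C (j l) (q l)) x) y \<ge> 0}) ` ((\<lambda>p. (\<pi>\<^sub>1 p, \<pi>\<^sub>2 p)) ` P)"
        using C jq by (simp add: image_image)
      have "card ((\<lambda>(x, y). {l. l < N \<and> poly (slice t (C (j l) (q l)) x) y \<ge> 0}) ` ((\<lambda>p. (\<pi>\<^sub>1 p, \<pi>\<^sub>2 p)) ` P))
          \<le> c0 * N ^ 2"
        using c0[rule_format, of N "\<lambda>l. C (j l) (q l)"] N C jq P by blast
      also have "\<dots> \<le> (c0 + 1) * N ^ 2" by simp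
      finally show "card ((\<lambda>p. {l. l < N \<and> val (j l) p (q l) \<ge> 0}) ` P) \<le> (c0 + 1) * N ^ 2"
        unfolding eq .
    qed (use assms in auto)
  qed (intro mult_pos_pos add_nonneg_pos mult_nonneg_nonneg of_nat_0_le_iff; simp)
qed


section \<open>Evaluation with one of the two points fixed\<close>

lemma eval_pair_eq_sum:
  fixes p :: "real ^ 'a" and q :: "real ^ 'b"
  shows "eval_pair f p q = (\<Sum>\<mu>\<in>Poly_Mapping.keys f. Poly_Mapping.lookup f \<mu> *
    ((\<Prod>i\<in>UNIV. p $ i ^ Poly_Mapping.lookup \<mu> (Inl i)) * (\<Prod>j\<in>UNIV. q $ j ^ Poly_Mapping.lookup \<mu> (Inr j))))"
  by (simp add: eval_pair_def mpoly_value_def monom_value_case_sum)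

text \<open>Fixing \<open>q\<close> turns its coordinates into coefficients. Each exponent is at
  most the total degree, so the bound \<open>t\<close> holds whatever \<open>q\<close> is.\<close>

lemma eval_pair_left_line:
  fixes f :: "('a::finite + 'b::finite) real_mpoly"
  assumes "(UNIV :: 'a set) = {u}" "mpoly_degree f \<le> t"
  shows "\<exists>C. degree C \<le> t \<and> (\<forall>p. eval_pair f p q = poly C (p $ u))"
proof -
  have deg: "Poly_Mapping.lookup \<mu> i \<le> t" if "\<mu> \<in> Poly_Mapping.keys f" for \<mu> i
    using lookup_le_mpoly_degree[OF that] assms(2) by (rule order.trans)
  obtain C where "degree C \<le> t" "\<forall>x. (\<Sum>\<mu>\<in>Poly_Mapping.keys f. (Poly_Mapping.lookup f \<mu> *
      (\<Prod>j\<in>UNIV. q $ j ^ Poly_Mapping.lookup \<mu> (Inr j))) * x ^ Poly_Mapping.lookup \<mu> (Inl u)) = poly C x"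
    using exists_poly_of_monomials[of "Poly_Mapping.keys f" "\<lambda>\<mu>. Poly_Mapping.lookup \<mu> (Inl u)" t
        "\<lambda>\<mu>. Poly_Mapping.lookup f \<mu> * (\<Prod>j\<in>UNIV. q $ j ^ Poly_Mapping.lookup \<mu> (Inr j))", OF finite_keys deg] by blast
  then show ?thesis by (intro exI[of _ C]) (simp add: eval_pair_eq_sum assms(1) mult_ac)
qed

lemma eval_pair_right_line:
  fixes f :: "('a::finite + 'b::finite) real_mpoly"
  assumes "(UNIV :: 'b set) = {u}" "mpoly_degree f \<le> t"
  shows "\<exists>C. degree C \<le> t \<and> (\<forall>q. eval_pair f p q = poly C (q $ u))"
proof -
  have deg: "Poly_Mapping.lookup \<mu> i \<le> t" if "\<mu> \<in> Poly_Mapping.keys f" for \<mu> i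
    using lookup_le_mpoly_degree[OF that] assms(2) by (rule order.trans)
  obtain C where "degree C \<le> t" "\<forall>x. (\<Sum>\<mu>\<in>Poly_Mapping.keys f. (Poly_Mapping.lookup f \<mu> *
      (\<Prod>i\<in>UNIV. p $ i ^ Poly_Mapping.lookup \<mu> (Inl i))) * x ^ Poly_Mapping.lookup \<mu> (Inr u)) = poly C x"
    using exists_poly_of_monomials[of "Poly_Mapping.keys f" "\<lambda>\<mu>. Poly_Mapping.lookup \<mu> (Inr u)" t
        "\<lambda>\<mu>. Poly_Mapping.lookup f \<mu> * (\<Prod>i\<in>UNIV. p $ i ^ Poly_Mapping.lookup \<mu> (Inl i))", OF finite_keys deg] by blast
  then show ?thesis by (intro exI[of _ C]) (simp add: eval_pair_eq_sum assms(1) mult_ac)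
qed

lemma eval_pair_left_plane:
  fixes f :: "('a::finite + 'b::finite) real_mpoly"
  assumes "(UNIV :: 'a set) = {u, v}" "u \<noteq> v" "mpoly_degree f \<le> t"
  shows "\<exists>C. (\<forall>j. degree (C j) \<le> t) \<and> (\<forall>p. eval_pair f p q = poly (slice t C (p $ u)) (p $ v))"
proof -
  have deg: "Poly_Mapping.lookup \<mu> i \<le> t" if "\<mu> \<in> Poly_Mapping.keys f" for \<mu> i
    using lookup_le_mpoly_degree[OF that] assms(3) by (rule order.trans)
  obtain C where "\<forall>j. degree (C j) \<le> t" "\<forall>x y. (\<Sum>\<mu>\<in>Poly_Mapping.keys f. (Poly_Mapping.lookup f \<mu> *
      (\<Prod>j\<in>UNIV. q $ j ^ Poly_Mapping.lookup \<mu> (Inr j))) *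
      (x ^ Poly_Mapping.lookup \<mu> (Inl u) * y ^ Poly_Mapping.lookup \<mu> (Inl v))) = poly (slice t C x) y"
    using exists_slice_of_monomials[of "Poly_Mapping.keys f" "\<lambda>\<mu>. Poly_Mapping.lookup \<mu> (Inl u)" t
        "\<lambda>\<mu>. Poly_Mapping.lookup \<mu> (Inl v)" "\<lambda>\<mu>. Poly_Mapping.lookup f \<mu> * (\<Prod>j\<in>UNIV. q $ j ^ Poly_Mapping.lookup \<mu> (Inr j))", OF finite_keys deg deg] by blast
  then show ?thesis using assms(2)
    by (intro exI[of _ C]) (simp add: eval_pair_eq_sum assms(1) mult_ac)
qed

lemma eval_pair_right_plane:
  fixes f :: "('a::finite + 'b::finite) real_mpoly"
  assumes "(UNIV :: 'b set) = {u, v}" "u \<noteq> v" "mpoly_degree f \<le> t"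
  shows "\<exists>C. (\<forall>j. degree (C j) \<le> t) \<and> (\<forall>q. eval_pair f p q = poly (slice t C (q $ u)) (q $ v))"
proof -
  have deg: "Poly_Mapping.lookup \<mu> i \<le> t" if "\<mu> \<in> Poly_Mapping.keys f" for \<mu> i
    using lookup_le_mpoly_degree[OF that] assms(3) by (rule order.trans)
  obtain C where "\<forall>j. degree (C j) \<le> t" "\<forall>x y. (\<Sum>\<mu>\<in>Poly_Mapping.keys f. (Poly_Mapping.lookup f \<mu> *
      (\<Prod>i\<in>UNIV. p $ i ^ Poly_Mapping.lookup \<mu> (Inl i))) *
      (x ^ Poly_Mapping.lookup \<mu> (Inr u) * y ^ Poly_Mapping.lookup \<mu> (Inr v))) = poly (slice t C x) y"
    using exists_slice_of_monomials[of "Poly_Mapping.keys f" "\<lambda>\<mu>. Poly_Mapping.lookup \<mu> (Inr u)" t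
        "\<lambda>\<mu>. Poly_Mapping.lookup \<mu> (Inr v)" "\<lambda>\<mu>. Poly_Mapping.lookup f \<mu> * (\<Prod>i\<in>UNIV. p $ i ^ Poly_Mapping.lookup \<mu> (Inl i))", OF finite_keys deg deg] by blast
  then show ?thesis using assms(2)
    by (intro exI[of _ C]) (simp add: eval_pair_eq_sum assms(1) mult_ac)
qed

lemma semialgebraic_graphE:
  assumes "semialgebraic_graph t P Q E"
  obtains fs \<Phi> where "finite P" "finite Q" "E \<subseteq> P \<times> Q"
    "\<And>j. j < t \<Longrightarrow> mpoly_degree (fs ! j) \<le> t"
    "\<And>p q. p \<in> P \<Longrightarrow> q \<in> Q \<Longrightarrow> (p, q) \<in> E \<longleftrightarrow> \<Phi> (map (\<lambda>j. eval_pair (fs ! j) p q \<ge> 0) [0..<t])"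
proof -
  from assms obtain fs \<Phi> where f: "bipartite_graph P Q E" "length fs = t"
    "\<forall>f\<in>set fs. mpoly_degree f \<le> t"
    "\<forall>p\<in>P. \<forall>q\<in>Q. (p, q) \<in> E \<longleftrightarrow> \<Phi> (map (\<lambda>f. eval_pair f p q \<ge> 0) fs)"
    unfolding semialgebraic_graph_def by blast
  have "map (\<lambda>f. eval_pair f p q \<ge> 0) fs = map (\<lambda>j. eval_pair (fs ! j) p q \<ge> 0) [0..<t]" for p q
    using f(2) by (intro nth_equalityI) auto
  then show thesis using that[of fs \<Phi>] f by (auto simp: bipartite_graph_def)
qed

lemma exists_biclique_left:
  assumes "CARD('a::finite) = \<kappa>" "\<kappa> = 1 \<or> \<kappa> = 2" "t \<ge> 1"
  shows "\<exists>K>0. \<forall>(P :: (real ^ 'a) set) (Q :: (real ^ 'b::finite) set) E.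
    semialgebraic_graph t P Q E \<longrightarrow> E \<noteq> {} \<longrightarrow> biclique_bound K \<kappa> P Q E"
  using assms(2)
proof
  assume \<kappa>: "\<kappa> = 1"
  then obtain u where u: "(UNIV :: 'a set) = {u}" using assms(1) by (auto simp: card_1_singleton_iff)
  obtain K where "K > 0" and K: "\<forall>P Q E \<Phi> (val :: nat \<Rightarrow> real ^ 'a \<Rightarrow> real ^ 'b \<Rightarrow> real) (C :: nat \<Rightarrow> real ^ 'b \<Rightarrow> real poly) \<pi>.
    finite P \<longrightarrow> finite Q \<longrightarrow> E \<subseteq> P \<times> Q \<longrightarrow> E \<noteq> {} \<longrightarrow>
    (\<forall>p\<in>P. \<forall>q\<in>Q. (p, q) \<in> E \<longleftrightarrow> \<Phi> (map (\<lambda>j. val j p q \<ge> 0) [0..<t])) \<longrightarrow>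
    (\<forall>j<t. \<forall>q\<in>Q. degree (C j q) \<le> t \<and> (\<forall>p. val j p q = poly (C j q) (\<pi> p))) \<longrightarrow>
    biclique_bound K 1 P Q E"
    using exists_biclique_line[OF assms(3)] by blast
  have "biclique_bound K \<kappa> P Q E" if G: "semialgebraic_graph t P Q E" "E \<noteq> {}"
    for P :: "(real ^ 'a) set" and Q :: "(real ^ 'b) set" and E
  proof -
    from G(1) obtain fs \<Phi> where f: "finite P" "finite Q" "E \<subseteq> P \<times> Q"
      "\<And>j. j < t \<Longrightarrow> mpoly_degree (fs ! j) \<le> t"
      "\<And>p q. p \<in> P \<Longrightarrow> q \<in> Q \<Longrightarrow> (p, q) \<in> E \<longleftrightarrow> \<Phi> (map (\<lambda>j. eval_pair (fs ! j) p q \<ge> 0) [0..<t])"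
      by (rule semialgebraic_graphE) (rule that; assumption)
    define C where "C j q = (SOME C. degree C \<le> t \<and> (\<forall>p. eval_pair (fs ! j) p q = poly C (p $ u)))" for j q
    have "degree (C j q) \<le> t \<and> (\<forall>p. eval_pair (fs ! j) p q = poly (C j q) (p $ u))" if "j < t" for j q
      unfolding C_def by (rule someI_ex) (rule eval_pair_left_line[OF u f(4)[OF that]])
    then show ?thesis unfolding \<kappa>
      using K[rule_format, of P Q E \<Phi> "\<lambda>j. eval_pair (fs ! j)" C "\<lambda>p. p $ u"] f G(2) by blast
  qed
  then show ?thesis using \<open>K > 0\<close> by blast
next
  assume \<kappa>: "\<kappa> = 2"
  then obtain u v where u: "(UNIV :: 'a set) = {u, v}" "u \<noteq> v" using assms(1) by (auto simp: card_2_iff)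
  obtain K where "K > 0" and K: "\<forall>P Q E \<Phi> (val :: nat \<Rightarrow> real ^ 'a \<Rightarrow> real ^ 'b \<Rightarrow> real) (C :: nat \<Rightarrow> real ^ 'b \<Rightarrow> nat \<Rightarrow> real poly) \<pi>\<^sub>1 \<pi>\<^sub>2.
    finite P \<longrightarrow> finite Q \<longrightarrow> E \<subseteq> P \<times> Q \<longrightarrow> E \<noteq> {} \<longrightarrow>
    (\<forall>p\<in>P. \<forall>q\<in>Q. (p, q) \<in> E \<longleftrightarrow> \<Phi> (map (\<lambda>j. val j p q \<ge> 0) [0..<t])) \<longrightarrow>
    (\<forall>j<t. \<forall>q\<in>Q. (\<forall>i. degree (C j q i) \<le> t) \<and>
       (\<forall>p. val j p q = poly (slice t (C j q) (\<pi>\<^sub>1 p)) (\<pi>\<^sub>2 p))) \<longrightarrow>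
    biclique_bound K 2 P Q E"
    using exists_biclique_plane[OF assms(3)] by blast
  have "biclique_bound K \<kappa> P Q E" if G: "semialgebraic_graph t P Q E" "E \<noteq> {}"
    for P :: "(real ^ 'a) set" and Q :: "(real ^ 'b) set" and E
  proof -
    from G(1) obtain fs \<Phi> where f: "finite P" "finite Q" "E \<subseteq> P \<times> Q"
      "\<And>j. j < t \<Longrightarrow> mpoly_degree (fs ! j) \<le> t"
      "\<And>p q. p \<in> P \<Longrightarrow> q \<in> Q \<Longrightarrow> (p, q) \<in> E \<longleftrightarrow> \<Phi> (map (\<lambda>j. eval_pair (fs ! j) p q \<ge> 0) [0..<t])"
      by (rule semialgebraic_graphE) (rule that; assumption)
    define C where "C j q = (SOME C. (\<forall>i. degree (C i) \<le> t) \<and>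
      (\<forall>p. eval_pair (fs ! j) p q = poly (slice t C (p $ u)) (p $ v)))" for j q
    have "(\<forall>i. degree (C j q i) \<le> t) \<and> (\<forall>p. eval_pair (fs ! j) p q = poly (slice t (C j q) (p $ u)) (p $ v))"
      if "j < t" for j q
      unfolding C_def by (rule someI_ex[OF eval_pair_left_plane[where q = q, OF u f(4)[OF that]]])
    then show ?thesis unfolding \<kappa>
      using K[rule_format, of P Q E \<Phi> "\<lambda>j. eval_pair (fs ! j)" C "\<lambda>p. p $ u" "\<lambda>p. p $ v"] f G(2) by blast
  qed
  then show ?thesis using \<open>K > 0\<close> by blast
qed

text \<open>The sides are exchanged: \<open>Q\<close> is now the side of low dimension, and the
  edges are reversed.\<close>

lemma exists_biclique_right:
  assumes "CARD('b::finite) = \<kappa>" "\<kappa> = 1 \<or> \<kappa> = 2" "t \<ge> 1"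
  shows "\<exists>K>0. \<forall>(P :: (real ^ 'a::finite) set) (Q :: (real ^ 'b) set) E.
    semialgebraic_graph t P Q E \<longrightarrow> E \<noteq> {} \<longrightarrow> biclique_bound K \<kappa> Q P (E\<inverse>)"
  using assms(2)
proof
  assume \<kappa>: "\<kappa> = 1"
  then obtain u where u: "(UNIV :: 'b set) = {u}" using assms(1) by (auto simp: card_1_singleton_iff)
  obtain K where "K > 0" and K: "\<forall>P Q E \<Phi> (val :: nat \<Rightarrow> real ^ 'b \<Rightarrow> real ^ 'a \<Rightarrow> real) (C :: nat \<Rightarrow> real ^ 'a \<Rightarrow> real poly) \<pi>.
    finite P \<longrightarrow> finite Q \<longrightarrow> E \<subseteq> P \<times> Q \<longrightarrow> E \<noteq> {} \<longrightarrow>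
    (\<forall>p\<in>P. \<forall>q\<in>Q. (p, q) \<in> E \<longleftrightarrow> \<Phi> (map (\<lambda>j. val j p q \<ge> 0) [0..<t])) \<longrightarrow>
    (\<forall>j<t. \<forall>q\<in>Q. degree (C j q) \<le> t \<and> (\<forall>p. val j p q = poly (C j q) (\<pi> p))) \<longrightarrow>
    biclique_bound K 1 P Q E"
    using exists_biclique_line[OF assms(3)] by blast
  have "biclique_bound K \<kappa> Q P (E\<inverse>)" if G: "semialgebraic_graph t P Q E" "E \<noteq> {}"
    for P :: "(real ^ 'a) set" and Q :: "(real ^ 'b) set" and E
  proof -
    from G(1) obtain fs \<Phi> where f: "finite P" "finite Q" "E \<subseteq> P \<times> Q"
      "\<And>j. j < t \<Longrightarrow> mpoly_degree (fs ! j) \<le> t"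
      "\<And>p q. p \<in> P \<Longrightarrow> q \<in> Q \<Longrightarrow> (p, q) \<in> E \<longleftrightarrow> \<Phi> (map (\<lambda>j. eval_pair (fs ! j) p q \<ge> 0) [0..<t])"
      by (rule semialgebraic_graphE) (rule that; assumption)
    have E: "E\<inverse> \<subseteq> Q \<times> P" "E\<inverse> \<noteq> {}" using f(3) G(2) by auto
    have rel: "\<forall>q\<in>Q. \<forall>p\<in>P. (q, p) \<in> E\<inverse> \<longleftrightarrow> \<Phi> (map (\<lambda>j. eval_pair (fs ! j) p q \<ge> 0) [0..<t])"
      using f(5) by simp
    define C where "C j p = (SOME C. degree C \<le> t \<and> (\<forall>q. eval_pair (fs ! j) p q = poly C (q $ u)))" for j p
    have "degree (C j p) \<le> t \<and> (\<forall>q. eval_pair (fs ! j) p q = poly (C j p) (q $ u))" if "j < t" for j p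
      unfolding C_def by (rule someI_ex) (rule eval_pair_right_line[OF u f(4)[OF that]])
    then show ?thesis unfolding \<kappa>
      using K[rule_format, of Q P "E\<inverse>" \<Phi> "\<lambda>j q p. eval_pair (fs ! j) p q" C "\<lambda>q. q $ u"] f(1,2) E rel by blast
  qed
  then show ?thesis using \<open>K > 0\<close> by blast
next
  assume \<kappa>: "\<kappa> = 2"
  then obtain u v where u: "(UNIV :: 'b set) = {u, v}" "u \<noteq> v" using assms(1) by (auto simp: card_2_iff)
  obtain K where "K > 0" and K: "\<forall>P Q E \<Phi> (val :: nat \<Rightarrow> real ^ 'b \<Rightarrow> real ^ 'a \<Rightarrow> real) (C :: nat \<Rightarrow> real ^ 'a \<Rightarrow> nat \<Rightarrow> real poly) \<pi>\<^sub>1 \<pi>\<^sub>2.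
    finite P \<longrightarrow> finite Q \<longrightarrow> E \<subseteq> P \<times> Q \<longrightarrow> E \<noteq> {} \<longrightarrow>
    (\<forall>p\<in>P. \<forall>q\<in>Q. (p, q) \<in> E \<longleftrightarrow> \<Phi> (map (\<lambda>j. val j p q \<ge> 0) [0..<t])) \<longrightarrow>
    (\<forall>j<t. \<forall>q\<in>Q. (\<forall>i. degree (C j q i) \<le> t) \<and>
       (\<forall>p. val j p q = poly (slice t (C j q) (\<pi>\<^sub>1 p)) (\<pi>\<^sub>2 p))) \<longrightarrow>
    biclique_bound K 2 P Q E"
    using exists_biclique_plane[OF assms(3)] by blast
  have "biclique_bound K \<kappa> Q P (E\<inverse>)" if G: "semialgebraic_graph t P Q E" "E \<noteq> {}"
    for P :: "(real ^ 'a) set" and Q :: "(real ^ 'b) set" and E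
  proof -
    from G(1) obtain fs \<Phi> where f: "finite P" "finite Q" "E \<subseteq> P \<times> Q"
      "\<And>j. j < t \<Longrightarrow> mpoly_degree (fs ! j) \<le> t"
      "\<And>p q. p \<in> P \<Longrightarrow> q \<in> Q \<Longrightarrow> (p, q) \<in> E \<longleftrightarrow> \<Phi> (map (\<lambda>j. eval_pair (fs ! j) p q \<ge> 0) [0..<t])"
      by (rule semialgebraic_graphE) (rule that; assumption)
    have E: "E\<inverse> \<subseteq> Q \<times> P" "E\<inverse> \<noteq> {}" using f(3) G(2) by auto
    have rel: "\<forall>q\<in>Q. \<forall>p\<in>P. (q, p) \<in> E\<inverse> \<longleftrightarrow> \<Phi> (map (\<lambda>j. eval_pair (fs ! j) p q \<ge> 0) [0..<t])"
      using f(5) by simp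
    define C where "C j p = (SOME C. (\<forall>i. degree (C i) \<le> t) \<and>
      (\<forall>q. eval_pair (fs ! j) p q = poly (slice t C (q $ u)) (q $ v)))" for j p
    have "(\<forall>i. degree (C j p i) \<le> t) \<and> (\<forall>q. eval_pair (fs ! j) p q = poly (slice t (C j p) (q $ u)) (q $ v))"
      if "j < t" for j p
      unfolding C_def by (rule someI_ex[OF eval_pair_right_plane[where p = p, OF u f(4)[OF that]]])
    then show ?thesis unfolding \<kappa>
      using K[rule_format, of Q P "E\<inverse>" \<Phi> "\<lambda>j q p. eval_pair (fs ! j) p q" C "\<lambda>q. q $ u" "\<lambda>q. q $ v"]
        f(1,2) E rel by blast
  qed
  then show ?thesis using \<open>K > 0\<close> by blast
qed

section \<open>Exponents\<close>

text \<open>Half of the exponent 2 \<epsilon> L beats the square, the other half the constant: c = 1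
  + 2 / \<epsilon> gives 1 + L \<le> c (1 + \<epsilon> L / 2) \<le> c exp (\<epsilon> L / 2), and K
  c^2 \<le> exp (\<epsilon> L) from L = ln (K c^2) / \<epsilon> on.\<close>

lemma log_square_le_exp:
  fixes \<epsilon> K :: real
  assumes "\<epsilon> > 0" "K > 0"
  shows "\<exists>L0. \<forall>L\<ge>L0. L \<ge> 0 \<longrightarrow> K * (1 + L)\<^sup>2 \<le> exp (2 * \<epsilon> * L)"
proof (intro exI allI impI)
  define c where "c = 1 + 2 / \<epsilon>"
  have c: "c > 0" using assms by (simp add: c_def add_pos_pos)
  fix L :: real assume L: "L \<ge> ln (K * c\<^sup>2) / \<epsilon>" "L \<ge> 0"
  have e: "exp (\<epsilon> * L / 2) \<ge> 1 + \<epsilon> * L / 2" by (rule exp_ge_add_one_self)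
  have "1 + L \<le> c * (1 + \<epsilon> * L / 2)" using assms L(2) by (simp add: c_def field_simps)
  also have "\<dots> \<le> c * exp (\<epsilon> * L / 2)" using e c by (intro mult_left_mono) auto
  finally have "(1 + L)\<^sup>2 \<le> (c * exp (\<epsilon> * L / 2))\<^sup>2" using L(2) by (intro power_mono) auto
  also have "\<dots> = c\<^sup>2 * exp (\<epsilon> * L)" by (simp add: power_mult_distrib flip: exp_double)
  finally have "K * (1 + L)\<^sup>2 \<le> K * (c\<^sup>2 * exp (\<epsilon> * L))" using assms by (intro mult_left_mono) auto
  also have "\<dots> = exp (ln (K * c\<^sup>2)) * exp (\<epsilon> * L)" using assms c by simp
  also have "\<dots> \<le> exp (\<epsilon> * L) * exp (\<epsilon> * L)"
    using L(1) assms by (intro mult_right_mono) (auto simp: field_simps simp del: exp_ln)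
  also have "\<dots> = exp (2 * \<epsilon> * L)" by (simp flip: exp_add)
  finally show "K * (1 + L)\<^sup>2 \<le> exp (2 * \<epsilon> * L)" .
qed

text \<open>Here x = ln m, y = ln n, and exp z bounds the denominator of the biclique. For \<kappa>
  = 1 the form in the larger of x and y works. For \<kappa> = 2 the form in x works if 2 y \<le> x.
  Otherwise 2 \<alpha> + \<beta> = 2 and \<beta> \<ge> 1/2, and without the \<epsilon> terms the
  first form exceeds z by (2 \<beta> - 1) (y - x / 2).\<close>

lemma exponent_cases:
  fixes \<kappa> d :: nat and x y \<epsilon> \<alpha> \<beta> :: real
  assumes \<kappa>: "\<kappa> = 1 \<or> \<kappa> = 2" and d: "d \<ge> 2" and pos: "x \<ge> 0" "y \<ge> 0" "\<epsilon> > 0"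
    and \<alpha>: "\<alpha> = (real \<kappa> * real d - real d) / (real \<kappa> * real d - 1)"
    and \<beta>: "\<beta> = (real \<kappa> * real d - real \<kappa>) / (real \<kappa> * real d - 1)"
    and z: "z = (2 - 1 / \<kappa>) * x + y + 2 * \<epsilon> * max x y"
  shows "z \<le> 2 * (\<alpha> + \<epsilon>) * x + 2 * (\<beta> + \<epsilon>) * y \<or> z \<le> (2 + 2 * \<epsilon>) * y \<or> z \<le> (2 + 2 * \<epsilon>) * x"
  using \<kappa>
proof
  assume "\<kappa> = 1"
  then have "z = x + y + 2 * \<epsilon> * max x y" using z by simp
  then show ?thesis by (cases "x \<le> y") (simp_all add: max_def algebra_simps)
next
  assume k: "\<kappa> = 2"
  show ?thesis
  proof (cases "2 * y \<le> x")
    case True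
    then have "max x y = x" using pos by simp
    then have "z = 3 / 2 * x + y + 2 * \<epsilon> * x" using z k by simp
    then show ?thesis using True by (simp add: algebra_simps)
  next
    case False
    define D where "D = 2 * real d - 1"
    have D: "D > 0" using d by (simp add: D_def)
    have "\<beta> = (2 * real d - 2) / D" "\<alpha> = real d / D" using k \<alpha> \<beta> by (simp_all add: D_def)
    then have DD: "D * \<beta> = 2 * real d - 2" "D * \<alpha> = real d" using D by simp_all
    have "D * (2 * \<alpha> + \<beta>) = 2 * (D * \<alpha>) + D * \<beta>" by (simp add: algebra_simps)
    also have "\<dots> = D * 2" unfolding DD by (simp add: D_def)
    finally have ab: "2 * \<alpha> + \<beta> = 2" using D by simp
    have "D * (1 / 2) \<le> D * \<beta>" unfolding DD using d by (simp add: D_def)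
    then have "\<beta> \<ge> 1 / 2" using D by (rule mult_left_le_imp_le)
    note ab = ab this
    have "(2 * \<beta> - 1) * (y - x / 2) \<ge> 0" using ab False by (intro mult_nonneg_nonneg) auto
    moreover have "2 * \<alpha> * x = (2 - \<beta>) * x" using ab by (metis add_diff_cancel_right')
    ultimately have "3 / 2 * x + y \<le> 2 * \<alpha> * x + 2 * \<beta> * y" by (simp add: algebra_simps)
    moreover have "2 * \<epsilon> * max x y \<le> 2 * \<epsilon> * (x + y)" using pos by (intro mult_left_mono) auto
    moreover have "z = 3 / 2 * x + y + 2 * \<epsilon> * max x y" using z k by simp
    ultimately show ?thesis by (simp add: algebra_simps)
  qed
qed

text \<open>Without the \<epsilon> terms the difference of the sides is (2 \<beta> - 1) (y - x) + (2
  \<alpha> + 2 \<beta> - 3) x. The last coefficient is nonnegative exactly if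
  (\<open>d\<^sub>1\<close> - 2) (\<open>d\<^sub>2\<close> - 2) \<ge> 1, which explains the
  dimension 3.\<close>

lemma exponent_star:
  fixes d\<^sub>1 d\<^sub>2 :: nat and x y \<epsilon> \<alpha> \<beta> :: real
  assumes d: "d\<^sub>1 \<ge> 3" "d\<^sub>2 \<ge> 3" and xy: "0 \<le> x" "x \<le> y" "\<epsilon> > 0"
    and \<alpha>: "\<alpha> = (real d\<^sub>1 * real d\<^sub>2 - real d\<^sub>2) / (real d\<^sub>1 * real d\<^sub>2 - 1)"
    and \<beta>: "\<beta> = (real d\<^sub>1 * real d\<^sub>2 - real d\<^sub>1) / (real d\<^sub>1 * real d\<^sub>2 - 1)"
  shows "2 * x + y \<le> 2 * (\<alpha> + \<epsilon>) * x + 2 * (\<beta> + \<epsilon>) * y"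
proof -
  define D where "D = real d\<^sub>1 * real d\<^sub>2 - 1"
  have "3 * 3 \<le> real d\<^sub>1 * real d\<^sub>2" using d by (intro mult_mono) auto
  then have D: "D > 0" by (simp add: D_def)
  have p: "(real d\<^sub>1 - 3) * (real d\<^sub>2 - 3) \<ge> 0" "real d\<^sub>1 * (real d\<^sub>2 - 3) \<ge> 0" using d by (auto intro: mult_nonneg_nonneg)
  have DD: "D * \<alpha> = real d\<^sub>1 * real d\<^sub>2 - real d\<^sub>2" "D * \<beta> = real d\<^sub>1 * real d\<^sub>2 - real d\<^sub>1"
    unfolding \<alpha> \<beta> D_def[symmetric] using D by simp_all
  have p': "real d\<^sub>1 * real d\<^sub>2 \<ge> 3 * real d\<^sub>1 + 3 * real d\<^sub>2 - 9" "real d\<^sub>1 * real d\<^sub>2 \<ge> 3 * real d\<^sub>1"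
    "real d\<^sub>1 \<ge> 3" "real d\<^sub>2 \<ge> 3"
    using p d by (simp_all add: algebra_simps)
  have "D * 1 \<le> 2 * (D * \<beta>)" unfolding DD using p' by (simp add: D_def)
  then have "D * 1 \<le> D * (2 * \<beta>)" by (simp only: mult.left_commute)
  then have b: "2 * \<beta> \<ge> 1" using D by (rule mult_left_le_imp_le)
  have "D * 3 \<le> 2 * (D * \<alpha>) + 2 * (D * \<beta>)" unfolding DD using p' by (simp add: D_def)
  then have "D * 3 \<le> D * (2 * \<alpha> + 2 * \<beta>)" by (simp only: mult.left_commute distrib_left)
  then have ab: "2 * \<alpha> + 2 * \<beta> \<ge> 3" using D by (rule mult_left_le_imp_le)
  have "(2 * \<beta> - 1) * (y - x) \<ge> 0" "(2 * \<alpha> + 2 * \<beta> - 3) * x \<ge> 0" "\<epsilon> * x \<ge> 0" "\<epsilon> * y \<ge> 0"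
    using b ab xy by (auto intro!: mult_nonneg_nonneg)
  then show ?thesis by (simp add: algebra_simps)
qed

text \<open>The three forms bounding \<open>z\<close> are the logarithms of the denominators of the
  three entries, taken with numerator I^2.\<close>

lemma Min_le_of_biclique:
  fixes I den W z \<alpha> \<beta> \<epsilon> :: real and m n :: nat
  assumes mn: "m > 0" "n > 0" and W: "I\<^sup>2 / den \<le> W" and den: "0 < den" "den \<le> exp z"
    and z: "z \<le> 2 * (\<alpha> + \<epsilon>) * ln m + 2 * (\<beta> + \<epsilon>) * ln n \<or> z \<le> (2 + 2 * \<epsilon>) * ln n \<or> z \<le> (2 + 2 * \<epsilon>) * ln m"
  shows "Min {(I / (real m powr (\<alpha> + \<epsilon>) * real n powr (\<beta> + \<epsilon>)))\<^sup>2,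
     I\<^sup>2 / real n powr (2 + 2 * \<epsilon>), I\<^sup>2 / real m powr (2 + 2 * \<epsilon>)} \<le> W"
proof -
  have key: "I\<^sup>2 / exp u \<le> W" if "z \<le> u" for u
  proof -
    have "den \<le> exp u" using den(2) that by (meson exp_le_cancel_iff order.trans)
    then have "I\<^sup>2 / exp u \<le> I\<^sup>2 / den" using den(1) by (intro divide_left_mono) auto
    then show ?thesis using W by linarith
  qed
  have 1: "(I / (real m powr (\<alpha> + \<epsilon>) * real n powr (\<beta> + \<epsilon>)))\<^sup>2 =
      I\<^sup>2 / exp (2 * (\<alpha> + \<epsilon>) * ln m + 2 * (\<beta> + \<epsilon>) * ln n)"
  proof -
    have "(real m powr (\<alpha> + \<epsilon>) * real n powr (\<beta> + \<epsilon>))\<^sup>2 = (exp ((\<alpha> + \<epsilon>) * ln m + (\<beta> + \<epsilon>) * ln n))\<^sup>2"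
      using mn by (simp add: powr_def exp_add)
    also have "\<dots> = exp (2 * ((\<alpha> + \<epsilon>) * ln m + (\<beta> + \<epsilon>) * ln n))" by (rule exp_double[symmetric])
    finally show ?thesis by (simp add: power_divide algebra_simps)
  qed
  have 2: "I\<^sup>2 / real n powr (2 + 2 * \<epsilon>) = I\<^sup>2 / exp ((2 + 2 * \<epsilon>) * ln n)"
          "I\<^sup>2 / real m powr (2 + 2 * \<epsilon>) = I\<^sup>2 / exp ((2 + 2 * \<epsilon>) * ln m)"
    using mn by (simp_all add: powr_def)
  show ?thesis using z key unfolding 1 2 by (subst Min_le_iff) auto
qed

text \<open>The larger logarithm appears because, in each case of \<open>exponent_cases\<close>, the
  \<epsilon> part of the form that is used is at least 2 \<epsilon> times this maximum.\<close>

lemma biclique_denominator_le: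
  fixes m n \<kappa> :: nat
  assumes "m > 0" "n > 0" "K > 0" "\<kappa> \<ge> 1"
    and "K * (1 + max (ln m) (ln n))\<^sup>2 \<le> exp (2 * \<epsilon> * max (ln m) (ln n))"
  shows "K * (m * real m powr (1 - 1 / \<kappa>) * n * (1 + ln m)\<^sup>2)
      \<le> exp ((2 - 1 / \<kappa>) * ln m + ln n + 2 * \<epsilon> * max (ln m) (ln n))"
    and "0 < K * (m * real m powr (1 - 1 / \<kappa>) * n * (1 + ln m)\<^sup>2)"
proof -
  have ln: "ln (real m) \<ge> 0" "ln (real n) \<ge> 0" using assms by auto
  have e: "m * real m powr (1 - 1 / \<kappa>) * n = exp ((2 - 1 / \<kappa>) * ln m + ln n)"
  proof -
    have "exp ((2 - 1 / \<kappa>) * ln m + ln n) = exp (ln m + (1 - 1 / \<kappa>) * ln m + ln n)"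
      by (simp add: algebra_simps)
    also have "\<dots> = m * real m powr (1 - 1 / \<kappa>) * n" using assms by (simp add: exp_add powr_def)
    finally show ?thesis by simp
  qed
  have "(1 + ln m)\<^sup>2 \<le> (1 + max (ln m) (ln n))\<^sup>2" using ln by (intro power_mono) auto
  then have "K * (1 + ln m)\<^sup>2 \<le> exp (2 * \<epsilon> * max (ln m) (ln n))"
    using assms(3,5) by (meson less_imp_le mult_left_mono order.trans)
  then have "exp ((2 - 1 / \<kappa>) * ln m + ln n) * (K * (1 + ln m)\<^sup>2) \<le>
      exp ((2 - 1 / \<kappa>) * ln m + ln n) * exp (2 * \<epsilon> * max (ln m) (ln n))"
    by (intro mult_left_mono) auto
  then show "K * (m * real m powr (1 - 1 / \<kappa>) * n * (1 + ln m)\<^sup>2)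
      \<le> exp ((2 - 1 / \<kappa>) * ln m + ln n + 2 * \<epsilon> * max (ln m) (ln n))"
    unfolding e by (simp add: mult_ac exp_add)
  have "(1 + ln (real m))\<^sup>2 > 0" using ln by (intro zero_less_power) linarith
  then show "0 < K * (m * real m powr (1 - 1 / \<kappa>) * n * (1 + ln m)\<^sup>2)"
    using assms by (intro mult_pos_pos) auto
qed

text \<open>The assumption forces C \<le> card E \<le> m n, whereas m n would be at most exp (2 max
  L 0) < C if both logarithms were below L.\<close>

lemma ln_card_ge:
  fixes P :: "'p set" and Q :: "'q set" and L C \<epsilon> X :: real
  assumes "finite P" "finite Q" "E \<subseteq> P \<times> Q" "E \<noteq> {}" "\<epsilon> > 0" "X \<ge> 0"
    and C: "C = exp (2 * max L 0) + 1"
    and I: "C * (X + real (card P) powr (1 + \<epsilon>) + real (card Q) powr (1 + \<epsilon>)) \<le> real (card E)"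
  shows "max (ln (card P)) (ln (card Q)) \<ge> L"
proof (rule ccontr)
  assume less: "\<not> ?thesis"
  have ne: "card P > 0" "card Q > 0" using assms by (auto simp: card_gt_0_iff)
  then have "1 \<le> real (card P) powr (1 + \<epsilon>)" using assms by (intro ge_one_powr_ge_zero) auto
  moreover have "0 \<le> real (card Q) powr (1 + \<epsilon>)" by simp
  ultimately have "1 \<le> X + real (card P) powr (1 + \<epsilon>) + real (card Q) powr (1 + \<epsilon>)"
    using \<open>X \<ge> 0\<close> by linarith
  then have "C * 1 \<le> C * (X + real (card P) powr (1 + \<epsilon>) + real (card Q) powr (1 + \<epsilon>))"
    by (intro mult_left_mono) (auto simp: C add_nonneg_nonneg)
  with I have "C \<le> card E" by linarith
  also have "card E \<le> card (P \<times> Q)" using assms by (intro card_mono) auto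
  then have "real (card E) \<le> real (card P) * real (card Q)"
    by (metis card_cartesian_product of_nat_le_iff of_nat_mult)
  also have "\<dots> = exp (ln (card P) + ln (card Q))" using ne by (simp add: exp_add)
  also have "\<dots> \<le> exp (2 * max L 0)" using less by simp
  finally show False by (simp add: C)
qed

text \<open>Some vertex has degree at least I / m; combined with I \<le> m n this makes I^2 at most
  m^2 n times that degree.\<close>

lemma exists_star:
  assumes "finite P" "finite Q" "E \<subseteq> P \<times> Q" "E \<noteq> {}"
  shows "\<exists>A B. A \<subseteq> P \<and> B \<subseteq> Q \<and> A \<times> B \<subseteq> E \<and>
    (real (card E))\<^sup>2 / exp (2 * ln (card P) + ln (card Q)) \<le> real (card A * card B)"
proof -
  have ne: "card P > 0" "card Q > 0" using assms by (auto simp: card_gt_0_iff)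
  obtain p where p: "p \<in> P" "card E \<le> card P * card {q\<in>Q. (p, q) \<in> E}"
    using exists_max_degree[of P Q E] assms by blast
  define B where "B = {q\<in>Q. (p, q) \<in> E}"
  have EB: "real (card E) \<le> real (card P) * real (card B)"
    using p(2) unfolding B_def by (metis of_nat_le_iff of_nat_mult)
  have "card E \<le> card (P \<times> Q)" using assms by (intro card_mono) auto
  then have EPQ: "real (card E) \<le> real (card P) * real (card Q)"
    by (metis card_cartesian_product of_nat_le_iff of_nat_mult)
  have "(real (card E))\<^sup>2 \<le> (real (card P) * real (card Q)) * (real (card P) * real (card B))"
    unfolding power2_eq_square using EB EPQ by (intro mult_mono) auto
  also have "\<dots> = exp (2 * ln (card P) + ln (card Q)) * card B"
    using ne by (simp add: exp_add exp_double power2_eq_square)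
  finally have "(real (card E))\<^sup>2 / exp (2 * ln (card P) + ln (card Q)) \<le> card B"
    by (simp add: divide_le_eq mult.commute)
  then show ?thesis using p(1)
    by (intro exI[of _ "{p}"] exI[of _ B]) (auto simp: B_def)
qed


section \<open>Assembling the cases of the theorem\<close>

definition Min_bound :: "real \<Rightarrow> real \<Rightarrow> real \<Rightarrow> nat \<Rightarrow> nat \<Rightarrow> nat \<Rightarrow> real" where
  "Min_bound \<alpha> \<beta> \<epsilon> m n I = Min {(real I / (real m powr (\<alpha> + \<epsilon>) * real n powr (\<beta> + \<epsilon>)))\<^sup>2,
     (real I)\<^sup>2 / real n powr (2 + 2 * \<epsilon>), (real I)\<^sup>2 / real m powr (2 + 2 * \<epsilon>)}"

lemma Min_bound_commute: "Min_bound \<alpha> \<beta> \<epsilon> m n I = Min_bound \<beta> \<alpha> \<epsilon> n m I"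
  by (simp add: Min_bound_def mult.commute insert_commute)

lemma biclique_bound_imp_Min:
  fixes d \<kappa> :: nat
  assumes bb: "biclique_bound K \<kappa> P Q E" and K: "K > 0" and ne: "card P > 0" "card Q > 0"
    and \<kappa>: "\<kappa> = 1 \<or> \<kappa> = 2" and d: "d \<ge> 2" and "\<epsilon> > 0"
    and L: "K * (1 + max (ln (card P)) (ln (card Q)))\<^sup>2 \<le> exp (2 * \<epsilon> * max (ln (card P)) (ln (card Q)))"
    and \<alpha>: "\<alpha> = (real \<kappa> * real d - real d) / (real \<kappa> * real d - 1)"
    and \<beta>: "\<beta> = (real \<kappa> * real d - real \<kappa>) / (real \<kappa> * real d - 1)"
  shows "\<exists>A B. A \<subseteq> P \<and> B \<subseteq> Q \<and> A \<times> B \<subseteq> E \<and>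
    Min_bound \<alpha> \<beta> \<epsilon> (card P) (card Q) (card E) \<le> real (card A * card B)"
proof -
  define m n where "m = card P" and "n = card Q"
  define z where "z = (2 - 1 / real \<kappa>) * ln (real m) + ln (real n) + 2 * \<epsilon> * max (ln (real m)) (ln (real n))"
  obtain A B where AB: "A \<subseteq> P" "B \<subseteq> Q" "A \<times> B \<subseteq> E"
    "(real (card E))\<^sup>2 / (K * (m * real m powr (1 - 1 / \<kappa>) * n * (1 + ln m)\<^sup>2)) \<le> real (card A * card B)"
    using bb unfolding biclique_bound_def m_def n_def by blast
  have mn: "m > 0" "n > 0" using ne by (simp_all add: m_def n_def)
  have k1: "\<kappa> \<ge> 1" using \<kappa> by auto
  note den = biclique_denominator_le[OF mn K k1 L[folded m_def n_def]]
  have "ln (real m) \<ge> 0" "ln (real n) \<ge> 0" using mn by auto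
  note exponent_cases[OF \<kappa> d this \<open>\<epsilon> > 0\<close> \<alpha> \<beta> z_def]
  from Min_le_of_biclique[OF mn AB(4) den(2) den(1)[folded z_def] this]
  have "Min_bound \<alpha> \<beta> \<epsilon> m n (card E) \<le> real (card A * card B)" by (simp only: Min_bound_def)
  then show ?thesis using AB(1-3) unfolding m_def n_def by blast
qed

lemma star_imp_Min:
  fixes d\<^sub>1 d\<^sub>2 :: nat
  assumes "finite P" "finite Q" "E \<subseteq> P \<times> Q" "E \<noteq> {}" and d: "d\<^sub>1 \<ge> 3" "d\<^sub>2 \<ge> 3" and "\<epsilon> > 0"
    and le: "card P \<le> card Q"
    and \<alpha>: "\<alpha> = (real d\<^sub>1 * real d\<^sub>2 - real d\<^sub>2) / (real d\<^sub>1 * real d\<^sub>2 - 1)"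
    and \<beta>: "\<beta> = (real d\<^sub>1 * real d\<^sub>2 - real d\<^sub>1) / (real d\<^sub>1 * real d\<^sub>2 - 1)"
  shows "\<exists>A B. A \<subseteq> P \<and> B \<subseteq> Q \<and> A \<times> B \<subseteq> E \<and>
    Min_bound \<alpha> \<beta> \<epsilon> (card P) (card Q) (card E) \<le> real (card A * card B)"
proof -
  have ne: "card P > 0" "card Q > 0" using assms by (auto simp: card_gt_0_iff)
  obtain A B where AB: "A \<subseteq> P" "B \<subseteq> Q" "A \<times> B \<subseteq> E"
    "(real (card E))\<^sup>2 / exp (2 * ln (card P) + ln (card Q)) \<le> real (card A * card B)"
    using exists_star[OF assms(1-4)] by blast
  have "0 \<le> ln (real (card P))" "ln (real (card P)) \<le> ln (real (card Q))" using ne le by auto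
  note exponent_star[OF d this \<open>\<epsilon> > 0\<close> \<alpha> \<beta>]
  from Min_le_of_biclique[OF ne AB(4) exp_gt_zero order_refl disjI1[OF this]]
  have "Min_bound \<alpha> \<beta> \<epsilon> (card P) (card Q) (card E) \<le> real (card A * card B)"
    by (simp only: Min_bound_def)
  then show ?thesis using AB(1-3) by blast
qed

lemma biclique_converse:
  assumes "\<exists>A B. A \<subseteq> Q \<and> B \<subseteq> P \<and> A \<times> B \<subseteq> E\<inverse> \<and>
    Min_bound \<beta> \<alpha> \<epsilon> (card Q) (card P) (card (E\<inverse>)) \<le> real (card A * card B)"
  shows "\<exists>A B. A \<subseteq> P \<and> B \<subseteq> Q \<and> A \<times> B \<subseteq> E \<and>
    Min_bound \<alpha> \<beta> \<epsilon> (card P) (card Q) (card E) \<le> real (card A * card B)"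
proof -
  obtain A B where AB: "A \<subseteq> Q" "B \<subseteq> P" "A \<times> B \<subseteq> E\<inverse>"
    "Min_bound \<beta> \<alpha> \<epsilon> (card Q) (card P) (card (E\<inverse>)) \<le> real (card A * card B)"
    using assms by blast
  then have "B \<times> A \<subseteq> E" by blast
  moreover have "Min_bound \<alpha> \<beta> \<epsilon> (card P) (card Q) (card E) \<le> real (card B * card A)"
    using AB(4) by (simp add: Min_bound_commute[of \<beta> \<alpha>] mult.commute)
  ultimately show ?thesis using AB(1,2) by blast
qed

lemma semialgebraic_biclique:
  fixes d\<^sub>1 d\<^sub>2 t :: nat and \<epsilon> \<alpha> \<beta> :: real
  assumes d: "d\<^sub>1 = CARD('a::finite)" "d\<^sub>2 = CARD('b::finite)" "d\<^sub>1 * d\<^sub>2 \<noteq> 1" and "t > 0" "\<epsilon> > 0"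
    and \<alpha>: "\<alpha> = (real d\<^sub>1 * real d\<^sub>2 - real d\<^sub>2) / (real d\<^sub>1 * real d\<^sub>2 - 1)"
    and \<beta>: "\<beta> = (real d\<^sub>1 * real d\<^sub>2 - real d\<^sub>1) / (real d\<^sub>1 * real d\<^sub>2 - 1)"
  shows "\<exists>L. \<forall>(P :: (real ^ 'a) set) (Q :: (real ^ 'b) set) E.
    semialgebraic_graph t P Q E \<longrightarrow> E \<noteq> {} \<longrightarrow> L \<le> max (ln (card P)) (ln (card Q)) \<longrightarrow>
    (\<exists>A B. A \<subseteq> P \<and> B \<subseteq> Q \<and> A \<times> B \<subseteq> E \<and>
       Min_bound \<alpha> \<beta> \<epsilon> (card P) (card Q) (card E) \<le> real (card A * card B))"
proof -
  have t1: "t \<ge> 1" using \<open>t > 0\<close> by simp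
  have dpos: "d\<^sub>1 > 0" "d\<^sub>2 > 0" using d by (simp_all add: card_gt_0_iff)
  have basic: "finite P \<and> finite Q \<and> E \<subseteq> P \<times> Q \<and> card P > 0 \<and> card Q > 0 \<and>
      0 \<le> max (ln (real (card P))) (ln (real (card Q)))"
    if "semialgebraic_graph t P Q E" "E \<noteq> {}" for P :: "(real ^ 'a) set" and Q :: "(real ^ 'b) set" and E
  proof -
    have f: "finite P" "finite Q" "E \<subseteq> P \<times> Q"
      using that(1) by (auto simp: semialgebraic_graph_def bipartite_graph_def)
    then have c: "card P > 0" "card Q > 0" using that(2) by (auto simp: card_gt_0_iff)
    then have "0 \<le> ln (real (card P))" by simp
    then show ?thesis using f c by (simp add: le_max_iff_disj)
  qed
  \<comment> \<open>The dimensions are not both 1, so next to a dimension 1 or 2 the other one can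
    be taken to be at least 2, as \<open>exponent_cases\<close> demands.\<close>
  consider "d\<^sub>1 = 1 \<or> d\<^sub>1 = 2" "d\<^sub>2 \<ge> 2" | "d\<^sub>2 = 1 \<or> d\<^sub>2 = 2" "d\<^sub>1 \<ge> 2" | "d\<^sub>1 \<ge> 3" "d\<^sub>2 \<ge> 3"
  proof -
    have "d\<^sub>1 \<noteq> 1 \<or> d\<^sub>2 \<noteq> 1" using d(3) by auto
    then show thesis using that dpos by linarith
  qed
  then show ?thesis
  proof cases
    case 1
    obtain K where K: "K > 0" "\<forall>(P :: (real ^ 'a) set) (Q :: (real ^ 'b) set) E.
        semialgebraic_graph t P Q E \<longrightarrow> E \<noteq> {} \<longrightarrow> biclique_bound K d\<^sub>1 P Q E"
      using exists_biclique_left[OF d(1)[symmetric] 1(1) t1] by blast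
    obtain L where L: "\<And>x. L \<le> x \<Longrightarrow> 0 \<le> x \<Longrightarrow> K * (1 + x)\<^sup>2 \<le> exp (2 * \<epsilon> * x)"
      using log_square_le_exp[OF \<open>\<epsilon> > 0\<close> K(1)] by blast
    show ?thesis
    proof (intro exI[of _ L] allI impI)
      fix P :: "(real ^ 'a) set" and Q :: "(real ^ 'b) set" and E
      assume G: "semialgebraic_graph t P Q E" "E \<noteq> {}"
        and big: "L \<le> max (ln (real (card P))) (ln (real (card Q)))"
      show "\<exists>A B. A \<subseteq> P \<and> B \<subseteq> Q \<and> A \<times> B \<subseteq> E \<and>
         Min_bound \<alpha> \<beta> \<epsilon> (card P) (card Q) (card E) \<le> real (card A * card B)"
        using basic[OF G] K G
        by (intro biclique_bound_imp_Min[OF _ K(1) _ _ 1 \<open>\<epsilon> > 0\<close> L[OF big] \<alpha> \<beta>]) auto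
    qed
  next
    case 2
    obtain K where K: "K > 0" "\<forall>(P :: (real ^ 'a) set) (Q :: (real ^ 'b) set) E.
        semialgebraic_graph t P Q E \<longrightarrow> E \<noteq> {} \<longrightarrow> biclique_bound K d\<^sub>2 Q P (E\<inverse>)"
      using exists_biclique_right[OF d(2)[symmetric] 2(1) t1] by blast
    obtain L where L: "\<And>x. L \<le> x \<Longrightarrow> 0 \<le> x \<Longrightarrow> K * (1 + x)\<^sup>2 \<le> exp (2 * \<epsilon> * x)"
      using log_square_le_exp[OF \<open>\<epsilon> > 0\<close> K(1)] by blast
    have \<alpha>': "\<beta> = (real d\<^sub>2 * real d\<^sub>1 - real d\<^sub>1) / (real d\<^sub>2 * real d\<^sub>1 - 1)"
      and \<beta>': "\<alpha> = (real d\<^sub>2 * real d\<^sub>1 - real d\<^sub>2) / (real d\<^sub>2 * real d\<^sub>1 - 1)"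
      by (simp_all add: \<alpha> \<beta> mult.commute)
    show ?thesis
    proof (intro exI[of _ L] allI impI)
      fix P :: "(real ^ 'a) set" and Q :: "(real ^ 'b) set" and E
      assume G: "semialgebraic_graph t P Q E" "E \<noteq> {}"
        and "L \<le> max (ln (real (card P))) (ln (real (card Q)))"
      then have big: "L \<le> max (ln (real (card Q))) (ln (real (card P)))" by (simp add: max.commute)
      have nn: "0 \<le> max (ln (real (card Q))) (ln (real (card P)))" using basic[OF G] by (simp add: max.commute)
      show "\<exists>A B. A \<subseteq> P \<and> B \<subseteq> Q \<and> A \<times> B \<subseteq> E \<and>
         Min_bound \<alpha> \<beta> \<epsilon> (card P) (card Q) (card E) \<le> real (card A * card B)"
        using basic[OF G] K G
        by - (rule biclique_converse,
          rule biclique_bound_imp_Min[OF _ K(1) _ _ 2 \<open>\<epsilon> > 0\<close> L[OF big nn] \<alpha>' \<beta>']; blast)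
    qed
  next
    case 3
    have \<alpha>': "\<beta> = (real d\<^sub>2 * real d\<^sub>1 - real d\<^sub>1) / (real d\<^sub>2 * real d\<^sub>1 - 1)"
      and \<beta>': "\<alpha> = (real d\<^sub>2 * real d\<^sub>1 - real d\<^sub>2) / (real d\<^sub>2 * real d\<^sub>1 - 1)"
      by (simp_all add: \<alpha> \<beta> mult.commute)
    show ?thesis
    \<comment> \<open>The star bound carries no logarithm, so any threshold will do.\<close>
    proof (intro exI[of _ "0::real"] allI impI)
      fix P :: "(real ^ 'a) set" and Q :: "(real ^ 'b) set" and E
      assume G: "semialgebraic_graph t P Q E" "E \<noteq> {}"
      show "\<exists>A B. A \<subseteq> P \<and> B \<subseteq> Q \<and> A \<times> B \<subseteq> E \<and>
         Min_bound \<alpha> \<beta> \<epsilon> (card P) (card Q) (card E) \<le> real (card A * card B)"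
      \<comment> \<open>The centre of the star is taken on the smaller side, since
        \<open>exponent_star\<close> assumes x \<le> y.\<close>
      proof (cases "card P \<le> card Q")
        case True
        then show ?thesis using basic[OF G] G(2)
          by (intro star_imp_Min[OF _ _ _ _ 3 \<open>\<epsilon> > 0\<close> True \<alpha> \<beta>]) auto
      next
        case False
        then have "card Q \<le> card P" by simp
        show ?thesis
          by (rule biclique_converse, rule star_imp_Min[OF _ _ _ _ 3(2,1) \<open>\<epsilon> > 0\<close> \<open>card Q \<le> card P\<close> \<alpha>' \<beta>'])
            (use basic[OF G] G(2) in auto)
      qed
    qed
  qed
qed

theorem corollary1p12:
  fixes d\<^sub>1 d\<^sub>2 t :: nat and \<epsilon> :: real
  assumes "d\<^sub>1 = CARD('a::finite)" and "d\<^sub>2 = CARD('b::finite)"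
    and "t > 0" and "d\<^sub>1 * d\<^sub>2 \<noteq> 1" and "\<epsilon> > 0"
  shows "\<exists>C::real. C > 0 \<and>
    (\<forall>(P :: (real ^ 'a) set) (Q :: (real ^ 'b) set) E (m::nat) (n::nat) (I::nat) \<alpha> \<beta>.
       semialgebraic_graph t P Q E \<longrightarrow>
       m = card P \<longrightarrow> n = card Q \<longrightarrow> I = card E \<longrightarrow>
       \<alpha> = (real d\<^sub>1 * real d\<^sub>2 - real d\<^sub>2) / (real d\<^sub>1 * real d\<^sub>2 - 1) \<longrightarrow>
       \<beta> = (real d\<^sub>1 * real d\<^sub>2 - real d\<^sub>1) / (real d\<^sub>1 * real d\<^sub>2 - 1) \<longrightarrow>
       real I \<ge> C * (real m powr (\<alpha> + \<epsilon>) * real n powr (\<beta> + \<epsilon>)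
                      + real m powr (1 + \<epsilon>) + real n powr (1 + \<epsilon>)) \<longrightarrow>
       (\<exists>u\<^sub>1 u\<^sub>2 :: nat. contains_complete_bipartite P Q E u\<^sub>1 u\<^sub>2 \<and>
          real (u\<^sub>1 * u\<^sub>2) \<ge>
            Min {(real I / (real m powr (\<alpha> + \<epsilon>) * real n powr (\<beta> + \<epsilon>)))\<^sup>2,
                 (real I)\<^sup>2 / real n powr (2 + 2 * \<epsilon>),
                 (real I)\<^sup>2 / real m powr (2 + 2 * \<epsilon>)}))"
proof -
  define \<alpha> \<beta> where "\<alpha> = (real d\<^sub>1 * real d\<^sub>2 - real d\<^sub>2) / (real d\<^sub>1 * real d\<^sub>2 - 1)"
    and "\<beta> = (real d\<^sub>1 * real d\<^sub>2 - real d\<^sub>1) / (real d\<^sub>1 * real d\<^sub>2 - 1)"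
  obtain L where L: "\<forall>(P :: (real ^ 'a) set) (Q :: (real ^ 'b) set) E.
    semialgebraic_graph t P Q E \<longrightarrow> E \<noteq> {} \<longrightarrow> L \<le> max (ln (card P)) (ln (card Q)) \<longrightarrow>
    (\<exists>A B. A \<subseteq> P \<and> B \<subseteq> Q \<and> A \<times> B \<subseteq> E \<and>
       Min_bound \<alpha> \<beta> \<epsilon> (card P) (card Q) (card E) \<le> real (card A * card B))"
    using semialgebraic_biclique[OF assms(1,2,4,3,5) \<alpha>_def \<beta>_def] by blast
  define C where "C = exp (2 * max L 0) + 1"
  have main: "\<exists>u\<^sub>1 u\<^sub>2 :: nat. contains_complete_bipartite P Q E u\<^sub>1 u\<^sub>2 \<and>
      Min_bound \<alpha> \<beta> \<epsilon> (card P) (card Q) (card E) \<le> real (u\<^sub>1 * u\<^sub>2)"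
    if G: "semialgebraic_graph t P Q E"
      and I: "C * (real (card P) powr (\<alpha> + \<epsilon>) * real (card Q) powr (\<beta> + \<epsilon>)
        + real (card P) powr (1 + \<epsilon>) + real (card Q) powr (1 + \<epsilon>)) \<le> real (card E)"
    for P :: "(real ^ 'a) set" and Q :: "(real ^ 'b) set" and E
  proof (cases "E = {}")
    case True
    \<comment> \<open>Without edges all three entries of the minimum are 0, even where a denominator
      is 0, so the empty biclique suffices.\<close>
    have "contains_complete_bipartite P Q E 0 0"
      unfolding contains_complete_bipartite_def by (intro exI[of _ "{}"]) simp
    moreover have "Min_bound \<alpha> \<beta> \<epsilon> (card P) (card Q) (card E) \<le> real (0 * 0)"
      using True by (simp add: Min_bound_def)
    ultimately show ?thesis by blast
  next
    case False
    have fin: "finite P" "finite Q" "E \<subseteq> P \<times> Q"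
      using G by (auto simp: semialgebraic_graph_def bipartite_graph_def)
    have "L \<le> max (ln (real (card P))) (ln (real (card Q)))"
      by (rule ln_card_ge[OF fin False assms(5) _ C_def I]) simp
    from L[rule_format, OF G False this]
    obtain A B where "A \<subseteq> P" "B \<subseteq> Q" "A \<times> B \<subseteq> E"
      "Min_bound \<alpha> \<beta> \<epsilon> (card P) (card Q) (card E) \<le> real (card A * card B)"
      by blast
    then show ?thesis unfolding contains_complete_bipartite_def by blast
  qed
  show ?thesis
  proof (rule exI[of _ C], intro conjI allI impI)
    show "C > 0" by (simp add: C_def add_pos_pos)
    fix P :: "(real ^ 'a) set" and Q :: "(real ^ 'b) set" and E and m n I :: nat and a b :: real
    assume G: "semialgebraic_graph t P Q E" and eqs: "m = card P" "n = card Q" "I = card E"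
      "a = (real d\<^sub>1 * real d\<^sub>2 - real d\<^sub>2) / (real d\<^sub>1 * real d\<^sub>2 - 1)"
      "b = (real d\<^sub>1 * real d\<^sub>2 - real d\<^sub>1) / (real d\<^sub>1 * real d\<^sub>2 - 1)"
      and I: "C * (real m powr (a + \<epsilon>) * real n powr (b + \<epsilon>)
        + real m powr (1 + \<epsilon>) + real n powr (1 + \<epsilon>)) \<le> real I"
    show "\<exists>u\<^sub>1 u\<^sub>2 :: nat. contains_complete_bipartite P Q E u\<^sub>1 u\<^sub>2 \<and>
        Min {(real I / (real m powr (a + \<epsilon>) * real n powr (b + \<epsilon>)))\<^sup>2,
             (real I)\<^sup>2 / real n powr (2 + 2 * \<epsilon>),
             (real I)\<^sup>2 / real m powr (2 + 2 * \<epsilon>)} \<le> real (u\<^sub>1 * u\<^sub>2)"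
      using main[OF G I[unfolded eqs, folded \<alpha>_def \<beta>_def]]
      unfolding eqs \<alpha>_def[symmetric] \<beta>_def[symmetric] Min_bound_def .
  qed
qed

end
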